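(* Let $R$ be a commutative ring with unit, let $D$ be an oriented link diagram, choose a collection of $m\ge 1$ crossings of $D$ numbered $1,\dots,m$, and let $D_{(k)},\widetilde D_{(k)}$ ($0\le k\le m$) and the integers $A_k,B_k$ ($0\le k\le m$), $\widetilde a_k,\widetilde b_k$ ($1\le k\le m$) be the diagrams and constants associated with this choice as defined in the context. Fix an integer $j$. Then there is a spectral sequence $(E_r^{*,*},\ d_r\colon E_r^{s,t}\to E_r^{s+r,t-r+1})$ converging to the Khovanov homology $KH^{*,j}(D;R)$ with $E_1$-page given by $$E_1^{s,t}=\begin{cases} KH^{\,s+t+A_s+\widetilde a_{s+1},\ j+B_s+\widetilde b_{s+1}}(\widetilde D_{(s+1)};R) & s=0,\dots,m-1,\\[2pt] KH^{\,m+t+A_m,\ j+B_m}(D_{(m)};R) & s=m,\\[2pt] 0 & s<0\ \text{or}\ s>m.\end{cases}$$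
   Context: **Khovanov complex.** Let $D$ be an oriented link diagram with $n$ crossings, $n^+$ of them positive and $n^-$ negative. The $2^n$ smoothings of $D$ are indexed by $\alpha\in\{0,1\}^n$ (each crossing receives its 0-smoothing or its 1-smoothing; the 0-smoothing is the oriented resolution at a positive crossing, the 1-smoothing is the oriented resolution at a negative crossing). Let $V$ be the graded free $R$-module of rank two with generators $1$ in degree $1$ and $x$ in degree $-1$. For a graded module $W$ put $(W\{l\})^m=W^{m-l}$. Let $V_\alpha=V^{\otimes k_\alpha}\{r_\alpha\}$, where $k_\alpha$ is the number of circles in the smoothing $\alpha$ and $r_\alpha$ is the number of 1's in $\alpha$. The unnormalised complex is $\overline C^{i,*}(D)=\bigoplus_{r_\alpha=i}V_\alpha$, with the standard Khovanov cube differential (of bidegree $(1,0)$) built from the Frobenius algebra structure on $V$ with multiplication $1\cdot1=1$, $1\cdot x=x\cdot 1=x$, $x^2=0$ and comultiplication $1\mapsto 1\otimes x+x\otimes 1$, $x\mapsto x\otimes x$. For a bigraded module, $(W^{*,*}[l]\{m\})^{i,j}=W^{i-l,j-m}$. The normalised Khovanov complex is $C^{i,j}(D)=(\overline C^{*,*}(D)[-n^-]\{n^+-2n^-\})^{i,j}$, and $KH^{i,j}(D;R)$ is its homology. **The diagrams.** For $k=1,\dots,m$, $D_{(k)}$ is the diagram obtained from $D$ by resolving crossings $1,\dots,k$ to 1-smoothings, and $\widetilde D_{(k)}$ is obtained from $D$ by resolving crossings $1,\dots,k-1$ to 1-smoothings and crossing $k$ to a 0-smoothing. Also $D_{(0)}=\widetilde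 D_{(0)}=D$. **Orientations.** $D_{(0)}=D$ has its given orientation. Inductively, given an orientation of $D_{(k-1)}$: if the $k$-th crossing is positive (in the oriented diagram $D_{(k-1)}$), then $\widetilde D_{(k)}$ inherits the orientation of $D_{(k-1)}$, and $D_{(k)}$ is given an arbitrarily chosen orientation; if the $k$-th crossing is negative, then $D_{(k)}$ inherits the orientation, and $\widetilde D_{(k)}$ is given an arbitrarily chosen orientation. **The constants.** Let $n_k^{\pm}$ be the numbers of positive/negative crossings of $D_{(k)}$ and $\widetilde n_k^{\pm}$ those of $\widetilde D_{(k)}$. If the $k$-th crossing is positive (in $D_{(k-1)}$), set $a_k=n_{k-1}^--n_k^--1$ and $\widetilde a_k=0$. If it is negative, set $a_k=0$ and $\widetilde a_k=n_{k-1}^--\widetilde n_k^-$. In both cases set $b_k=3a_k+1$ and $\widetilde b_k=3\widetilde a_k-1$. Finally $A_k=\sum_{i=1}^k a_i$ and $B_k=\sum_{i=1}^k b_i=3A_k+k$, with $A_0=B_0=0$. *)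

theory Defs
  imports "HOL-Algebra.Module" "HOL-Algebra.AbelCoset" "HOL-Combinatorics.Orbits"
    "HOL-Library.FuncSet"
begin

section \<open>Link diagrams\<close>

text \<open>
  A link diagram on the sphere is given by its underlying 4-valent plane graph, as a rotation
  system. Every vertex \<open>v\<close> has four ends \<open>(v,0), (v,1), (v,2), (v,3)\<close>, listed
  counterclockwise and such that \<open>(v,0)\<close> and \<open>(v,2)\<close> belong to the under-strand; this is the
  convention of planar diagram codes \<open>X[a,b,c,d]\<close>. The arcs of the graph are the pairs
  \<open>{e, glue D e}\<close>.

  A vertex \<open>v\<close> with \<open>resolved D v = None\<close> is a crossing of the diagram. If
  \<open>resolved D v = Some b\<close>, the crossing at \<open>v\<close> has been replaced by its 0-smoothing
  (\<open>b = False\<close>) or 1-smoothing (\<open>b = True\<close>), so \<open>v\<close> is no longer a crossing and two strands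
  pass by each other there. Resolving crossings thus stays within the same type. Components
  without crossings are covered too: a circle is a 1-smoothed vertex with \<open>(v,0)\<close> glued to
  \<open>(v,1)\<close> and \<open>(v,2)\<close> glued to \<open>(v,3)\<close>.
\<close>

type_synonym vertex_end = "nat \<times> nat"

record diagram =
  vertices :: "nat set"
  glue :: "vertex_end \<Rightarrow> vertex_end"
  resolved :: "nat \<Rightarrow> bool option"

definition ends :: "diagram \<Rightarrow> vertex_end set" where
  "ends D = vertices D \<times> {0..<4}"

definition crossings :: "diagram \<Rightarrow> nat set" where
  "crossings D = {v \<in> vertices D. resolved D v = None}"

definition resolve :: "diagram \<Rightarrow> nat \<Rightarrow> bool \<Rightarrow> diagram" where
  "resolve D v b = D\<lparr>resolved := (resolved D)(v := Some b)\<rparr>"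

definition next_end :: "vertex_end \<Rightarrow> vertex_end" where
  "next_end e = (fst e, (snd e + 1) mod 4)"

definition opposite_end :: "vertex_end \<Rightarrow> vertex_end" where
  "opposite_end e = (fst e, (snd e + 2) mod 4)"

text \<open>
  The 0-smoothing joins \<open>0\<close> with \<open>1\<close> and \<open>2\<close> with \<open>3\<close>: it merges the two regions
  swept out when the over-strand is turned counterclockwise. The 1-smoothing joins \<open>1\<close>
  with \<open>2\<close> and \<open>3\<close> with \<open>0\<close>.
\<close>

definition smoothed_end :: "bool \<Rightarrow> vertex_end \<Rightarrow> vertex_end" where
  "smoothed_end b e = (fst e, if b then 3 - snd e else if even (snd e) then snd e + 1 else snd e - 1)"

definition arcs :: "diagram \<Rightarrow> vertex_end set set" where
  "arcs D = {{e, glue D e} |e. e \<in> ends D}"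

definition faces :: "diagram \<Rightarrow> vertex_end set set" where
  "faces D = orbit (next_end \<circ> glue D) ` ends D"

definition components :: "diagram \<Rightarrow> vertex_end set set" where
  "components D = ends D // {(e, f). e \<in> ends D \<and> (f = glue D e \<or> f = next_end e)}\<^sup>*"

text \<open>Planarity is expressed by Euler's formula (every connected component has genus 0).\<close>

definition planar :: "diagram \<Rightarrow> bool" where
  "planar D \<longleftrightarrow>
     int (card (vertices D)) - int (card (arcs D)) + int (card (faces D)) = 2 * int (card (components D))"

definition link_diagram :: "diagram \<Rightarrow> bool" where
  "link_diagram D \<longleftrightarrow>
     finite (vertices D) \<and>
     (\<forall>e\<in>ends D. glue D e \<in> ends D \<and> glue D e \<noteq> e \<and> glue D (glue D e) = e) \<and>
     planar D"

text \<open>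
  An orientation is given by the set of those ends at which the strand is directed into the
  vertex.
\<close>

type_synonym orient = "vertex_end set"

definition through :: "diagram \<Rightarrow> vertex_end \<Rightarrow> vertex_end" where
  "through D e = (case resolved D (fst e) of None \<Rightarrow> opposite_end e | Some b \<Rightarrow> smoothed_end b e)"

definition orientation :: "diagram \<Rightarrow> orient \<Rightarrow> bool" where
  "orientation D \<omega> \<longleftrightarrow>
     \<omega> \<subseteq> ends D \<and>
     (\<forall>e\<in>ends D. (glue D e \<in> \<omega> \<longleftrightarrow> e \<notin> \<omega>) \<and> (through D e \<in> \<omega> \<longleftrightarrow> e \<notin> \<omega>))"

text \<open>
  If the under-strand runs from \<open>0\<close> to \<open>2\<close>, the crossing is positive iff the over-strand
  runs from \<open>3\<close> to \<open>1\<close>, that is, iff the 0-smoothing is the oriented one.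
\<close>

definition positive_crossing :: "orient \<Rightarrow> nat \<Rightarrow> bool" where
  "positive_crossing \<omega> v \<longleftrightarrow> ((v,0) \<in> \<omega> \<longleftrightarrow> (v,3) \<in> \<omega>)"

definition n_pos :: "diagram \<Rightarrow> orient \<Rightarrow> int" where
  "n_pos D \<omega> = int (card {v \<in> crossings D. positive_crossing \<omega> v})"

definition n_neg :: "diagram \<Rightarrow> orient \<Rightarrow> int" where
  "n_neg D \<omega> = int (card {v \<in> crossings D. \<not> positive_crossing \<omega> v})"


section \<open>Homology of modules\<close>

text \<open>The fields \<open>mult\<close> and \<open>one\<close> of a module record carry no meaning.\<close>

definition free_module :: "('r, 'b) ring_scheme \<Rightarrow> 'x set \<Rightarrow> ('r, 'x \<Rightarrow> 'r) module" where
  "free_module R B =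
     \<lparr>carrier = {c. (\<forall>x\<in>B. c x \<in> carrier R) \<and> (\<forall>x. x \<notin> B \<longrightarrow> c x = \<zero>\<^bsub>R\<^esub>)},
      monoid.mult = undefined, one = undefined,
      zero = (\<lambda>_. \<zero>\<^bsub>R\<^esub>), add = (\<lambda>c c' x. c x \<oplus>\<^bsub>R\<^esub> c' x),
      smult = (\<lambda>r c x. r \<otimes>\<^bsub>R\<^esub> c x)\<rparr>"

definition quotient_module :: "('r, 'a) module \<Rightarrow> 'a set \<Rightarrow> ('r, 'a set) module" where
  "quotient_module M N =
     \<lparr>carrier = a_rcosets\<^bsub>M\<^esub> N, monoid.mult = undefined, one = undefined,
      zero = N, add = (\<lambda>X Y. X <+>\<^bsub>M\<^esub> Y),
      smult = (\<lambda>r X. \<Union>x\<in>X. N +>\<^bsub>M\<^esub> (r \<odot>\<^bsub>M\<^esub> x))\<rparr>"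

text \<open>The homology \<open>ker g / im f\<close> at the middle term of \<open>L \<rightarrow> M \<rightarrow> N\<close>, with maps \<open>f\<close>, \<open>g\<close>.\<close>

definition homology ::
  "('r, 'l) module \<Rightarrow> ('l \<Rightarrow> 'a) \<Rightarrow> ('r, 'a) module \<Rightarrow> ('a \<Rightarrow> 'n) \<Rightarrow> ('r, 'n) module
   \<Rightarrow> ('r, 'a set) module" where
  "homology L f M g N =
     quotient_module (M\<lparr>carrier := {x \<in> carrier M. g x = \<zero>\<^bsub>N\<^esub>}\<rparr>) (f ` carrier L)"

definition module_hom ::
  "('r, 'b) ring_scheme \<Rightarrow> ('r, 'a) module \<Rightarrow> ('r, 'n) module \<Rightarrow> ('a \<Rightarrow> 'n) set" where
  "module_hom R M N =
     {h \<in> carrier M \<rightarrow> carrier N.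
        (\<forall>x\<in>carrier M. \<forall>y\<in>carrier M. h (x \<oplus>\<^bsub>M\<^esub> y) = h x \<oplus>\<^bsub>N\<^esub> h y) \<and>
        (\<forall>r\<in>carrier R. \<forall>x\<in>carrier M. h (r \<odot>\<^bsub>M\<^esub> x) = r \<odot>\<^bsub>N\<^esub> h x)}"

definition module_iso ::
  "('r, 'b) ring_scheme \<Rightarrow> ('r, 'a) module \<Rightarrow> ('r, 'n) module \<Rightarrow> bool" where
  "module_iso R M N \<longleftrightarrow> (\<exists>h\<in>module_hom R M N. bij_betw h (carrier M) (carrier N))"


section \<open>The Khovanov complex\<close>

text \<open>
  A vertex \<open>\<alpha>\<close> of the cube is the set \<open>S\<close> of crossings receiving the 1-smoothing.
\<close>

definition state_end :: "diagram \<Rightarrow> nat set \<Rightarrow> vertex_end \<Rightarrow> vertex_end" where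
  "state_end D S e =
     smoothed_end (case resolved D (fst e) of None \<Rightarrow> fst e \<in> S | Some b \<Rightarrow> b) e"

definition state_rel :: "diagram \<Rightarrow> nat set \<Rightarrow> (vertex_end \<times> vertex_end) set" where
  "state_rel D S = {(e, f). e \<in> ends D \<and> (f = glue D e \<or> f = state_end D S e)}\<^sup>*"

definition circle :: "diagram \<Rightarrow> nat set \<Rightarrow> vertex_end \<Rightarrow> vertex_end set" where
  "circle D S e = state_rel D S `` {e}"

definition circles :: "diagram \<Rightarrow> nat set \<Rightarrow> vertex_end set set" where
  "circles D S = ends D // state_rel D S"

text \<open>The generators \<open>1\<close> and \<open>x\<close> of \<open>V\<close>, and the structure constants of \<open>V\<close>.\<close>

datatype gen = Gen_1 | Gen_x

fun gen_deg :: "gen \<Rightarrow> int" where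
  "gen_deg Gen_1 = 1"
| "gen_deg Gen_x = -1"

text \<open>\<open>mult_coeff R a b c\<close> is the coefficient of \<open>c\<close> in \<open>a \<cdot> b\<close>.\<close>

definition mult_coeff :: "('r, 'b) ring_scheme \<Rightarrow> gen \<Rightarrow> gen \<Rightarrow> gen \<Rightarrow> 'r" where
  "mult_coeff R a b c =
     (if (a, b, c) \<in> {(Gen_1, Gen_1, Gen_1), (Gen_1, Gen_x, Gen_x), (Gen_x, Gen_1, Gen_x)}
      then \<one>\<^bsub>R\<^esub> else \<zero>\<^bsub>R\<^esub>)"

text \<open>\<open>comult_coeff R a b c\<close> is the coefficient of \<open>b \<otimes> c\<close> in \<open>\<Delta> a\<close>.\<close>

definition comult_coeff :: "('r, 'b) ring_scheme \<Rightarrow> gen \<Rightarrow> gen \<Rightarrow> gen \<Rightarrow> 'r" where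
  "comult_coeff R a b c =
     (if (a, b, c) \<in> {(Gen_1, Gen_1, Gen_x), (Gen_1, Gen_x, Gen_1), (Gen_x, Gen_x, Gen_x)}
      then \<one>\<^bsub>R\<^esub> else \<zero>\<^bsub>R\<^esub>)"

text \<open>
  The module \<open>V\<^sub>\<alpha>\<close> is free on the pure tensors of generators, that is, on the labellings of
  the circles of \<open>S\<close> by generators. A basis element of the cube complex is a pair of a state
  \<open>S\<close> and such a labelling.
\<close>

type_synonym kgen = "nat set \<times> (vertex_end set \<Rightarrow> gen)"

definition kgens :: "diagram \<Rightarrow> kgen set" where
  "kgens D = (SIGMA S : Pow (crossings D). circles D S \<rightarrow>\<^sub>E UNIV)"

definition kgen_deg :: "diagram \<Rightarrow> kgen \<Rightarrow> int" where
  "kgen_deg D = (\<lambda>(S, \<epsilon>). (\<Sum>z\<in>circles D S. gen_deg (\<epsilon> z)) + int (card S))"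

text \<open>
  The edge map from \<open>S\<close> to \<open>insert v S\<close> affects only the circles through \<open>v\<close>. In the state
  \<open>S\<close> these are the circles of \<open>(v,0)\<close> and \<open>(v,2)\<close>, and likewise in the state \<open>insert v S\<close>.
  For a planar diagram these two circles are distinct in exactly one of the two states: they
  are either merged or split.
\<close>

definition edge_coeff ::
  "('r, 'b) ring_scheme \<Rightarrow> diagram \<Rightarrow> nat set \<Rightarrow> nat
   \<Rightarrow> (vertex_end set \<Rightarrow> gen) \<Rightarrow> (vertex_end set \<Rightarrow> gen) \<Rightarrow> 'r" where
  "edge_coeff R D S v \<epsilon> \<epsilon>' =
     (let a\<^sub>1 = circle D S (v,0); a\<^sub>2 = circle D S (v,2);
          b\<^sub>1 = circle D (insert v S) (v,0); b\<^sub>2 = circle D (insert v S) (v,2)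
      in if \<exists>z \<in> circles D S - {a\<^sub>1, a\<^sub>2}. \<epsilon> z \<noteq> \<epsilon>' z then \<zero>\<^bsub>R\<^esub>
         else if a\<^sub>1 \<noteq> a\<^sub>2 then mult_coeff R (\<epsilon> a\<^sub>1) (\<epsilon> a\<^sub>2) (\<epsilon>' b\<^sub>1)
         else comult_coeff R (\<epsilon> a\<^sub>1) (\<epsilon>' b\<^sub>1) (\<epsilon>' b\<^sub>2))"

text \<open>
  The matrix of the cube differential. The edge changing the crossing \<open>v\<close> carries the sign
  \<open>(-1)\<close> to the number of 1-smoothed crossings preceding \<open>v\<close>.
\<close>

definition diff_coeff :: "('r, 'b) ring_scheme \<Rightarrow> diagram \<Rightarrow> kgen \<Rightarrow> kgen \<Rightarrow> 'r" where
  "diff_coeff R D = (\<lambda>(S, \<epsilon>) (S', \<epsilon>').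
     if \<exists>v \<in> crossings D - S. S' = insert v S
     then let v = the_elem (S' - S)
          in (\<ominus>\<^bsub>R\<^esub> \<one>\<^bsub>R\<^esub>) [^]\<^bsub>R\<^esub> card {u \<in> S. u < v} \<otimes>\<^bsub>R\<^esub> edge_coeff R D S v \<epsilon> \<epsilon>'
     else \<zero>\<^bsub>R\<^esub>)"

definition kdiff :: "('r, 'b) ring_scheme \<Rightarrow> diagram \<Rightarrow> (kgen \<Rightarrow> 'r) \<Rightarrow> (kgen \<Rightarrow> 'r)" where
  "kdiff R D c =
     (\<lambda>y. if y \<in> kgens D then \<Oplus>\<^bsub>R\<^esub>x\<in>kgens D. diff_coeff R D x y \<otimes>\<^bsub>R\<^esub> c x else \<zero>\<^bsub>R\<^esub>)"

definition unnormalised_kchains ::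
  "('r, 'b) ring_scheme \<Rightarrow> diagram \<Rightarrow> int \<Rightarrow> int \<Rightarrow> ('r, kgen \<Rightarrow> 'r) module" where
  "unnormalised_kchains R D i j =
     free_module R {g \<in> kgens D. int (card (fst g)) = i \<and> kgen_deg D g = j}"

definition kchains ::
  "('r, 'b) ring_scheme \<Rightarrow> diagram \<Rightarrow> orient \<Rightarrow> int \<Rightarrow> int \<Rightarrow> ('r, kgen \<Rightarrow> 'r) module" where
  "kchains R D \<omega> i j =
     unnormalised_kchains R D (i - (- n_neg D \<omega>)) (j - (n_pos D \<omega> - 2 * n_neg D \<omega>))"

definition KH ::
  "('r, 'b) ring_scheme \<Rightarrow> diagram \<Rightarrow> orient \<Rightarrow> int \<Rightarrow> int \<Rightarrow> ('r, (kgen \<Rightarrow> 'r) set) module" where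
  "KH R D \<omega> i j =
     homology (kchains R D \<omega> (i - 1) j) (kdiff R D) (kchains R D \<omega> i j) (kdiff R D)
              (kchains R D \<omega> (i + 1) j)"


section \<open>Spectral sequences\<close>

definition spectral_sequence ::
  "('r, 'b) ring_scheme \<Rightarrow> (nat \<Rightarrow> int \<Rightarrow> int \<Rightarrow> ('r, 'e) module)
   \<Rightarrow> (nat \<Rightarrow> int \<Rightarrow> int \<Rightarrow> 'e \<Rightarrow> 'e) \<Rightarrow> bool" where
  "spectral_sequence R E d \<longleftrightarrow>
     (\<forall>r\<ge>1. \<forall>s t.
        module R (E r s t) \<and>
        d r s t \<in> module_hom R (E r s t) (E r (s + int r) (t - int r + 1)) \<and>
        (\<forall>x\<in>carrier (E r s t).
           d r (s + int r) (t - int r + 1) (d r s t x)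
             = \<zero>\<^bsub>E r (s + 2 * int r) (t - 2 * int r + 2)\<^esub>) \<and>
        module_iso R (E (r + 1) s t)
          (homology (E r (s - int r) (t + int r - 1)) (d r (s - int r) (t + int r - 1))
                    (E r s t) (d r s t)
                    (E r (s + int r) (t - int r + 1))))"

text \<open>
  Convergence to a graded module \<open>H\<close>: each \<open>H n\<close> has a finite decreasing filtration
  \<open>F p n\<close>, and at each \<open>(s,t)\<close> the differentials eventually vanish, so that the terms
  \<open>E r s t\<close> are eventually constant up to isomorphism, with the graded piece of the
  filtration as stable value.
\<close>

definition converges_to ::
  "('r, 'b) ring_scheme \<Rightarrow> (nat \<Rightarrow> int \<Rightarrow> int \<Rightarrow> ('r, 'e) module)
   \<Rightarrow> (nat \<Rightarrow> int \<Rightarrow> int \<Rightarrow> 'e \<Rightarrow> 'e) \<Rightarrow> (int \<Rightarrow> ('r, 'h) module) \<Rightarrow> bool" where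
  "converges_to R E d H \<longleftrightarrow>
     (\<forall>n. module R (H n)) \<and>
     (\<exists>F :: int \<Rightarrow> int \<Rightarrow> 'h set.
        (\<forall>p n. submodule (F p n) R (H n) \<and> F (p + 1) n \<subseteq> F p n) \<and>
        (\<forall>n. \<exists>p q. F p n = carrier (H n) \<and> F q n = {\<zero>\<^bsub>H n\<^esub>}) \<and>
        (\<forall>s t. \<exists>r\<^sub>0\<ge>1. \<forall>r\<ge>r\<^sub>0.
           (\<forall>x\<in>carrier (E r s t). d r s t x = \<zero>\<^bsub>E r (s + int r) (t - int r + 1)\<^esub>) \<and>
           (\<forall>x\<in>carrier (E r (s - int r) (t + int r - 1)).
              d r (s - int r) (t + int r - 1) x = \<zero>\<^bsub>E r s t\<^esub>) \<and>
           module_iso R (E r s t)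
             (quotient_module ((H (s + t))\<lparr>carrier := F s (s + t)\<rparr>) (F (s + 1) (s + t)))))"


section \<open>Resolving a sequence of crossings\<close>

text \<open>
  Here \<open>c k\<close> is the crossing numbered \<open>k\<close>; \<open>res_1 D c k\<close> is \<open>D\<^sub>(\<^sub>k\<^sub>)\<close> and
  \<open>res_0 D c k\<close> is its companion, in which the last crossing gets the 0-smoothing.
\<close>

fun res_1 :: "diagram \<Rightarrow> (nat \<Rightarrow> nat) \<Rightarrow> nat \<Rightarrow> diagram" where
  "res_1 D c 0 = D"
| "res_1 D c (Suc k) = resolve (res_1 D c k) (c (Suc k)) True"

fun res_0 :: "diagram \<Rightarrow> (nat \<Rightarrow> nat) \<Rightarrow> nat \<Rightarrow> diagram" where
  "res_0 D c 0 = D"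
| "res_0 D c (Suc k) = resolve (res_1 D c k) (c (Suc k)) False"

text \<open>
  \<open>\<omega> k\<close> and \<open>\<omega>' k\<close> are the orientations of \<open>res_1 D c k\<close> and \<open>res_0 D c k\<close>. The ends are
  not changed by resolving, so inheriting an orientation means that the sets are equal.
\<close>

definition tower_orientations ::
  "diagram \<Rightarrow> (nat \<Rightarrow> nat) \<Rightarrow> nat \<Rightarrow> (nat \<Rightarrow> orient) \<Rightarrow> (nat \<Rightarrow> orient) \<Rightarrow> bool" where
  "tower_orientations D c m \<omega> \<omega>' \<longleftrightarrow>
     orientation D (\<omega> 0) \<and> \<omega>' 0 = \<omega> 0 \<and>
     (\<forall>k\<in>{1..m}.
        orientation (res_1 D c k) (\<omega> k) \<and> orientation (res_0 D c k) (\<omega>' k) \<and>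
        (if positive_crossing (\<omega> (k - 1)) (c k) then \<omega>' k = \<omega> (k - 1) else \<omega> k = \<omega> (k - 1)))"

definition a_const :: "diagram \<Rightarrow> (nat \<Rightarrow> nat) \<Rightarrow> (nat \<Rightarrow> orient) \<Rightarrow> nat \<Rightarrow> int" where
  "a_const D c \<omega> k =
     (if positive_crossing (\<omega> (k - 1)) (c k)
      then n_neg (res_1 D c (k - 1)) (\<omega> (k - 1)) - n_neg (res_1 D c k) (\<omega> k) - 1
      else 0)"

definition a_tilde ::
  "diagram \<Rightarrow> (nat \<Rightarrow> nat) \<Rightarrow> (nat \<Rightarrow> orient) \<Rightarrow> (nat \<Rightarrow> orient) \<Rightarrow> nat \<Rightarrow> int" where
  "a_tilde D c \<omega> \<omega>' k =
     (if positive_crossing (\<omega> (k - 1)) (c k) then 0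
      else n_neg (res_1 D c (k - 1)) (\<omega> (k - 1)) - n_neg (res_0 D c k) (\<omega>' k))"

definition b_const :: "diagram \<Rightarrow> (nat \<Rightarrow> nat) \<Rightarrow> (nat \<Rightarrow> orient) \<Rightarrow> nat \<Rightarrow> int" where
  "b_const D c \<omega> k = 3 * a_const D c \<omega> k + 1"

definition b_tilde ::
  "diagram \<Rightarrow> (nat \<Rightarrow> nat) \<Rightarrow> (nat \<Rightarrow> orient) \<Rightarrow> (nat \<Rightarrow> orient) \<Rightarrow> nat \<Rightarrow> int" where
  "b_tilde D c \<omega> \<omega>' k = 3 * a_tilde D c \<omega> \<omega>' k - 1"

definition A_const :: "diagram \<Rightarrow> (nat \<Rightarrow> nat) \<Rightarrow> (nat \<Rightarrow> orient) \<Rightarrow> nat \<Rightarrow> int" where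
  "A_const D c \<omega> k = (\<Sum>i = 1..k. a_const D c \<omega> i)"

definition B_const :: "diagram \<Rightarrow> (nat \<Rightarrow> nat) \<Rightarrow> (nat \<Rightarrow> orient) \<Rightarrow> nat \<Rightarrow> int" where
  "B_const D c \<omega> k = (\<Sum>i = 1..k. b_const D c \<omega> i)"

end

theory Submission
  imports Defs
begin

text \<open>
  Filter the Khovanov complex of \<open>D\<close> by letting the \<open>s\<close>-th step be spanned by the states in which
  the crossings \<open>1, \<dots>, s\<close> all receive the 1-smoothing. The differential only adds 1-smoothings, so
  this is a finite filtration by subcomplexes, and its \<open>s\<close>-th graded piece is, up to edge signs and
  shifts, the Khovanov complex of the diagram with \<open>1, \<dots>, s\<close> 1-smoothed and \<open>s + 1\<close> 0-smoothed.
  The shifts agree because \<open>A\<^sub>s = n\<^sup>- - n\<^sub>s\<^sup>- - s\<close>.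

  That the cube is a complex at all rests on planarity: Euler's formula, applied to a double cover of
  the underlying graph, yields a source-sink structure, hence every edge of the cube merges or splits
  circles. The edge maps are then matrices of orientable cobordisms, which depend only on the genus.
\<close>

section \<open>Permutations and the genus inequality\<close>

text \<open>What threatens the cube is local: changing one smoothing might turn one circle into one
  circle, which neither multiplication nor comultiplication describes. Euler's formula, however, is
  a single count for the whole diagram. The bridge is that an unbranched double cover doubles the
  Euler characteristic, while no component contributes more than 2; so every component must lift
  twice, and its two sheets give a global two-colouring of the ends.

  Composites of edge maps are handled without a list of Frobenius identities. A matrix entry of a
  composite is a number of intermediate labellings, so commutativity of a face is an equality of
  cardinalities, valid over every ring at once.

  All chain groups are submodules of one module of functions on \<open>kgen\<close>, which keeps
  every page in one type.

  The factor 3 in the constants arises as follows: the quantum shift n^+ - 2 n^- is the number of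
  crossings minus 3 n^-, and the number of crossings ignores orientation. The chosen orientations
  therefore enter through n^- alone, once in the homological and three times in the quantum
  degree.\<close>

definition conn :: "('a \<times> 'a) set \<Rightarrow> ('a \<times> 'a) set" where
  "conn X = (X \<union> X\<inverse>)\<^sup>*"

definition graph_on :: "'a set \<Rightarrow> ('a \<Rightarrow> 'a) \<Rightarrow> ('a \<times> 'a) set" where
  "graph_on A f = (\<lambda>x. (x, f x)) ` A"

lemma conn_refl [simp]: "(x, x) \<in> conn X"
  by (simp add: conn_def)

lemma conn_sym: "(x, y) \<in> conn X \<Longrightarrow> (y, x) \<in> conn X"
  unfolding conn_def by (metis converse_Un converse_converse rtrancl_converseD sup_commute)

lemma conn_trans: "(x, y) \<in> conn X \<Longrightarrow> (y, z) \<in> conn X \<Longrightarrow> (x, z) \<in> conn X"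
  unfolding conn_def by simp

lemma equiv_conn: "equiv UNIV (conn X)"
  by (intro equivI refl_onI symI transI) (auto intro: conn_sym conn_trans)

lemma conn_base: "p \<in> X \<Longrightarrow> p \<in> conn X"
  unfolding conn_def by auto

lemma conn_induct [consumes 1, case_names refl step]:
  assumes "(a, b) \<in> conn X" "P a"
    and "\<And>y z. (a, y) \<in> conn X \<Longrightarrow> P y \<Longrightarrow> (y, z) \<in> X \<or> (z, y) \<in> X \<Longrightarrow> P z"
  shows "P b"
  using assms(1) unfolding conn_def
  by (induction rule: rtrancl_induct) (use assms(2,3) in \<open>auto simp: conn_def\<close>)

lemma conn_subset: "X \<subseteq> conn Y \<Longrightarrow> conn X \<subseteq> conn Y"
proof
  fix p assume X: "X \<subseteq> conn Y" and "p \<in> conn X"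
  then obtain a b where p: "p = (a, b)" "(a, b) \<in> conn X" by (cases p) auto
  from p(2) have "(a, b) \<in> conn Y"
    by (induction rule: conn_induct) (use X in \<open>auto intro: conn_trans conn_sym\<close>)
  then show "p \<in> conn Y" by (simp add: p)
qed

lemma conn_mono: "X \<subseteq> Y \<Longrightarrow> conn X \<subseteq> conn Y"
  by (rule conn_subset) (auto intro: conn_base)

lemma conn_eqI: "X \<subseteq> conn Y \<Longrightarrow> Y \<subseteq> conn X \<Longrightarrow> conn X = conn Y"
  by (simp add: conn_subset subset_antisym)

lemma conn_sym_rtrancl: "sym X \<Longrightarrow> conn X = X\<^sup>*"
  unfolding conn_def by (simp add: sym_conv_converse_eq)

lemma conn_class_eq_iff: "conn X `` {x} = conn X `` {y} \<longleftrightarrow> (x, y) \<in> conn X"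
  using equiv_class_eq_iff[OF equiv_conn, of x y X] by simp

lemma conn_insert_absorb: "(a, b) \<in> conn X \<Longrightarrow> conn (insert (a, b) X) = conn X"
  by (rule conn_eqI) (auto intro: conn_base)

text \<open>A path can be shortened until it crosses the new pair at most once, in one of two
  directions.\<close>

lemma conn_insert_iff:
  "(x, y) \<in> conn (insert (a, b) X) \<longleftrightarrow>
     (x, y) \<in> conn X \<or> (x, a) \<in> conn X \<and> (b, y) \<in> conn X \<or> (x, b) \<in> conn X \<and> (a, y) \<in> conn X"
proof
  assume "(x, y) \<in> conn (insert (a, b) X)"
  then show "(x, y) \<in> conn X \<or> (x, a) \<in> conn X \<and> (b, y) \<in> conn X \<or> (x, b) \<in> conn X \<and> (a, y) \<in> conn X"
  proof (induction rule: conn_induct)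
    case (step y z)
    have "(y, z) \<in> conn X \<or> y = a \<and> z = b \<or> y = b \<and> z = a"
      using step.hyps(2) conn_base conn_sym by fast
    then show ?case
      using step.IH by (elim disjE) (blast intro: conn_trans conn_refl)+
  qed simp
next
  have *: "conn X \<subseteq> conn (insert (a, b) X)" by (rule conn_mono) auto
  have "(a, b) \<in> conn (insert (a, b) X)" by (auto intro: conn_base)
  then show "(x, y) \<in> conn (insert (a, b) X)"
    if "(x, y) \<in> conn X \<or> (x, a) \<in> conn X \<and> (b, y) \<in> conn X \<or> (x, b) \<in> conn X \<and> (a, y) \<in> conn X"
    using that * by (meson conn_sym conn_trans subsetD)
qed

text \<open>The formula also covers the case of a single class: it is taken out and put back
  unchanged.\<close>

lemma quotient_conn_insert:
  assumes "a \<in> A" "b \<in> A"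
  shows "A // conn (insert (a, b) X) =
           insert (conn X `` {a} \<union> conn X `` {b}) (A // conn X - {conn X `` {a}, conn X `` {b}})"
proof -
  let ?Y = "insert (a, b) X" and ?U = "conn X `` {a} \<union> conn X `` {b}"
  have union: "conn ?Y `` {x} = ?U" if "(x, a) \<in> conn X \<or> (x, b) \<in> conn X" for x
    using that unfolding set_eq_iff Un_iff Image_singleton_iff conn_insert_iff
    by (elim disjE) (blast intro: conn_trans conn_sym conn_refl)+
  have keep: "conn ?Y `` {x} = conn X `` {x}" if "\<not> ((x, a) \<in> conn X \<or> (x, b) \<in> conn X)" for x
    using that by (auto simp: conn_insert_iff)
  show ?thesis
  proof (intro equalityI subsetI)
    fix C assume "C \<in> A // conn ?Y"
    then obtain x where x: "x \<in> A" "C = conn ?Y `` {x}" by (auto elim: quotientE)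
    show "C \<in> insert ?U (A // conn X - {conn X `` {a}, conn X `` {b}})"
    proof (cases "(x, a) \<in> conn X \<or> (x, b) \<in> conn X")
      case True then show ?thesis using union x by simp
    next
      case False
      then have "C = conn X `` {x}" using keep x by simp
      then show ?thesis using False x(1) by (auto simp: conn_class_eq_iff intro: quotientI)
    qed
  next
    fix C assume "C \<in> insert ?U (A // conn X - {conn X `` {a}, conn X `` {b}})"
    then consider "C = ?U" | x where "x \<in> A" "C = conn X `` {x}" "C \<noteq> conn X `` {a}" "C \<noteq> conn X `` {b}"
      by (metis Diff_iff insert_iff quotientE)
    then show "C \<in> A // conn ?Y"
    proof cases
      case 1
      then have "C = conn ?Y `` {a}" using union[of a] by simp
      then show ?thesis using assms by (auto intro: quotientI)
    next
      case 2
      then have "\<not> ((x, a) \<in> conn X \<or> (x, b) \<in> conn X)"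
        using conn_class_eq_iff[of X x] by metis
      then have "C = conn ?Y `` {x}"
        using keep[of x] 2(2) by metis
      then show ?thesis using 2(1) by (metis quotientI)
    qed
  qed
qed

lemma finite_quotient_conn: "finite A \<Longrightarrow> finite (A // conn X)"
  by (simp add: quotient_def)

text \<open>A class containing both points would relate them. Hence a merged class is new, and
  merging lowers the count by exactly one.\<close>

lemma union_conn_notin_quotient:
  assumes "(a, b) \<notin> conn X"
  shows "conn X `` {a} \<union> conn X `` {b} \<notin> A // conn X"
proof
  assume "conn X `` {a} \<union> conn X `` {b} \<in> A // conn X"
  then obtain x where "conn X `` {a} \<union> conn X `` {b} = conn X `` {x}" by (auto elim: quotientE)
  then have "a \<in> conn X `` {x}" "b \<in> conn X `` {x}" by (metis Image_singleton_iff UnCI conn_refl)+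
  then have "(x, a) \<in> conn X" "(x, b) \<in> conn X" by simp_all
  then show False using assms by (meson conn_sym conn_trans)
qed

lemma card_quotient_conn_insert:
  assumes "finite A" "a \<in> A" "b \<in> A"
  shows "card (A // conn (insert (a, b) X)) + (if (a, b) \<in> conn X then 0 else 1) = card (A // conn X)"
proof (cases "(a, b) \<in> conn X")
  case True then show ?thesis by (simp add: conn_insert_absorb)
next
  case False
  let ?Q = "A // conn X" and ?a = "conn X `` {a}" and ?b = "conn X `` {b}"
  have "?a \<noteq> ?b" using False by (simp add: conn_class_eq_iff)
  moreover have "?a \<in> ?Q" "?b \<in> ?Q" using assms by (auto intro: quotientI)
  moreover have "?a \<union> ?b \<notin> ?Q" by (rule union_conn_notin_quotient[OF False])
  moreover have "finite ?Q" using assms(1) by (rule finite_quotient_conn)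
  moreover have "card {?a, ?b} \<le> card ?Q" using calculation by (intro card_mono) auto
  ultimately show ?thesis using False
    by (simp add: quotient_conn_insert[OF assms(2,3)] card_Diff_subset)
qed

text \<open>An injective self-map of a finite set is a permutation, so a backward step is an
  iterated forward step and the classes are the cycles.\<close>

lemma conn_graph_on_funpow:
  assumes A: "finite A" "f \<in> A \<rightarrow> A" "inj_on f A" and "(a, b) \<in> conn (graph_on A f)" "a \<in> A"
  shows "\<exists>n. b = (f ^^ n) a"
proof -
  have pow: "(f ^^ n) x \<in> A" if "x \<in> A" for n x
    using that A(2) by (induction n) auto
  \<comment> \<open>Two iterates of \<open>x\<close> agree by the pigeonhole principle; cancelling
    the common power by injectivity yields a return to \<open>x\<close>.\<close>
  have per: "\<exists>n. (f ^^ n) (f x) = x" if x: "x \<in> A" for x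
  proof -
    have "\<not> inj_on (\<lambda>n. (f ^^ n) x) UNIV"
      using pow[OF x] A(1) by (metis finite_imageD finite_subset image_subsetI infinite_UNIV_nat)
    then obtain i k where ik: "(f ^^ i) x = (f ^^ k) x" "i < k"
      unfolding inj_on_def by (metis linorder_neqE_nat)
    then have "(f ^^ i) x = (f ^^ i) ((f ^^ (k - i)) x)"
      by (metis add_diff_inverse_nat comp_apply funpow_add not_less_iff_gr_or_eq)
    moreover have "inj_on (f ^^ i) A"
    proof (induction i)
      case (Suc i)
      show ?case
      proof (rule inj_onI)
        fix y z assume yz: "y \<in> A" "z \<in> A" "(f ^^ Suc i) y = (f ^^ Suc i) z"
        then have "(f ^^ i) y = (f ^^ i) z"
          using inj_onD[OF A(3), of "(f ^^ i) y" "(f ^^ i) z"] pow by simp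
        then show "y = z" using inj_onD[OF Suc] yz by blast
      qed
    qed simp
    ultimately have "(f ^^ (k - i)) x = x"
      using inj_onD[of "f ^^ i" A x "(f ^^ (k - i)) x"] pow x by simp
    moreover obtain n where "k - i = Suc n" using ik(2) by (metis Suc_diff_Suc)
    ultimately show ?thesis by (metis funpow_Suc_right o_apply)
  qed
  have "b \<in> A \<and> (\<exists>n. b = (f ^^ n) a)"
    using assms(4)
  proof (induction rule: conn_induct)
    case refl
    show ?case using assms(5) funpow_0[of f a] by metis
  next
    case (step y z)
    then obtain n where n: "y = (f ^^ n) a" and y: "y \<in> A" by auto
    from step.hyps(2) show ?case
    proof
      assume "(y, z) \<in> graph_on A f"
      then have "z = (f ^^ Suc n) a" using n by (auto simp: graph_on_def)
      then show ?thesis using pow[OF assms(5)] by blast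
    next
      assume "(z, y) \<in> graph_on A f"
      then have z: "z \<in> A" "y = f z" by (auto simp: graph_on_def)
      then obtain k where "(f ^^ k) y = z" using per by blast
      then have "z = (f ^^ (k + n)) a" using n by (simp add: funpow_add)
      then show ?thesis using z by blast
    qed
  qed
  then show ?thesis by blast
qed

lemma conn_graph_on_funpowI:
  assumes "f \<in> A \<rightarrow> A" "a \<in> A"
  shows "(a, (f ^^ n) a) \<in> conn (graph_on A f) \<and> (f ^^ n) a \<in> A"
proof (induction n)
  case (Suc n)
  then have "((f ^^ n) a, f ((f ^^ n) a)) \<in> conn (graph_on A f)"
    by (intro conn_base) (auto simp: graph_on_def)
  then show ?case using Suc assms(1) by (auto intro: conn_trans)
qed (use assms in auto)

text \<open>Here \<open>g\<close> is the transposition of \<open>a\<close> and \<open>b\<close>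
  followed by \<open>f\<close>. Such a product splits a cycle through both points and joins two
  cycles that contain one point each.\<close>

lemma conn_graph_on_swap_iff:
  assumes A: "finite A" "f \<in> A \<rightarrow> A" "inj_on f A" and ab: "a \<in> A" "b \<in> A" "a \<noteq> b"
    and g: "g a = f b" "g b = f a" "\<And>x. x \<in> A \<Longrightarrow> x \<noteq> a \<Longrightarrow> x \<noteq> b \<Longrightarrow> g x = f x"
  shows "(a, b) \<in> conn (graph_on A g) \<longleftrightarrow> (a, b) \<notin> conn (graph_on A f)"
proof -
  have gA: "g \<in> A \<rightarrow> A" using A(2) ab g by (metis Pi_iff)
  have gi: "inj_on g A"
    unfolding inj_on_def by (metis A(3) ab(1,2) g inj_onD)
  have pow: "(f ^^ n) x \<in> A" if "x \<in> A" for n x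
    using that A(2) by (induction n) auto
  have "(a, b) \<notin> conn (graph_on A g)" if ab_f: "(a, b) \<in> conn (graph_on A f)"
  proof
    assume c: "(a, b) \<in> conn (graph_on A g)"
    obtain k where "b = (f ^^ k) a" using conn_graph_on_funpow[OF A ab_f ab(1)] by blast
    \<comment> \<open>The first visit to \<open>b\<close>: the arc \<open>f a\<close>, ...,
      \<open>(f ^^ n) a = b\<close> then avoids \<open>a\<close>.\<close>
    define n where "n = (LEAST n. (f ^^ n) a = b)"
    have n: "(f ^^ n) a = b" unfolding n_def by (rule LeastI[of _ k]) (simp add: \<open>b = _\<close>)
    have least: "(f ^^ i) a \<noteq> b" if "i < n" for i using that not_less_Least unfolding n_def by blast
    have "n > 0" using n ab(3) by (cases n) auto
    have na: "(f ^^ i) a \<noteq> a" if "1 \<le> i" "i \<le> n" for i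
    proof
      assume "(f ^^ i) a = a"
      then have "(f ^^ (n - i)) a = b"
        using n that by (metis comp_apply funpow_add le_add_diff_inverse2)
      then show False using least[of "n - i"] that \<open>n > 0\<close> by simp
    qed
    \<comment> \<open>From \<open>b\<close> the map \<open>g\<close> jumps to \<open>f a\<close> and
      runs along this arc back to \<open>b\<close>, so it never reaches \<open>a\<close>.\<close>
    have "\<exists>i\<in>{1..n}. (g ^^ j) b = (f ^^ i) a" for j
    proof (induction j)
      case 0
      then show ?case using n \<open>n > 0\<close> by (auto intro: bexI[of _ n])
    next
      case (Suc j)
      then obtain i where i: "1 \<le> i" "i \<le> n" "(g ^^ j) b = (f ^^ i) a" by auto
      show ?case
      proof (cases "i = n")
        case True
        then have "(g ^^ Suc j) b = (f ^^ 1) a" using i n g by simp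
        then show ?thesis using \<open>n > 0\<close> by (metis Suc_leI One_nat_def atLeastAtMost_iff order_refl)
      next
        case False
        then have "(f ^^ i) a \<noteq> b" using i least by simp
        then have "(g ^^ Suc j) b = (f ^^ Suc i) a" using i na[of i] pow[OF ab(1)] g(3) by simp
        then show ?thesis using False i by (intro bexI[of _ "Suc i"]) auto
      qed
    qed
    moreover obtain j where "a = (g ^^ j) b"
      using conn_graph_on_funpow[OF A(1) gA gi conn_sym[OF c] ab(2)] by blast
    ultimately show False using na by (metis atLeastAtMost_iff)
  qed
  moreover have "(a, b) \<in> conn (graph_on A g)" if *: "(a, b) \<notin> conn (graph_on A f)"
  proof -
    have "(f b, b) \<in> conn (graph_on A f)"
      using ab by (intro conn_sym[OF conn_base]) (auto simp: graph_on_def)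
    then obtain k where "b = (f ^^ k) (f b)"
      using conn_graph_on_funpow[OF A] ab A(2) by blast
    then have k: "(f ^^ Suc k) b = b" by (metis funpow_Suc_right o_apply)
    define n where "n = (LEAST n. (f ^^ Suc n) b = b)"
    have n: "(f ^^ Suc n) b = b" unfolding n_def by (rule LeastI[of _ k]) (use k in simp)
    have least: "(f ^^ Suc i) b \<noteq> b" if "i < n" for i using that not_less_Least unfolding n_def by blast
    \<comment> \<open>From \<open>a\<close> the map \<open>g\<close> jumps to \<open>f b\<close> and
      then follows the old cycle of \<open>b\<close>, which avoids \<open>a\<close>, until it closes
      up at \<open>b\<close>.\<close>
    have "i \<le> n \<Longrightarrow> (a, (f ^^ Suc i) b) \<in> conn (graph_on A g)" for i
    proof (induction i)
      case 0
      show ?case using ab g by (intro conn_base) (auto simp: graph_on_def)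
    next
      case (Suc i)
      let ?y = "(f ^^ Suc i) b"
      have "?y \<in> A" using pow[OF ab(2)] .
      moreover have "?y \<noteq> b" using least[of i] Suc by simp
      moreover have "?y \<noteq> a"
        using * conn_graph_on_funpowI[OF A(2) ab(2)] conn_sym by metis
      ultimately have "(?y, f ?y) \<in> conn (graph_on A g)"
        using g by (intro conn_base) (force simp: graph_on_def)
      then show ?case using Suc by (auto intro: conn_trans)
    qed
    then show ?thesis using n by force
  qed
  ultimately show ?thesis by blast
qed

text \<open>Once \<open>a\<close> and \<open>b\<close> are identified, exchanging their images is
  invisible. The merged partition is the common reference with which the cycles of \<open>f\<close>
  and of \<open>g\<close> are compared.\<close>

lemma conn_graph_on_swap:
  assumes "a \<in> A" "b \<in> A"
    and g: "g a = f b" "g b = f a" "\<And>x. x \<in> A \<Longrightarrow> x \<noteq> a \<Longrightarrow> x \<noteq> b \<Longrightarrow> g x = f x"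
  shows "conn (insert (a, b) (graph_on A g)) = conn (insert (a, b) (graph_on A f))"
proof -
  have "graph_on A g \<subseteq> conn (insert (a, b) (graph_on A f))"
    if "g a = f b" "g b = f a" "\<And>x. x \<in> A \<Longrightarrow> x \<noteq> a \<Longrightarrow> x \<noteq> b \<Longrightarrow> g x = f x" for f g
  proof
    fix p assume "p \<in> graph_on A g"
    then obtain x where x: "x \<in> A" "p = (x, g x)" by (auto simp: graph_on_def)
    let ?C = "conn (insert (a, b) (graph_on A f))"
    have f: "(y, f y) \<in> ?C" if "y \<in> A" for y
      using that by (intro conn_base) (auto simp: graph_on_def)
    have ab: "(a, b) \<in> ?C" by (intro conn_base) auto
    have fa: "(a, f b) \<in> ?C" "(b, f a) \<in> ?C"
      using ab f[OF assms(1)] f[OF assms(2)] by (blast intro: conn_sym conn_trans)+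
    show "p \<in> ?C"
    proof (cases "x = a \<or> x = b")
      case True then show ?thesis using fa that(1,2) x(2) by auto
    next
      case False then show ?thesis using that(3)[OF x(1)] f[OF x(1)] x(2) by simp
    qed
  qed
  from this[of g f] this[of f g] g show ?thesis
    by (intro conn_eqI) (auto intro: conn_base)
qed

text \<open>
  The permutations \<open>f\<close>, \<open>g\<close> and \<open>f \<circ> g\<close> describe the faces, edges and vertices of a map on a closed
  surface, whose genus is nonnegative. The edges are added one at a time: each multiplies the
  permutation by a transposition, which merges or splits a cycle.
\<close>

lemma genus_inequality:
  assumes "finite A" "f \<in> A \<rightarrow> A" "inj_on f A" "\<And>x. x \<in> A \<Longrightarrow> g x \<in> A \<and> g (g x) = x"
  shows "2 * card (A // conn (graph_on A f)) + 2 * card (A // conn (graph_on A (f \<circ> g)))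
           \<le> card {x \<in> A. g x \<noteq> x} + 4 * card (A // conn (graph_on A f \<union> graph_on A g))"
  using assms(4)
proof (induction "card {x \<in> A. g x \<noteq> x}" arbitrary: g rule: less_induct)
  case less
  show ?case
  proof (cases "{x \<in> A. g x \<noteq> x} = {}")
    \<comment> \<open>Without edges every component is a single cycle, and equality holds. The
      inequality is V - E + F \<le> 2C doubled, because the moved points count each edge
      twice.\<close>
    case True
    then have "graph_on A (f \<circ> g) = graph_on A f" by (auto simp: graph_on_def)
    moreover have "conn (graph_on A f \<union> graph_on A g) = conn (graph_on A f)"
      using True by (intro conn_eqI) (auto intro: conn_base simp: graph_on_def)
    ultimately show ?thesis by simp
  next
    case False
    then obtain a where a: "a \<in> A" "g a \<noteq> a" by auto
    define b where "b = g a"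
    \<comment> \<open>Delete the edge with ends \<open>a\<close> and \<open>b\<close> by turning
      both into fixed points.\<close>
    define g0 where "g0 = (\<lambda>x. if x = a \<or> x = b then x else g x)"
    have b: "b \<in> A" "a \<noteq> b" "g b = a" using less(2) a by (auto simp: b_def)
    have g0: "g0 x \<in> A \<and> g0 (g0 x) = x" if "x \<in> A" for x
    proof (cases "x = a \<or> x = b")
      case False
      then have "g x \<noteq> a" "g x \<noteq> b" using that less(2)[OF that] a b b_def by metis+
      then show ?thesis using False less(2)[OF that] by (simp add: g0_def)
    qed (use a b in \<open>auto simp: g0_def\<close>)
    let ?S = "{x \<in> A. g x \<noteq> x}" and ?T = "{x \<in> A. g0 x \<noteq> x}"
    have S: "?T = ?S - {a, b}" by (auto simp: g0_def)
    have "{a, b} \<subseteq> ?S" using a b by auto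
    then have "card ?T = card ?S - card {a, b}" "card {a, b} \<le> card ?S"
      unfolding S using assms(1) by (intro card_Diff_subset card_mono; simp)+
    then have cS: "card ?S = card ?T + 2" using b(2) by simp
    define h where "h = f \<circ> g0"
    have IH: "2 * card (A // conn (graph_on A f)) + 2 * card (A // conn (graph_on A h))
           \<le> card ?T + 4 * card (A // conn (graph_on A f \<union> graph_on A g0))"
      unfolding h_def by (rule less(1)) (use cS g0 in auto)
    have hA: "h \<in> A \<rightarrow> A" using g0 assms(2) by (auto simp: h_def)
    have hi: "inj_on h A" unfolding inj_on_def h_def comp_def
      by (metis assms(3) g0 inj_onD)
    have sw: "(f \<circ> g) a = h b" "(f \<circ> g) b = h a" "\<And>x. x \<in> A \<Longrightarrow> x \<noteq> a \<Longrightarrow> x \<noteq> b \<Longrightarrow> (f \<circ> g) x = h x"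
      using b by (auto simp: h_def g0_def b_def)
    have dich: "(a, b) \<in> conn (graph_on A (f \<circ> g)) \<longleftrightarrow> (a, b) \<notin> conn (graph_on A h)"
      by (rule conn_graph_on_swap_iff[OF assms(1) hA hi a(1) b(1,2)]) (rule sw; assumption)+
    have same: "conn (insert (a, b) (graph_on A (f \<circ> g))) = conn (insert (a, b) (graph_on A h))"
      by (rule conn_graph_on_swap[OF a(1) b(1)]) (rule sw; assumption)+
    have "conn (graph_on A f \<union> graph_on A g) = conn (insert (a, b) (graph_on A f \<union> graph_on A g0))"
    proof (intro conn_eqI subsetI)
      fix p assume "p \<in> graph_on A f \<union> graph_on A g"
      moreover have "p \<in> graph_on A g0 \<or> p = (a, b) \<or> p = (b, a)" if pg: "p \<in> graph_on A g"
      proof -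
        obtain x where x: "x \<in> A" "p = (x, g x)" using pg by (auto simp: graph_on_def)
        show ?thesis
        proof (cases "x = a \<or> x = b")
          case True then show ?thesis using x b b_def by auto
        next
          case False then show ?thesis using x by (auto simp: graph_on_def g0_def)
        qed
      qed
      ultimately consider "p \<in> graph_on A f \<union> graph_on A g0" | "p = (a, b)" | "p = (b, a)"
        by blast
      then show "p \<in> conn (insert (a, b) (graph_on A f \<union> graph_on A g0))"
        by cases (auto intro: conn_base conn_sym)
    next
      fix p assume "p \<in> insert (a, b) (graph_on A f \<union> graph_on A g0)"
      moreover have "p \<in> graph_on A g \<or> fst p = snd p" if "p \<in> graph_on A g0"
        using that by (auto simp: graph_on_def g0_def)
      moreover have "(a, b) \<in> graph_on A g" using a(1) by (auto simp: graph_on_def b_def)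
      ultimately have "p \<in> graph_on A f \<union> graph_on A g \<or> fst p = snd p" by blast
      then show "p \<in> conn (graph_on A f \<union> graph_on A g)"
        by (cases p) (auto intro: conn_base)
    qed
    then have "card (A // conn (graph_on A f \<union> graph_on A g)) +
          (if (a, b) \<in> conn (graph_on A f \<union> graph_on A g0) then 0 else 1)
        = card (A // conn (graph_on A f \<union> graph_on A g0))"
      using card_quotient_conn_insert[OF assms(1) a(1) b(1)] by simp
    moreover have "(a, b) \<in> conn (graph_on A f \<union> graph_on A g0)" if "(a, b) \<in> conn (graph_on A h)"
    proof -
      have "graph_on A h \<subseteq> conn (graph_on A f \<union> graph_on A g0)"
      proof
        fix p assume "p \<in> graph_on A h"
        then obtain x where x: "x \<in> A" "p = (x, f (g0 x))" by (auto simp: graph_on_def h_def)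
        have "(x, g0 x) \<in> conn (graph_on A f \<union> graph_on A g0)"
          "(g0 x, f (g0 x)) \<in> conn (graph_on A f \<union> graph_on A g0)"
          using x g0 by (auto intro!: conn_base simp: graph_on_def)
        then show "p \<in> conn (graph_on A f \<union> graph_on A g0)" using x by (auto intro: conn_trans)
      qed
      then show ?thesis using that conn_subset by blast
    qed
    moreover note card_quotient_conn_insert[OF assms(1) a(1) b(1), of "graph_on A h"]
      card_quotient_conn_insert[OF assms(1) a(1) b(1), of "graph_on A (f \<circ> g)", unfolded same]
    \<comment> \<open>Restoring the edge adds 2 to the first term on the right. If \<open>a\<close>
      and \<open>b\<close> share a cycle of \<open>h\<close>, that cycle splits, the components
      stay, and the left side also gains 2. Otherwise two cycles merge, the left side loses 2, and
      at most one component is lost, at a cost of 4.\<close>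
    ultimately show ?thesis
      using IH cS dich
      by (cases "(a, b) \<in> conn (graph_on A h)";
          cases "(a, b) \<in> conn (graph_on A f \<union> graph_on A g0)") simp_all
  qed
qed

section \<open>Source-sink structures on planar diagrams\<close>

lemma finite_ends: "link_diagram D \<Longrightarrow> finite (ends D)"
  by (simp add: link_diagram_def ends_def)

lemma link_diagram_glue:
  assumes "link_diagram D" "e \<in> ends D"
  shows "glue D e \<in> ends D" "glue D e \<noteq> e" "glue D (glue D e) = e"
  using assms by (auto simp: link_diagram_def)

lemma inj_on_glue: "link_diagram D \<Longrightarrow> inj_on (glue D) (ends D)"
  by (metis inj_onI link_diagram_glue(3))

lemma next_end_in_ends [simp]: "e \<in> ends D \<Longrightarrow> next_end e \<in> ends D"
  by (auto simp: ends_def next_end_def)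

lemma next_end_pow4: "e \<in> ends D \<Longrightarrow> next_end (next_end (next_end (next_end e))) = e"
  by (auto simp: ends_def next_end_def) presburger

lemma inj_on_next_end: "inj_on next_end (ends D)"
  by (metis inj_onI next_end_pow4)

lemma card_ends: "card (ends D) = 4 * card (vertices D)"
  by (simp add: ends_def card_cartesian_product)

text \<open>Gluing is an involution without fixed points, so the arcs partition the ends into pairs,
  and every vertex has four ends.\<close>

lemma card_arcs:
  assumes "link_diagram D"
  shows "card (arcs D) = 2 * card (vertices D)"
proof -
  have arcs: "arcs D = (\<lambda>e. {e, glue D e}) ` ends D" by (auto simp: arcs_def)
  have "2 * card (arcs D) = card (\<Union>(arcs D))"
  proof (rule card_partition)
    show "finite (arcs D)" using finite_ends[OF assms] by (simp add: arcs)
    show "finite (\<Union>(arcs D))" using finite_ends[OF assms] by (auto simp: arcs)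
    show "card c = 2" if c: "c \<in> arcs D" for c
    proof -
      obtain e where "e \<in> ends D" "c = {e, glue D e}" using c by (auto simp: arcs)
      then show ?thesis using link_diagram_glue(2)[OF assms, of e] by (metis card_2_iff)
    qed
    show "c \<inter> c' = {}" if c: "c \<in> arcs D" "c' \<in> arcs D" "c \<noteq> c'" for c c'
    proof -
      have "d = {x, glue D x}" if "d \<in> arcs D" "x \<in> d" for d x
        using that link_diagram_glue(3)[OF assms] unfolding arcs by fastforce
      then show ?thesis using c by (metis disjoint_iff)
    qed
  qed
  also have "\<Union>(arcs D) = ends D" using link_diagram_glue(1)[OF assms] by (auto simp: arcs)
  finally show ?thesis by (simp add: card_ends)
qed

definition diagram_rel :: "diagram \<Rightarrow> (vertex_end \<times> vertex_end) set" where
  "diagram_rel D = {(e, f). e \<in> ends D \<and> (f = glue D e \<or> f = next_end e)}"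

text \<open>\<open>glue D\<close> is its own inverse and \<open>next_end\<close> has order four, so
  the transitive closure in \<open>components\<close> already contains the backward steps.\<close>

lemma components_eq:
  assumes "link_diagram D"
  shows "components D = ends D // conn (diagram_rel D)"
proof -
  let ?X = "diagram_rel D"
  have "conn ?X \<subseteq> ?X\<^sup>*"
    unfolding conn_def
  proof (rule rtrancl_subset_rtrancl, safe)
    fix e f assume "(f, e) \<in> ?X"
    then have f: "f \<in> ends D" "e = glue D f \<or> e = next_end f" by (auto simp: diagram_rel_def)
    from f(2) show "(e, f) \<in> ?X\<^sup>*"
    proof
      assume "e = glue D f"
      then have "(e, f) \<in> ?X" using link_diagram_glue[OF assms f(1)] by (simp add: diagram_rel_def)
      then show ?thesis by blast
    next
      assume e: "e = next_end f"
      have n: "(x, next_end x) \<in> ?X" if "x \<in> ends D" for x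
        using that by (auto simp: diagram_rel_def)
      have "(e, next_end (next_end (next_end e))) \<in> ?X\<^sup>*"
        using n[of e] n[of "next_end e"] n[of "next_end (next_end e)"] f(1) e
        by (simp add: rtrancl.rtrancl_into_rtrancl)
      then show ?thesis using next_end_pow4[OF f(1)] e by simp
    qed
  qed auto
  moreover have "?X\<^sup>* \<subseteq> conn ?X" unfolding conn_def by (rule rtrancl_mono) auto
  ultimately show ?thesis by (simp add: components_def diagram_rel_def)
qed

text \<open>
  The double cover of the underlying map on which both \<open>glue D\<close> and \<open>next_end\<close> switch sheets. It is
  unbranched, over the vertices because their degree is even. By Euler's formula and the genus
  inequality it has at least twice as many components as the map itself, so it is trivial.
\<close>

definition cover_ends :: "diagram \<Rightarrow> (vertex_end \<times> bool) set" where
  "cover_ends D = ends D \<times> UNIV"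

text \<open>A step along a face crosses an arc and turns at a vertex. The two switches of sheet
  cancel, so the cover is unbranched over the faces.\<close>

definition cover_face :: "diagram \<Rightarrow> vertex_end \<times> bool \<Rightarrow> vertex_end \<times> bool" where
  "cover_face D = (\<lambda>(e, b). (next_end (glue D e), b))"

definition cover_glue :: "diagram \<Rightarrow> vertex_end \<times> bool \<Rightarrow> vertex_end \<times> bool" where
  "cover_glue D = (\<lambda>(e, b). (glue D e, \<not> b))"

definition cover_rel :: "diagram \<Rightarrow> ((vertex_end \<times> bool) \<times> (vertex_end \<times> bool)) set" where
  "cover_rel D = graph_on (cover_ends D) (cover_face D) \<union> graph_on (cover_ends D) (cover_glue D)"

lemma cover_face_funpow: "(cover_face D ^^ n) (e, b) = (((next_end \<circ> glue D) ^^ n) e, b)"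
  by (induction n) (auto simp: cover_face_def)

lemma inj_on_cover_face:
  assumes "link_diagram D"
  shows "inj_on (cover_face D) (cover_ends D)"
proof (rule inj_onI)
  fix x y assume "x \<in> cover_ends D" "y \<in> cover_ends D" "cover_face D x = cover_face D y"
  moreover obtain e b e' b' where "x = (e, b)" "y = (e', b')" by fastforce
  ultimately have *: "e \<in> ends D" "e' \<in> ends D" "next_end (glue D e) = next_end (glue D e')" "b = b'"
    by (auto simp: cover_ends_def cover_face_def)
  then have "glue D e = glue D e'"
    using inj_onD[OF inj_on_next_end *(3)] link_diagram_glue(1)[OF assms] by blast
  then show "x = y"
    using inj_onD[OF inj_on_glue[OF assms], of e e'] * \<open>x = (e, b)\<close> \<open>y = (e', b')\<close> by simp
qed

text \<open>The walk around a face stays on its sheet, so every face lifts once to each of the two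
  sheets.\<close>

lemma card_faces_le:
  assumes "link_diagram D"
  shows "2 * card (faces D) \<le> card (cover_ends D // conn (graph_on (cover_ends D) (cover_face D)))"
proof -
  let ?A = "cover_ends D" and ?f = "cover_face D"
  have A: "finite ?A" "?f \<in> ?A \<rightarrow> ?A"
    using finite_ends[OF assms] link_diagram_glue(1)[OF assms] by (auto simp: cover_ends_def cover_face_def)
  note inj = inj_on_cover_face[OF assms]
  have cls: "orbit (next_end \<circ> glue D) e \<times> {b} = conn (graph_on ?A ?f) `` {(e, b)}"
    if e: "e \<in> ends D" for e b
  proof (intro equalityI subsetI)
    have eA: "(e, b) \<in> ?A" using e by (simp add: cover_ends_def)
    fix y
    {
      assume "y \<in> orbit (next_end \<circ> glue D) e \<times> {b}"
      then obtain n where "y = (?f ^^ n) (e, b)" by (auto simp: orbit_altdef cover_face_funpow)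
      then show "y \<in> conn (graph_on ?A ?f) `` {(e, b)}"
        using conn_graph_on_funpowI[OF A(2) eA, of n] by simp
    }
    assume "y \<in> conn (graph_on ?A ?f) `` {(e, b)}"
    then have "((e, b), y) \<in> conn (graph_on ?A ?f)" by simp
    \<comment> \<open>\<open>orbit\<close> begins with the first iterate, so the walk is started one
      step later.\<close>
    moreover have "(?f (e, b), (e, b)) \<in> conn (graph_on ?A ?f)"
      using eA by (intro conn_sym[OF conn_base]) (simp add: graph_on_def)
    ultimately have "(?f (e, b), y) \<in> conn (graph_on ?A ?f)" by (rule conn_trans[rotated])
    then obtain n where "y = (?f ^^ n) (?f (e, b))"
      using conn_graph_on_funpow[OF A inj] eA A(2) by blast
    then have "y = (?f ^^ Suc n) (e, b)" by (simp only: funpow_Suc_right o_apply)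
    then show "y \<in> orbit (next_end \<circ> glue D) e \<times> {b}"
      unfolding cover_face_funpow orbit_altdef by blast
  qed
  have "card (faces D \<times> (UNIV :: bool set)) \<le> card (?A // conn (graph_on ?A ?f))"
  proof (rule card_inj_on_le)
    show "inj_on (\<lambda>(F, b). F \<times> {b}) (faces D \<times> (UNIV :: bool set))"
    proof (rule inj_onI, clarify)
      fix F F' and b b' :: bool
      assume "F \<in> faces D" "F' \<in> faces D" "F \<times> {b} = F' \<times> {b'}"
      moreover have "G \<noteq> {}" if "G \<in> faces D" for G
        using that orbit_nonempty[of "next_end \<circ> glue D"] by (auto simp: faces_def)
      ultimately show "F = F' \<and> b = b'" by (simp add: times_eq_iff)
    qed
    show "(\<lambda>(F, b). F \<times> {b}) ` (faces D \<times> (UNIV :: bool set)) \<subseteq> ?A // conn (graph_on ?A ?f)"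
    proof safe
      fix F b assume "F \<in> faces D"
      then obtain e where "e \<in> ends D" "F = orbit (next_end \<circ> glue D) e" by (auto simp: faces_def)
      then show "F \<times> {b} \<in> ?A // conn (graph_on ?A ?f)"
        using cls by (auto simp: cover_ends_def intro: quotientI)
    qed
    show "finite (?A // conn (graph_on ?A ?f))" by (rule finite_quotient_conn[OF A(1)])
  qed
  then show ?thesis by (simp add: card_cartesian_product mult.commute)
qed

text \<open>Turning at a vertex switches both the sheet and the parity of the end, consistently
  because the degree four is even. Thus \<open>sheet\<close> is an invariant that separates the two
  lifts of a vertex.\<close>

lemma card_vertices_le:
  assumes "link_diagram D"
  shows "2 * card (vertices D)
    \<le> card (cover_ends D // conn (graph_on (cover_ends D) (cover_face D \<circ> cover_glue D)))"
proof -
  let ?A = "cover_ends D" and ?h = "cover_face D \<circ> cover_glue D"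
  have h: "?h (e, b) = (next_end e, \<not> b)" if "e \<in> ends D" for e b
    using that link_diagram_glue[OF assms] by (simp add: cover_face_def cover_glue_def)
  have even_mod: "even ((Suc i) mod 4) \<longleftrightarrow> odd i" for i :: nat by presburger
  define sheet where "sheet = (\<lambda>((v, i), b). (v :: nat, b = even (i :: nat)))"
  have sheet_step: "sheet (?h x) = sheet x" if "x \<in> ?A" for x
    using that h by (auto simp: cover_ends_def next_end_def sheet_def even_mod simp del: comp_apply)
  have sheet: "sheet y = sheet x" if "(x, y) \<in> conn (graph_on ?A ?h)" for x y
    using that
  proof (induction rule: conn_induct)
    case (step y z)
    then show ?case using sheet_step by (auto simp: graph_on_def simp del: comp_apply)
  qed simp
  have "card (vertices D \<times> (UNIV :: bool set)) \<le> card (?A // conn (graph_on ?A ?h))"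
  proof (rule card_inj_on_le)
    show "inj_on (\<lambda>(v, b). conn (graph_on ?A ?h) `` {((v, 0), b)}) (vertices D \<times> (UNIV :: bool set))"
    proof (rule inj_onI)
      fix p q :: "nat \<times> bool"
      assume "(case p of (v, b) \<Rightarrow> conn (graph_on ?A ?h) `` {((v, 0), b)}) =
        (case q of (v, b) \<Rightarrow> conn (graph_on ?A ?h) `` {((v, 0), b)})"
      then have "conn (graph_on ?A ?h) `` {((fst p, 0), snd p)} = conn (graph_on ?A ?h) `` {((fst q, 0), snd q)}"
        by (simp only: case_prod_unfold)
      then have "sheet ((fst q, 0), snd q) = sheet ((fst p, 0), snd p)"
        unfolding conn_class_eq_iff by (rule sheet)
      then show "p = q" by (simp add: sheet_def prod_eq_iff)
    qed
    show "(\<lambda>(v, b). conn (graph_on ?A ?h) `` {((v, 0), b)}) ` (vertices D \<times> UNIV) \<subseteq> ?A // conn (graph_on ?A ?h)"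
      by (auto simp: cover_ends_def ends_def intro!: quotientI)
    show "finite (?A // conn (graph_on ?A ?h))"
      using finite_ends[OF assms] by (intro finite_quotient_conn) (simp add: cover_ends_def)
  qed
  then show ?thesis by (simp add: card_cartesian_product mult.commute)
qed

text \<open>With E = 2V, Euler's formula reads F = V + 2C. The cover has at least 2F faces and 2V
  vertices and at most 4V edges, so its Euler characteristic is at least 4C, whereas each of its
  components contributes at most 2.\<close>

lemma card_cover_components:
  assumes "link_diagram D"
  shows "2 * card (components D) \<le> card (cover_ends D // conn (cover_rel D))"
proof -
  let ?A = "cover_ends D"
  note inj = inj_on_cover_face[OF assms]
  have "2 * card (?A // conn (graph_on ?A (cover_face D))) +
      2 * card (?A // conn (graph_on ?A (cover_face D \<circ> cover_glue D)))
      \<le> card {x \<in> ?A. cover_glue D x \<noteq> x} + 4 * card (?A // conn (cover_rel D))"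
    unfolding cover_rel_def
    by (rule genus_inequality)
      (use finite_ends[OF assms] link_diagram_glue[OF assms] inj in
        \<open>auto simp: cover_ends_def cover_face_def cover_glue_def\<close>)
  moreover have "card {x \<in> ?A. cover_glue D x \<noteq> x} \<le> card ?A"
    using finite_ends[OF assms] by (intro card_mono) (auto simp: cover_ends_def)
  moreover have "card ?A = 8 * card (vertices D)"
    by (simp add: cover_ends_def card_cartesian_product card_ends)
  moreover have "int (card (faces D)) = int (card (vertices D)) + 2 * int (card (components D))"
    using assms card_arcs[OF assms] by (simp add: link_diagram_def planar_def)
  ultimately show ?thesis
    using card_faces_le[OF assms] card_vertices_le[OF assms] by linarith
qed

lemma cover_rel_steps:
  assumes "link_diagram D" "e \<in> ends D"
  shows "((e, b), (glue D e, \<not> b)) \<in> conn (cover_rel D)"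
    and "((e, b), (next_end e, \<not> b)) \<in> conn (cover_rel D)"
proof -
  have f: "(x, cover_face D x) \<in> conn (cover_rel D)"
    and g: "(x, cover_glue D x) \<in> conn (cover_rel D)" if "x \<in> cover_ends D" for x
    using that by (auto intro!: conn_base simp: cover_rel_def graph_on_def)
  show 1: "((e, b), (glue D e, \<not> b)) \<in> conn (cover_rel D)"
    using g[of "(e, b)"] assms(2) by (simp add: cover_ends_def cover_glue_def)
  have "((glue D e, \<not> b), (next_end e, \<not> b)) \<in> conn (cover_rel D)"
    using f[of "(glue D e, \<not> b)"] link_diagram_glue[OF assms]
    by (simp add: cover_ends_def cover_face_def)
  with 1 show "((e, b), (next_end e, \<not> b)) \<in> conn (cover_rel D)" by (rule conn_trans)
qed

text \<open>Path lifting: every step in the diagram has a lift that starts on a prescribed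
  sheet.\<close>

lemma cover_rel_lift:
  assumes "link_diagram D" "(x, y) \<in> conn (diagram_rel D)"
  shows "\<exists>b'. ((x, b), (y, b')) \<in> conn (cover_rel D)"
  using assms(2)
proof (induction rule: conn_induct)
  case (step y z)
  then obtain b' where b': "((x, b), (y, b')) \<in> conn (cover_rel D)" by blast
  from step.hyps(2) have "((y, b'), (z, \<not> b')) \<in> conn (cover_rel D)"
  proof
    assume "(y, z) \<in> diagram_rel D"
    then show ?thesis using cover_rel_steps[OF assms(1), of y b'] by (auto simp: diagram_rel_def)
  next
    assume "(z, y) \<in> diagram_rel D"
    then show ?thesis
      using cover_rel_steps[OF assms(1), of z "\<not> b'", THEN conn_sym] by (auto simp: diagram_rel_def)
  qed
  from conn_trans[OF b' this] show ?case by blast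
qed (blast intro: conn_refl)

text \<open>Every class of the cover contains a lift of a representative of its component, so two
  labels per component reach all classes. If both lifts of \<open>e\<close> were joined, one label
  would be redundant, against the lower bound on the number of classes.\<close>

lemma cover_sheets_not_connected:
  assumes D: "link_diagram D" and e: "e \<in> ends D"
  shows "((e, False), (e, True)) \<notin> conn (cover_rel D)"
proof
  assume c: "((e, False), (e, True)) \<in> conn (cover_rel D)"
  let ?K = "components D"
  \<comment> \<open>The component of \<open>e\<close> is represented by \<open>e\<close> itself, so
    that the supposed coincidence occurs between two of the chosen labels.\<close>
  define r where "r = (\<lambda>K. if e \<in> K then e else SOME x. x \<in> K)"
  define \<Phi> where "\<Phi> = (\<lambda>(K, b). conn (cover_rel D) `` {(r K, b)})"
  let ?E = "conn (diagram_rel D) `` {e}"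
  have finK: "finite ?K"
    using finite_quotient_conn[OF finite_ends[OF D]] by (simp add: components_eq[OF D])
  have K0: "?E \<in> ?K" using quotientI[OF e] by (simp add: components_eq[OF D])
  have rK0: "r ?E = e" by (simp add: r_def)
  have "cover_ends D // conn (cover_rel D) \<subseteq> \<Phi> ` (?K \<times> UNIV)"
  proof
    fix C assume "C \<in> cover_ends D // conn (cover_rel D)"
    then obtain x b where x: "x \<in> ends D" "C = conn (cover_rel D) `` {(x, b)}"
      by (auto simp: cover_ends_def elim: quotientE)
    let ?L = "conn (diagram_rel D) `` {x}"
    have L: "?L \<in> ?K" using quotientI[OF x(1)] by (simp add: components_eq[OF D])
    have "x \<in> ?L" by simp
    then have "r ?L \<in> ?L" unfolding r_def by (metis someI)
    then obtain b' where "((x, b), (r ?L, b')) \<in> conn (cover_rel D)"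
      using cover_rel_lift[OF D] by blast
    then have "C = \<Phi> (?L, b')" using x(2) by (simp add: \<Phi>_def conn_class_eq_iff)
    then show "C \<in> \<Phi> ` (?K \<times> UNIV)" using L by blast
  qed
  also have "\<dots> \<subseteq> \<Phi> ` (?K \<times> UNIV - {(?E, True)})"
  proof
    fix C assume "C \<in> \<Phi> ` (?K \<times> UNIV)"
    moreover have "\<Phi> (?E, True) = \<Phi> (?E, False)"
      using conn_sym[OF c] by (simp add: \<Phi>_def rK0 conn_class_eq_iff)
    moreover have "(?E, False) \<in> ?K \<times> UNIV - {(?E, True)}" using K0 by simp
    moreover obtain p where "C = \<Phi> p" "p \<in> ?K \<times> UNIV" using calculation(1) by (elim imageE)
    ultimately show "C \<in> \<Phi> ` (?K \<times> UNIV - {(?E, True)})"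
      by (cases "p = (?E, True)") auto
  qed
  finally have "card (cover_ends D // conn (cover_rel D)) \<le> card (?K \<times> (UNIV :: bool set) - {(?E, True)})"
    using finK by (meson card_image_le card_mono finite_Diff finite_SigmaI finite_imageI finite_code le_trans)
  also have "\<dots> < card (?K \<times> (UNIV :: bool set))"
    using finK K0 by (intro card_Diff1_less) auto
  finally show False
    using card_cover_components[OF D] by (simp add: card_cartesian_product)
qed

text \<open>
  Geometrically: run along each edge with the black regions of a checkerboard colouring on the left.
  Here the colours are the sheets of the double cover.
\<close>

lemma source_sink_exists:
  assumes D: "link_diagram D"
  shows "\<exists>\<sigma>. \<sigma> \<subseteq> ends D \<and>
    (\<forall>e\<in>ends D. (glue D e \<in> \<sigma> \<longleftrightarrow> e \<notin> \<sigma>) \<and> (next_end e \<in> \<sigma> \<longleftrightarrow> e \<notin> \<sigma>))"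
proof -
  define r where "r = (\<lambda>e. SOME x. x \<in> conn (diagram_rel D) `` {e})"
  \<comment> \<open>\<open>r\<close> depends only on the component and serves as base point;
    \<open>\<sigma>\<close> collects the ends whose lift to one sheet is joined to the base point on
    the same sheet.\<close>
  define \<sigma> where "\<sigma> = {e \<in> ends D. ((e, False), (r e, False)) \<in> conn (cover_rel D)}"
  \<comment> \<open>Exchanging the two sheets is a symmetry of the cover.\<close>
  have flip: "((x, \<not> b), (y, \<not> b')) \<in> conn (cover_rel D)"
    if "((x, b), (y, b')) \<in> conn (cover_rel D)" for x y b b'
  proof -
    have "((fst q, \<not> snd q), (fst p, \<not> snd p)) \<in> conn (cover_rel D)" if "(q, p) \<in> conn (cover_rel D)" for p q
      using that
    proof (induction rule: conn_induct)
      case (step y z)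
      have *: "((fst u, \<not> snd u), (fst w, \<not> snd w)) \<in> cover_rel D" if "(u, w) \<in> cover_rel D" for u w
        using that by (fastforce simp: cover_rel_def graph_on_def cover_ends_def cover_face_def cover_glue_def)
      from step.hyps(2) have "((fst y, \<not> snd y), (fst z, \<not> snd z)) \<in> conn (cover_rel D)"
        using * conn_base conn_sym by metis
      from conn_trans[OF step.IH this] show ?case .
    qed simp
    from this[OF that] show ?thesis by simp
  qed
  have r: "(e, r e) \<in> conn (diagram_rel D)" for e
    unfolding r_def by (metis (mono_tags, lifting) Image_singleton_iff conn_refl someI)
  have key: "f \<in> \<sigma> \<longleftrightarrow> e \<notin> \<sigma>"
    if e: "e \<in> ends D" and f: "f \<in> ends D" and ef: "(e, f) \<in> conn (diagram_rel D)"
      and c: "((e, True), (f, False)) \<in> conn (cover_rel D)" for e f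
  proof -
    have rf: "r f = r e" using ef by (simp add: r_def flip: conn_class_eq_iff)
    have "f \<in> \<sigma> \<longleftrightarrow> ((e, True), (r e, False)) \<in> conn (cover_rel D)"
      using f rf conn_trans[OF c, of "(r e, False)"] conn_trans[OF conn_sym[OF c], of "(r e, False)"]
      unfolding \<sigma>_def by auto
    also have "\<dots> \<longleftrightarrow> e \<notin> \<sigma>"
    proof
      assume *: "((e, True), (r e, False)) \<in> conn (cover_rel D)"
      then show "e \<notin> \<sigma>"
        using cover_sheets_not_connected[OF D e] conn_trans[OF _ conn_sym[OF *], of "(e, False)"] unfolding \<sigma>_def by auto
    next
      assume "e \<notin> \<sigma>"
      then have "((e, False), (r e, False)) \<notin> conn (cover_rel D)" using e by (simp add: \<sigma>_def)
      moreover obtain b where b: "((e, True), (r e, b)) \<in> conn (cover_rel D)"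
        using cover_rel_lift[OF D r] by blast
      ultimately show "((e, True), (r e, False)) \<in> conn (cover_rel D)"
        using flip[OF b] by (cases b) auto
    qed
    finally show ?thesis .
  qed
  have "(glue D e \<in> \<sigma> \<longleftrightarrow> e \<notin> \<sigma>) \<and> (next_end e \<in> \<sigma> \<longleftrightarrow> e \<notin> \<sigma>)" if e: "e \<in> ends D" for e
  proof
    have "(e, glue D e) \<in> conn (diagram_rel D)" "(e, next_end e) \<in> conn (diagram_rel D)"
      using e by (auto intro: conn_base simp: diagram_rel_def)
    then show "glue D e \<in> \<sigma> \<longleftrightarrow> e \<notin> \<sigma>" "next_end e \<in> \<sigma> \<longleftrightarrow> e \<notin> \<sigma>"
      using key[OF e] cover_rel_steps[OF D e, of True] link_diagram_glue(1)[OF D e] e by auto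
  qed
  moreover have "\<sigma> \<subseteq> ends D" by (auto simp: \<sigma>_def)
  ultimately show ?thesis by blast
qed

section \<open>Circles of a state\<close>

definition state_edges :: "diagram \<Rightarrow> nat set \<Rightarrow> (vertex_end \<times> vertex_end) set" where
  "state_edges D S = {(e, f). e \<in> ends D \<and> (f = glue D e \<or> f = state_end D S e)}"

lemma state_end_ends:
  assumes "e \<in> ends D"
  shows "state_end D S e \<in> ends D" "state_end D S (state_end D S e) = e" "fst (state_end D S e) = fst e"
  using assms by (auto simp: ends_def state_end_def smoothed_end_def split: option.splits)

lemma sym_state_edges:
  assumes "link_diagram D"
  shows "sym (state_edges D S)"
proof (rule symI)
  fix e f assume "(e, f) \<in> state_edges D S"
  then have e: "e \<in> ends D" and f: "f = glue D e \<or> f = state_end D S e"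
    by (auto simp: state_edges_def)
  from f show "(f, e) \<in> state_edges D S"
    using link_diagram_glue[OF assms e] state_end_ends[OF e, of S] by (auto simp: state_edges_def)
qed

lemma state_rel_eq_conn:
  assumes "link_diagram D"
  shows "state_rel D S = conn (state_edges D S)"
  unfolding conn_sym_rtrancl[OF sym_state_edges[OF assms]] by (simp add: state_rel_def state_edges_def)

lemma circle_eq_iff:
  assumes "link_diagram D"
  shows "circle D S e = circle D S f \<longleftrightarrow> (e, f) \<in> state_rel D S"
  by (simp add: circle_def state_rel_eq_conn[OF assms] conn_class_eq_iff)

text \<open>
  Following the source-sink structure, the circles of a state are the cycles of a permutation of the
  ends in \<open>\<sigma>\<close>. Changing the smoothing at \<open>v\<close> multiplies it by a transposition.
\<close>

lemma circle_dichotomy: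
  assumes D: "link_diagram D" and v: "v \<in> crossings D" "v \<notin> S"
  shows "((v, 0), (v, 2)) \<in> state_rel D (insert v S) \<longleftrightarrow> ((v, 0), (v, 2)) \<notin> state_rel D S"
proof -
  obtain \<sigma>0 where \<sigma>0: "\<sigma>0 \<subseteq> ends D"
    "\<And>e. e \<in> ends D \<Longrightarrow> (glue D e \<in> \<sigma>0 \<longleftrightarrow> e \<notin> \<sigma>0) \<and> (next_end e \<in> \<sigma>0 \<longleftrightarrow> e \<notin> \<sigma>0)"
    using source_sink_exists[OF D] by blast
  \<comment> \<open>Complementing reverses all edges of the source-sink structure, so
    \<open>(v, 0)\<close> may be assumed to lie in it.\<close>
  define \<sigma> where "\<sigma> = (if (v, 0) \<in> \<sigma>0 then \<sigma>0 else ends D - \<sigma>0)"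
  have vV: "v \<in> vertices D" "resolved D v = None" using v by (auto simp: crossings_def)
  have ve: "(v, i) \<in> ends D" if "i < 4" for i using that vV by (simp add: ends_def)
  have sub: "\<sigma> \<subseteq> ends D" using \<sigma>0(1) by (auto simp: \<sigma>_def)
  have gl: "glue D e \<in> \<sigma> \<longleftrightarrow> e \<notin> \<sigma>" and nx: "next_end e \<in> \<sigma> \<longleftrightarrow> e \<notin> \<sigma>" if "e \<in> ends D" for e
    using \<sigma>0(2)[OF that] that link_diagram_glue(1)[OF D that] by (auto simp: \<sigma>_def)
  have v0: "(v, 0) \<in> \<sigma>" using ve by (auto simp: \<sigma>_def)
  have par: "(w, i) \<in> \<sigma> \<longleftrightarrow> ((w, 0) \<in> \<sigma> \<longleftrightarrow> even i)" if w: "w \<in> vertices D" "i < 4" for w i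
  proof -
    have e: "(w, j) \<in> ends D" if "j < 4" for j using that w by (simp add: ends_def)
    have n: "next_end (w, 0) = (w, 1)" "next_end (w, 1) = (w, 2)" "next_end (w, 2) = (w, 3)"
      by (simp_all add: next_end_def)
    have "(w, 1) \<in> \<sigma> \<longleftrightarrow> (w, 0) \<notin> \<sigma>" "(w, 2) \<in> \<sigma> \<longleftrightarrow> (w, 1) \<notin> \<sigma>" "(w, 3) \<in> \<sigma> \<longleftrightarrow> (w, 2) \<notin> \<sigma>"
      using nx[OF e[of 0]] nx[OF e[of 1]] nx[OF e[of 2]] n by simp_all
    moreover have "i = 0 \<or> i = 1 \<or> i = 2 \<or> i = 3" using w(2) by linarith
    ultimately show ?thesis by auto
  qed
  have st: "state_end D T e \<in> \<sigma> \<longleftrightarrow> e \<notin> \<sigma>" if e: "e \<in> ends D" for T e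
  proof -
    obtain w i where wi: "e = (w, i)" "w \<in> vertices D" "i < 4" using e by (auto simp: ends_def)
    obtain k where k: "state_end D T e = (w, k)" "k < 4" "even k \<longleftrightarrow> odd i"
      using state_end_ends[OF e, of T] wi
      by (auto simp: state_end_def smoothed_end_def ends_def split: option.splits)
    show ?thesis unfolding k(1) unfolding wi(1)
      using par[OF wi(2,3)] par[OF wi(2) k(2)] k(3) by blast
  qed
  \<comment> \<open>Two steps along a circle: through the smoothing and then along an arc. Each step
    alone leaves \<open>\<sigma>\<close>, so the two together return to it.\<close>
  define f where "f = (\<lambda>T e. glue D (state_end D T e))"
  have fA: "f T \<in> \<sigma> \<rightarrow> \<sigma>" for T
  proof
    fix e assume "e \<in> \<sigma>"
    then have "e \<in> ends D" using sub by blast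
    then show "f T e \<in> \<sigma>" using gl[OF state_end_ends(1)] st \<open>e \<in> \<sigma>\<close> by (simp add: f_def)
  qed
  have fi: "inj_on (f T) \<sigma>" for T
  proof (rule inj_onI)
    fix x y assume xy: "x \<in> \<sigma>" "y \<in> \<sigma>" "f T x = f T y"
    then have "x \<in> ends D" "y \<in> ends D" using sub by auto
    then have "state_end D T x = state_end D T y"
      using inj_onD[OF inj_on_glue[OF D], of "state_end D T x" "state_end D T y"]
        state_end_ends(1)[of x] state_end_ends(1)[of y] xy(3) by (simp add: f_def)
    then show "x = y" using state_end_ends(2)[of _ D T] xy sub by (metis subsetD)
  qed
  have rel: "(e, e') \<in> state_rel D T \<longleftrightarrow> (e, e') \<in> conn (graph_on \<sigma> (f T))"
    if e: "e \<in> \<sigma>" and e': "e' \<in> \<sigma>" for e e' T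
  proof
    let ?C = "conn (graph_on \<sigma> (f T))"
    have fC: "(x, f T x) \<in> ?C" if "x \<in> \<sigma>" for x
      using that by (intro conn_base) (simp add: graph_on_def)
    note symE = symD[OF sym_state_edges[OF D]]
    assume "(e, e') \<in> state_rel D T"
    then have "(e, e') \<in> conn (state_edges D T)" by (simp add: state_rel_eq_conn[OF D])
    \<comment> \<open>An end outside \<open>\<sigma>\<close> is represented by its partner under the
      smoothing, which lies in \<open>\<sigma>\<close>.\<close>
    then have "e' \<in> ends D \<and> (if e' \<in> \<sigma> then (e, e') \<in> ?C else (e, state_end D T e') \<in> ?C)"
    proof (induction rule: conn_induct)
      case refl
      then show ?case using e sub by auto
    next
      case (step y z)
      then have yz: "(y, z) \<in> state_edges D T" using symE by blast
      then have y: "y \<in> ends D" by (simp add: state_edges_def)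
      then have z: "z \<in> ends D"
        using yz link_diagram_glue(1)[OF D y] state_end_ends(1)[OF y, of T] by (auto simp: state_edges_def)
      consider "z = state_end D T y" | "z = glue D y" using yz by (auto simp: state_edges_def)
      then show ?case
      proof cases
        case 1
        then show ?thesis
          using step.IH st[OF y] state_end_ends[OF y] z by (auto split: if_splits)
      next
        case 2
        show ?thesis
        proof (cases "y \<in> \<sigma>")
          case True
          then have "z \<notin> \<sigma>" "state_end D T z \<in> \<sigma>" using 2 gl[OF y] st[OF z] by auto
          moreover have "f T (state_end D T z) = y"
            using 2 state_end_ends(2)[OF z] link_diagram_glue(3)[OF D y] by (simp add: f_def)
          ultimately show ?thesis using step.IH True fC[of "state_end D T z"] z
            by (auto intro: conn_trans conn_sym)
        next
          case False
          then have "z \<in> \<sigma>" "state_end D T y \<in> \<sigma>" using 2 gl[OF y] st[OF y] by auto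
          moreover have "f T (state_end D T y) = z"
            using 2 state_end_ends(2)[OF y] by (simp add: f_def)
          ultimately show ?thesis using step.IH False fC[of "state_end D T y"] z
            by (auto intro: conn_trans)
        qed
      qed
    qed
    then show "(e, e') \<in> ?C" using e' by simp
  next
    have "graph_on \<sigma> (f T) \<subseteq> conn (state_edges D T)"
    proof
      fix p assume "p \<in> graph_on \<sigma> (f T)"
      then obtain x where x: "x \<in> \<sigma>" "p = (x, f T x)" by (auto simp: graph_on_def)
      have "(x, state_end D T x) \<in> conn (state_edges D T)"
        "(state_end D T x, f T x) \<in> conn (state_edges D T)"
        using x sub state_end_ends(1)[of x D T] by (auto intro!: conn_base simp: state_edges_def f_def)
      then show "p \<in> conn (state_edges D T)" unfolding x(2) by (rule conn_trans)
    qed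
    then show "(e, e') \<in> state_rel D T" if "(e, e') \<in> conn (graph_on \<sigma> (f T))"
      using that conn_subset state_rel_eq_conn[OF D] by blast
  qed
  have v2: "(v, 2) \<in> \<sigma>" using par[OF vV(1), of 2] v0 by simp
  have "((v, 0), (v, 2)) \<in> conn (graph_on \<sigma> (f (insert v S))) \<longleftrightarrow>
      ((v, 0), (v, 2)) \<notin> conn (graph_on \<sigma> (f S))"
  proof (rule conn_graph_on_swap_iff[OF _ fA fi v0 v2])
    show "finite \<sigma>" using finite_subset[OF sub finite_ends[OF D]] .
    \<comment> \<open>The 0-smoothing sends \<open>0\<close> to \<open>1\<close> and
      \<open>2\<close> to \<open>3\<close>, the 1-smoothing sends \<open>0\<close> to
      \<open>3\<close> and \<open>2\<close> to \<open>1\<close>. The images of the two ends of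
      \<open>v\<close> in \<open>\<sigma>\<close> are thus exchanged.\<close>
    show "f (insert v S) (v, 0) = f S (v, 2)" "f (insert v S) (v, 2) = f S (v, 0)"
      using v(2) vV(2) by (simp_all add: f_def state_end_def smoothed_end_def)
    show "f (insert v S) x = f S x" if x: "x \<in> \<sigma>" "x \<noteq> (v, 0)" "x \<noteq> (v, 2)" for x
    proof -
      obtain w i where wi: "x = (w, i)" "w \<in> vertices D" "i < 4" using x(1) sub by (auto simp: ends_def)
      have "w \<noteq> v"
      proof
        assume "w = v"
        then have "even i" using par[OF wi(2,3)] v0 x(1) wi(1) by simp
        moreover have "i = 0 \<or> i = 1 \<or> i = 2 \<or> i = 3" using wi(3) by linarith
        ultimately show False using x(2,3) wi(1) \<open>w = v\<close> by auto
      qed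
      then show ?thesis by (simp add: f_def state_end_def wi(1) split: option.split)
    qed
  qed simp
  then show ?thesis using rel[OF v0 v2] by simp
qed

section \<open>Edges and faces of the cube\<close>

lemma circles_eq: "link_diagram D \<Longrightarrow> circles D S = ends D // conn (state_edges D S)"
  by (simp add: circles_def state_rel_eq_conn)

lemma circle_eq: "link_diagram D \<Longrightarrow> circle D S e = conn (state_edges D S) `` {e}"
  by (simp add: circle_def state_rel_eq_conn)

lemma finite_circles: "link_diagram D \<Longrightarrow> finite (circles D S)"
  by (simp add: circles_eq finite_quotient_conn finite_ends)

lemma circle_in_circles: "link_diagram D \<Longrightarrow> e \<in> ends D \<Longrightarrow> circle D S e \<in> circles D S"
  by (simp add: circles_eq circle_eq quotientI)

lemma in_circle_self: "link_diagram D \<Longrightarrow> e \<in> circle D S e"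
  by (simp add: circle_eq)

lemma circles_memberD:
  assumes "link_diagram D" "z \<in> circles D S" "e \<in> z"
  shows "z = circle D S e"
proof -
  obtain x where x: "z = conn (state_edges D S) `` {x}"
    using assms(1,2) by (auto simp: circles_eq elim: quotientE)
  then have "(x, e) \<in> conn (state_edges D S)" using assms(3) by simp
  then show ?thesis unfolding circle_eq[OF assms(1)] x conn_class_eq_iff .
qed

lemma crossing_ends:
  assumes "v \<in> crossings D" "i < 4"
  shows "(v, i) \<in> ends D"
  using assms by (simp add: crossings_def ends_def)

lemma state_end_crossing:
  assumes "v \<in> crossings D"
  shows "state_end D S (v, i) = smoothed_end (v \<in> S) (v, i)"
  using assms by (simp add: crossings_def state_end_def)

lemma circle_pair:
  assumes D: "link_diagram D" and v: "v \<in> crossings D" and i: "i < 4"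
  shows "circle D S (v, i) = circle D S (smoothed_end (v \<in> S) (v, i))"
  unfolding circle_eq[OF D] conn_class_eq_iff
  using crossing_ends[OF v i] by (intro conn_base) (simp add: state_edges_def state_end_crossing[OF v])

lemma circle_crossing_ends:
  assumes D: "link_diagram D" and v: "v \<in> crossings D" and i: "i < 4"
  shows "circle D S (v, i) \<in> {circle D S (v, 0), circle D S (v, 2)}"
proof -
  have "i = 0 \<or> i = 1 \<or> i = 2 \<or> i = 3" using i by linarith
  then show ?thesis
    using circle_pair[OF D v, of 0 S] circle_pair[OF D v, of 2 S]
    by (cases "v \<in> S") (auto simp: smoothed_end_def)
qed

text \<open>Either smoothing connects each end at \<open>v\<close> to \<open>(v, 0)\<close> or
  \<open>(v, 2)\<close>. Once these two are identified, all four ends are, and the smoothing at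
  \<open>v\<close> no longer matters.\<close>

lemma conn_insert_change_smoothing:
  assumes D: "link_diagram D" and v: "v \<in> crossings D" and ST: "\<And>w. w \<noteq> v \<Longrightarrow> w \<in> S \<longleftrightarrow> w \<in> T"
  shows "conn (insert ((v, 0), (v, 2)) (state_edges D S)) =
    conn (insert ((v, 0), (v, 2)) (state_edges D T))"
proof -
  have "state_edges D S \<subseteq> conn (insert ((v, 0), (v, 2)) (state_edges D T))"
    if ST: "\<And>w. w \<noteq> v \<Longrightarrow> w \<in> S \<longleftrightarrow> w \<in> T" for S T
  proof
    let ?C = "conn (insert ((v, 0), (v, 2)) (state_edges D T))"
    fix p assume "p \<in> state_edges D S"
    then obtain e f where p: "p = (e, f)" and e: "e \<in> ends D" and f: "f = glue D e \<or> f = state_end D S e"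
      by (auto simp: state_edges_def)
    have sub: "conn (state_edges D T) \<subseteq> ?C" by (rule conn_mono) auto
    have v4: "((v, i), (v, 0)) \<in> ?C" if i: "i < 4" for i
    proof -
      have "((v, 0), (v, 2)) \<in> ?C" by (rule conn_base) simp
      then have v20: "((v, 2), (v, 0)) \<in> ?C" by (rule conn_sym)
      have vi: "((v, i), (v, 0)) \<in> conn (state_edges D T) \<or> ((v, i), (v, 2)) \<in> conn (state_edges D T)"
        using circle_crossing_ends[OF D v i, of T] by (auto simp: circle_eq[OF D] conn_class_eq_iff)
      from vi show ?thesis
      proof
        assume "((v, i), (v, 2)) \<in> conn (state_edges D T)"
        then have "((v, i), (v, 2)) \<in> ?C" using sub by (rule subsetD[rotated])
        then show ?thesis using v20 by (rule conn_trans)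
      qed (rule subsetD[OF sub])
    qed
    show "p \<in> ?C"
    proof (cases "f = glue D e")
      case True
      then show ?thesis using e p by (intro conn_base) (simp add: state_edges_def)
    next
      case False
      then have f: "f = state_end D S e" using f by simp
      show ?thesis
      proof (cases "fst e = v")
        case True
        then obtain i j where "e = (v, i)" "f = (v, j)" "i < 4" "j < 4"
          using e state_end_ends(1,3)[OF e, of S] f by (auto simp: ends_def)
        then show ?thesis unfolding p using conn_trans[OF v4[of i] conn_sym[OF v4[of j]]] by simp
      next
        case False
        then have "f = state_end D T e"
          using ST[OF False] f by (simp add: state_end_def split: option.split)
        then show ?thesis using e p by (intro conn_base) (simp add: state_edges_def)
      qed
    qed
  qed
  from this[of S T] this[of T S] show ?thesis
    using ST by (intro conn_eqI) (auto intro: conn_base)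
qed

text \<open>The states \<open>S\<close> and \<open>T\<close> agree away from \<open>v\<close> but
  are not ordered. The same statement therefore serves for a merge along an edge of the cube and,
  with the roles exchanged, for a split.\<close>

lemma circles_merge:
  assumes D: "link_diagram D" and v: "v \<in> crossings D" and ST: "\<And>w. w \<noteq> v \<Longrightarrow> w \<in> S \<longleftrightarrow> w \<in> T"
    and ne: "circle D S (v, 0) \<noteq> circle D S (v, 2)" and eq: "circle D T (v, 0) = circle D T (v, 2)"
  shows "circles D T = insert (circle D S (v, 0) \<union> circle D S (v, 2))
           (circles D S - {circle D S (v, 0), circle D S (v, 2)})"
    and "circle D T (v, 0) = circle D S (v, 0) \<union> circle D S (v, 2)"
    and "circle D S (v, 0) \<union> circle D S (v, 2) \<notin> circles D S"
proof -
  let ?X = "state_edges D S" and ?Y = "state_edges D T"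
  have nS: "((v, 0), (v, 2)) \<notin> conn ?X" and T: "((v, 0), (v, 2)) \<in> conn ?Y"
    using ne eq by (simp_all add: circle_eq[OF D] conn_class_eq_iff)
  have Y: "conn ?Y = conn (insert ((v, 0), (v, 2)) ?X)"
    using conn_insert_absorb[OF T] conn_insert_change_smoothing[OF D v ST] by simp
  show "circles D T = insert (circle D S (v, 0) \<union> circle D S (v, 2))
           (circles D S - {circle D S (v, 0), circle D S (v, 2)})"
    unfolding circles_eq[OF D] circle_eq[OF D] Y
    by (rule quotient_conn_insert) (simp_all add: crossing_ends[OF v])
  show "circle D S (v, 0) \<union> circle D S (v, 2) \<notin> circles D S"
    unfolding circles_eq[OF D] circle_eq[OF D] by (rule union_conn_notin_quotient[OF nS])
  show "circle D T (v, 0) = circle D S (v, 0) \<union> circle D S (v, 2)"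
  proof (intro Set.set_eqI)
    fix e
    show "e \<in> circle D T (v, 0) \<longleftrightarrow> e \<in> circle D S (v, 0) \<union> circle D S (v, 2)"
      unfolding circle_eq[OF D] Y Un_iff Image_singleton_iff conn_insert_iff
      using nS by simp
  qed
qed

text \<open>The dichotomy excludes an edge that keeps one circle or keeps two. A split is a merge
  read backwards, and a pair with equal entries stands for a single circle.\<close>

lemma circles_insert_cases:
  fixes S :: "nat set" and v :: nat
  assumes D: "link_diagram D" and v: "v \<in> crossings D" "v \<notin> S"
  defines "A \<equiv> circles D S" and "B \<equiv> circles D (insert v S)"
    and "a1 \<equiv> circle D S (v, 0)" and "a2 \<equiv> circle D S (v, 2)"
    and "b1 \<equiv> circle D (insert v S) (v, 0)" and "b2 \<equiv> circle D (insert v S) (v, 2)"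
  shows "A - B = {a1, a2}" "B - A = {b1, b2}" "a1 \<union> a2 = b1 \<union> b2" "a1 = a2 \<longleftrightarrow> b1 \<noteq> b2"
proof -
  show dich: "a1 = a2 \<longleftrightarrow> b1 \<noteq> b2"
    using circle_dichotomy[OF D v] by (simp add: a1_def a2_def b1_def b2_def circle_eq_iff[OF D])
  have mem: "a1 \<in> A" "a2 \<in> A" "b1 \<in> B" "b2 \<in> B"
    by (simp_all add: A_def B_def a1_def a2_def b1_def b2_def circle_in_circles[OF D] crossing_ends[OF v(1)])
  have "A - B = {a1, a2} \<and> B - A = {b1, b2} \<and> a1 \<union> a2 = b1 \<union> b2"
  proof (cases "a1 = a2")
    case False
    then have b: "b1 = b2" using dich by simp
    have "B = insert (a1 \<union> a2) (A - {a1, a2})" "b1 = a1 \<union> a2" "a1 \<union> a2 \<notin> A"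
      unfolding A_def B_def a1_def a2_def b1_def
      by (rule circles_merge[OF D v(1)]; use False b in \<open>auto simp: a1_def a2_def b1_def b2_def\<close>)+
    then show ?thesis using mem b by auto
  next
    case True
    then have b: "b1 \<noteq> b2" using dich by simp
    have "A = insert (b1 \<union> b2) (B - {b1, b2})" "a1 = b1 \<union> b2" "b1 \<union> b2 \<notin> B"
      unfolding A_def B_def b1_def b2_def a1_def
      by (rule circles_merge[OF D v(1)]; use True b in \<open>auto simp: a1_def a2_def b1_def b2_def\<close>)+
    then show ?thesis using mem True by auto
  qed
  then show "A - B = {a1, a2}" "B - A = {b1, b2}" "a1 \<union> a2 = b1 \<union> b2" by blast+
qed

text \<open>The changed circles are characterised by touching \<open>v\<close>, a property of a
  circle by itself. This makes changes at two different crossings comparable.\<close>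

lemma circles_insert_diff:
  assumes D: "link_diagram D" and v: "v \<in> crossings D" "v \<notin> S"
  shows "circles D S - circles D (insert v S) = {z \<in> circles D S. \<exists>i<4. (v, i) \<in> z}"
    and "circles D (insert v S) - circles D S = {z \<in> circles D (insert v S). \<exists>i<4. (v, i) \<in> z}"
proof -
  have *: "{circle D T (v, 0), circle D T (v, 2)} = {z \<in> circles D T. \<exists>i<4. (v, i) \<in> z}" for T
  proof (intro equalityI subsetI)
    fix z assume z: "z \<in> {circle D T (v, 0), circle D T (v, 2)}"
    have "z \<in> circles D T" using z circle_in_circles[OF D crossing_ends[OF v(1)]] by auto
    moreover have "(v, 0) \<in> z \<or> (v, 2) \<in> z" using z in_circle_self[OF D] by auto
    ultimately show "z \<in> {z \<in> circles D T. \<exists>i<4. (v, i) \<in> z}"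
      by (metis (mono_tags, lifting) mem_Collect_eq rel_simps(51) numeral_less_iff semiring_norm(76,78) zero_less_numeral)
  next
    fix z assume "z \<in> {z \<in> circles D T. \<exists>i<4. (v, i) \<in> z}"
    then obtain i where "z \<in> circles D T" "i < 4" "(v, i) \<in> z" by blast
    then show "z \<in> {circle D T (v, 0), circle D T (v, 2)}"
      using circles_memberD[OF D] circle_crossing_ends[OF D v(1)] by metis
  qed
  show "circles D S - circles D (insert v S) = {z \<in> circles D S. \<exists>i<4. (v, i) \<in> z}"
    "circles D (insert v S) - circles D S = {z \<in> circles D (insert v S). \<exists>i<4. (v, i) \<in> z}"
    unfolding *[symmetric] by (rule circles_insert_cases[OF D v])+
qed

lemma Union_circles_insert:
  assumes D: "link_diagram D" and v: "v \<in> crossings D" "v \<notin> S"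
  shows "\<Union>(circles D S - circles D (insert v S)) = \<Union>(circles D (insert v S) - circles D S)"
  using circles_insert_cases[OF D v] by simp

text \<open>A saddle is a pair of pants, with three boundary circles whichever way it is
  read.\<close>

lemma card_circles_insert:
  assumes D: "link_diagram D" and v: "v \<in> crossings D" "v \<notin> S"
  shows "card (circles D S - circles D (insert v S)) + card (circles D (insert v S) - circles D S) = 3"
proof (cases "circle D S (v, 0) = circle D S (v, 2)")
  case True
  then show ?thesis
    using circles_insert_cases(4)[OF D v] by (simp add: circles_insert_cases(1,2)[OF D v])
next
  case False
  then show ?thesis
    using circles_insert_cases(4)[OF D v] by (simp add: circles_insert_cases(1,2)[OF D v])
qed

text \<open>
  The matrix entries of a connected genus 0 cobordism: counting the labels \<open>x\<close> on its incoming
  and the labels \<open>1\<close> on its outgoing circles, the entry is \<open>1\<close> if the total is one, and \<open>0\<close>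
  otherwise. For a connected genus 1 cobordism it is \<open>2\<close> if the total is zero, and \<open>0\<close> otherwise.
\<close>

definition saddle ::
  "'c set \<Rightarrow> 'c set \<Rightarrow> ('c \<Rightarrow> gen) \<Rightarrow> ('c \<Rightarrow> gen) \<Rightarrow> bool" where
  "saddle A B \<epsilon> \<epsilon>' \<longleftrightarrow> (\<forall>z\<in>A \<inter> B. \<epsilon> z = \<epsilon>' z) \<and>
     card {z \<in> A - B. \<epsilon> z = Gen_x} + card {z \<in> B - A. \<epsilon>' z = Gen_1} = 1"

lemma not_Gen_iff: "a \<noteq> Gen_x \<longleftrightarrow> a = Gen_1" "a \<noteq> Gen_1 \<longleftrightarrow> a = Gen_x"
  by (cases a; simp)+

lemma card_Collect_pair:
  "card {z \<in> {a, b}. P z} = (if P a then 1 else 0) + (if a \<noteq> b \<and> P b then 1 else 0)"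
proof -
  have "{z \<in> {a, b}. P z} = (if P a then {a} else {}) \<union> (if P b then {b} else {})" by auto
  then show ?thesis by auto
qed

text \<open>Each nonzero structure constant has exactly one label among incoming \<open>x\<close>
  and outgoing \<open>1\<close>: an incoming \<open>x\<close> if a factor \<open>x\<close> is merged
  or \<open>x\<close> is split, and an outgoing \<open>1\<close> for the product of two units or for
  either term in the coproduct of \<open>1\<close>. No other combination has total one.\<close>

lemma edge_coeff_saddle:
  assumes D: "link_diagram D" and v: "v \<in> crossings D" "v \<notin> S"
  shows "edge_coeff R D S v \<epsilon> \<epsilon>' =
    (if saddle (circles D S) (circles D (insert v S)) \<epsilon> \<epsilon>' then \<one>\<^bsub>R\<^esub> else \<zero>\<^bsub>R\<^esub>)"
proof -
  define a1 a2 b1 b2 where ab: "a1 = circle D S (v, 0)" "a2 = circle D S (v, 2)"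
    "b1 = circle D (insert v S) (v, 0)" "b2 = circle D (insert v S) (v, 2)"
  let ?A = "circles D S" and ?B = "circles D (insert v S)"
  note c = circles_insert_cases[OF D v, folded ab]
  have "?A \<inter> ?B = ?A - {a1, a2}" using c(1) by blast
  then have s: "saddle ?A ?B \<epsilon> \<epsilon>' \<longleftrightarrow> \<not> (\<exists>z\<in>?A - {a1, a2}. \<epsilon> z \<noteq> \<epsilon>' z) \<and>
     card {z \<in> {a1, a2}. \<epsilon> z = Gen_x} + card {z \<in> {b1, b2}. \<epsilon>' z = Gen_1} = 1"
    unfolding saddle_def c(1,2) by blast
  have e: "edge_coeff R D S v \<epsilon> \<epsilon>' = (if \<exists>z\<in>?A - {a1, a2}. \<epsilon> z \<noteq> \<epsilon>' z then \<zero>\<^bsub>R\<^esub>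
      else if a1 \<noteq> a2 then mult_coeff R (\<epsilon> a1) (\<epsilon> a2) (\<epsilon>' b1)
      else comult_coeff R (\<epsilon> a1) (\<epsilon>' b1) (\<epsilon>' b2))"
    unfolding edge_coeff_def Let_def ab ..
  show ?thesis
  proof (cases "a1 = a2")
    case True
    then show ?thesis using c(4) unfolding e s card_Collect_pair
      by (cases "\<epsilon> a1"; cases "\<epsilon>' b1"; cases "\<epsilon>' b2") (auto simp: comult_coeff_def)
  next
    case False
    then show ?thesis using c(4) unfolding e s card_Collect_pair
      by (cases "\<epsilon> a1"; cases "\<epsilon> a2"; cases "\<epsilon>' b1") (auto simp: mult_coeff_def)
  qed
qed

lemma sum_gen_deg:
  assumes "finite X"
  shows "(\<Sum>z\<in>X. gen_deg (f z)) = int (card X) - 2 * int (card {z \<in> X. f z = Gen_x})"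
    and "(\<Sum>z\<in>X. gen_deg (f z)) = 2 * int (card {z \<in> X. f z = Gen_1}) - int (card X)"
proof -
  have deg: "gen_deg a = 1 - 2 * (if a = Gen_x then 1 else 0)"
    "gen_deg a = 2 * (if a = Gen_1 then 1 else 0) - 1" for a
    by (cases a; simp)+
  have c: "(\<Sum>z\<in>X. if f z = a then 1 else 0 :: int) = int (card {z \<in> X. f z = a})" for a
    using assms by (simp add: sum.If_cases Int_def)
  show "(\<Sum>z\<in>X. gen_deg (f z)) = int (card X) - 2 * int (card {z \<in> X. f z = Gen_x})"
    by (simp add: deg(1) sum_subtractf sum_distrib_left[symmetric] c)
  show "(\<Sum>z\<in>X. gen_deg (f z)) = 2 * int (card {z \<in> X. f z = Gen_1}) - int (card X)"
    by (simp add: deg(2) sum_subtractf sum_distrib_left[symmetric] c)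
qed

text \<open>Three circles change and the label total is one, so the labels lose degree 3 - 2 = 1.
  The additional 1-smoothing restores it.\<close>

lemma kgen_deg_saddle:
  assumes D: "link_diagram D" and v: "v \<in> crossings D" "v \<notin> S" and fin: "finite S"
    and s: "saddle (circles D S) (circles D (insert v S)) \<epsilon> \<epsilon>'"
  shows "kgen_deg D (insert v S, \<epsilon>') = kgen_deg D (S, \<epsilon>)"
proof -
  let ?A = "circles D S" and ?B = "circles D (insert v S)"
  note f = finite_circles[OF D]
  have A: "(\<Sum>z\<in>?A. gen_deg (\<epsilon> z)) = (\<Sum>z\<in>?A \<inter> ?B. gen_deg (\<epsilon> z)) + (\<Sum>z\<in>?A - ?B. gen_deg (\<epsilon> z))"
    using f by (subst sum.union_disjoint[symmetric]) (auto intro: sum.cong)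
  have B: "(\<Sum>z\<in>?B. gen_deg (\<epsilon>' z)) = (\<Sum>z\<in>?A \<inter> ?B. gen_deg (\<epsilon>' z)) + (\<Sum>z\<in>?B - ?A. gen_deg (\<epsilon>' z))"
    using f by (subst sum.union_disjoint[symmetric]) (auto intro: sum.cong)
  have "(\<Sum>z\<in>?A \<inter> ?B. gen_deg (\<epsilon>' z)) = (\<Sum>z\<in>?A \<inter> ?B. gen_deg (\<epsilon> z))"
    using s by (intro sum.cong) (auto simp: saddle_def)
  moreover have "(\<Sum>z\<in>?A - ?B. gen_deg (\<epsilon> z)) = int (card (?A - ?B)) - 2 * int (card {z \<in> ?A - ?B. \<epsilon> z = Gen_x})"
    using f by (intro sum_gen_deg) auto
  moreover have "(\<Sum>z\<in>?B - ?A. gen_deg (\<epsilon>' z)) = 2 * int (card {z \<in> ?B - ?A. \<epsilon>' z = Gen_1}) - int (card (?B - ?A))"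
    using f by (intro sum_gen_deg) auto
  moreover have "card {z \<in> ?A - ?B. \<epsilon> z = Gen_x} + card {z \<in> ?B - ?A. \<epsilon>' z = Gen_1} = 1"
    using s by (simp add: saddle_def)
  moreover note card_circles_insert[OF D v]
  moreover have "card (insert v S) = card S + 1" using fin v(2) by simp
  ultimately show ?thesis unfolding kgen_deg_def prod.case A B by linarith
qed

text \<open>
  Composing two saddles: the intermediate labelling is determined on all circles except those
  of \<open>B - A - C\<close>, where it amounts to the choice of the set \<open>P\<close> of circles labelled \<open>1\<close>.
\<close>

lemma card_saddle_compositions:
  fixes A B C :: "'c set"
  assumes fin: "finite A" "finite B" "finite C"
  shows "card {g \<in> B \<rightarrow>\<^sub>E UNIV. saddle A B \<epsilon> g \<and> saddle B C g \<epsilon>'} =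
    (if \<forall>z\<in>A \<inter> B \<inter> C. \<epsilon> z = \<epsilon>' z
     then card {P \<in> Pow (B - A - C).
        card {z \<in> A - B. \<epsilon> z = Gen_x} + card {z \<in> B \<inter> C - A. \<epsilon>' z = Gen_1} + card P = 1 \<and>
        card {z \<in> A \<inter> B - C. \<epsilon> z = Gen_x} + card {z \<in> C - B. \<epsilon>' z = Gen_1} + card (B - A - C - P) = 1}
     else 0)"
proof (cases "\<forall>z\<in>A \<inter> B \<inter> C. \<epsilon> z = \<epsilon>' z")
  case False
  then have none: "{g \<in> B \<rightarrow>\<^sub>E UNIV. saddle A B \<epsilon> g \<and> saddle B C g \<epsilon>'} = {}"
    unfolding saddle_def by (auto 4 4)
  show ?thesis unfolding if_not_P[OF False] none by simp
next
  case True
  let ?M = "B - A - C"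
  define G where "G = {g \<in> B \<rightarrow>\<^sub>E UNIV. saddle A B \<epsilon> g \<and> saddle B C g \<epsilon>'}"
  define Q where "Q = {P \<in> Pow ?M.
        card {z \<in> A - B. \<epsilon> z = Gen_x} + card {z \<in> B \<inter> C - A. \<epsilon>' z = Gen_1} + card P = 1 \<and>
        card {z \<in> A \<inter> B - C. \<epsilon> z = Gen_x} + card {z \<in> C - B. \<epsilon>' z = Gen_1} + card (?M - P) = 1}"
  define ones where "ones = (\<lambda>g. {z \<in> ?M. g z = Gen_1})"
  \<comment> \<open>The order of the tests is harmless: on \<open>A \<inter> B \<inter> C\<close>
    the two outer labellings agree.\<close>
  define lab where "lab = (\<lambda>P. \<lambda>z\<in>B. if z \<in> A then \<epsilon> z else if z \<in> C then \<epsilon>' z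
    else if z \<in> P then Gen_1 else Gen_x)"
  have iff: "g \<in> G \<longleftrightarrow> ones g \<in> Q"
    if g: "g \<in> B \<rightarrow>\<^sub>E UNIV" "\<And>z. z \<in> A \<inter> B \<Longrightarrow> g z = \<epsilon> z" "\<And>z. z \<in> B \<inter> C \<Longrightarrow> g z = \<epsilon>' z" for g
  proof -
    have "{z \<in> B - A. g z = Gen_1} = {z \<in> B \<inter> C - A. \<epsilon>' z = Gen_1} \<union> ones g"
      using g(3) by (auto simp: ones_def)
    moreover have "card ({z \<in> B \<inter> C - A. \<epsilon>' z = Gen_1} \<union> ones g) =
        card {z \<in> B \<inter> C - A. \<epsilon>' z = Gen_1} + card (ones g)"
      using fin by (intro card_Un_disjoint) (auto simp: ones_def)
    ultimately have 1: "card {z \<in> B - A. g z = Gen_1} = card {z \<in> B \<inter> C - A. \<epsilon>' z = Gen_1} + card (ones g)"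
      by simp
    have "{z \<in> B - C. g z = Gen_x} = {z \<in> A \<inter> B - C. \<epsilon> z = Gen_x} \<union> (?M - ones g)"
      using g(2) by (auto simp: ones_def not_Gen_iff)
    moreover have "card ({z \<in> A \<inter> B - C. \<epsilon> z = Gen_x} \<union> (?M - ones g)) =
        card {z \<in> A \<inter> B - C. \<epsilon> z = Gen_x} + card (?M - ones g)"
      using fin by (intro card_Un_disjoint) auto
    ultimately have 2: "card {z \<in> B - C. g z = Gen_x} = card {z \<in> A \<inter> B - C. \<epsilon> z = Gen_x} + card (?M - ones g)"
      by simp
    have "ones g \<subseteq> ?M" by (auto simp: ones_def)
    then show ?thesis using g unfolding G_def Q_def saddle_def mem_Collect_eq 1 2 by auto
  qed
  have lab: "lab P \<in> B \<rightarrow>\<^sub>E UNIV" "\<And>z. z \<in> A \<inter> B \<Longrightarrow> lab P z = \<epsilon> z"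
    "\<And>z. z \<in> B \<inter> C \<Longrightarrow> lab P z = \<epsilon>' z" for P
    using True by (auto simp: lab_def)
  have ones_lab: "ones (lab P) = P" if "P \<subseteq> ?M" for P
    using that by (auto simp: ones_def lab_def split: if_splits)
  have G: "g \<in> B \<rightarrow>\<^sub>E UNIV" "\<And>z. z \<in> A \<inter> B \<Longrightarrow> g z = \<epsilon> z" "\<And>z. z \<in> B \<inter> C \<Longrightarrow> g z = \<epsilon>' z"
    if "g \<in> G" for g
    using that by (auto simp: G_def saddle_def)
  have lab_ones: "lab (ones g) = g" if "g \<in> G" for g
  proof
    fix z
    show "lab (ones g) z = g z"
    proof (cases "z \<in> B")
      case True
      then show ?thesis
        using G(2,3)[OF that, of z] by (cases "g z") (simp_all add: lab_def ones_def)
    next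
      case False
      then show ?thesis using PiE_arb[OF G(1)[OF that] False] by (simp add: lab_def)
    qed
  qed
  have "bij_betw ones G Q"
  proof (rule bij_betw_byWitness[where f' = lab])
    show "\<forall>g\<in>G. lab (ones g) = g" using lab_ones by blast
    show "\<forall>P\<in>Q. ones (lab P) = P" using ones_lab by (auto simp: Q_def)
    show "ones ` G \<subseteq> Q"
    proof safe
      fix g assume g: "g \<in> G"
      have "g \<in> G \<longleftrightarrow> ones g \<in> Q" by (rule iff) (fact G(1)[OF g], (erule G(2,3)[OF g])+)
      then show "ones g \<in> Q" using g by simp
    qed
    show "lab ` Q \<subseteq> G"
    proof safe
      fix P assume P: "P \<in> Q"
      then have "ones (lab P) = P" by (intro ones_lab) (simp add: Q_def)
      moreover have "lab P \<in> G \<longleftrightarrow> ones (lab P) \<in> Q" by (rule iff) (fact lab(1), (erule lab(2,3))+)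
      ultimately show "lab P \<in> G" using P by simp
    qed
  qed
  then have "card G = card Q" by (rule bij_betw_same_card)
  then show ?thesis using True by (simp add: G_def Q_def)
qed

text \<open>Gluing along one free circle gives genus 0: its label is forced, and only the sum
  \<open>p + q\<close> decides whether a label exists.\<close>

lemma card_Pow_one:
  assumes "card M = 1"
  shows "card {P \<in> Pow M. p + card P = 1 \<and> q + card (M - P) = 1} = (if p + q = (1::nat) then 1 else 0)"
proof -
  obtain a where M: "M = {a}" using assms card_1_singletonE by blast
  have "{P \<in> Pow M. p + card P = 1 \<and> q + card (M - P) = 1} =
    (if p + q = 1 then {if p = 0 then {a} else {}} else {})"
    unfolding M by (auto simp: subset_singleton_iff)
  then show ?thesis by simp
qed

text \<open>Gluing along two free circles creates a handle. Adding the two conditions forces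
  \<open>p = q = 0\<close>, and either circle may carry the label \<open>1\<close>; this is the
  factor 2 in multiplication after comultiplication.\<close>

lemma card_Pow_two:
  assumes "card M = 2"
  shows "card {P \<in> Pow M. p + card P = 1 \<and> q + card (M - P) = 1} = (if p + q = (0::nat) then 2 else 0)"
proof -
  have fin: "finite M" using assms by (metis card.infinite zero_neq_numeral)
  have key: "p + card P = 1 \<and> q + card (M - P) = 1 \<longleftrightarrow> p + q = 0 \<and> card P = 1" if "P \<subseteq> M" for P
    using card_Diff_subset[OF finite_subset[OF that fin] that] card_mono[OF fin that] assms by linarith
  have eq: "{P \<in> Pow M. p + card P = 1 \<and> q + card (M - P) = 1} = {P. P \<subseteq> M \<and> p + q = 0 \<and> card P = 1}"
    unfolding Pow_iff by (rule Collect_cong, rule conj_cong[OF refl], rule key)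
  show ?thesis
  proof (cases "p + q = 0")
    case True
    then show ?thesis unfolding eq using n_subsets[OF fin, of 1] assms by simp
  next
    case False
    then have none: "{P. P \<subseteq> M \<and> p + q = 0 \<and> card P = 1} = {}" by blast
    show ?thesis unfolding eq if_not_P[OF False] none by simp
  qed
qed

text \<open>
  By counting Euler characteristics, both ways around a face have the same number of free
  intermediate circles. If there is none, the two saddles are disjoint and exchange their roles.
  Otherwise only the sum of the two label counts matters, and it is the same both ways.
\<close>

lemma saddle_compositions_commute:
  assumes D: "link_diagram D" and u: "u \<in> crossings D" "u \<notin> S" and v: "v \<in> crossings D" "v \<notin> S"
    and uv: "u \<noteq> v"
  defines "A \<equiv> circles D S" and "B \<equiv> circles D (insert u S)" and "B' \<equiv> circles D (insert v S)"
    and "C \<equiv> circles D (insert u (insert v S))"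
  shows "card {g \<in> B \<rightarrow>\<^sub>E UNIV. saddle A B \<epsilon> g \<and> saddle B C g \<epsilon>'} =
    card {g \<in> B' \<rightarrow>\<^sub>E UNIV. saddle A B' \<epsilon> g \<and> saddle B' C g \<epsilon>'}"
proof -
  have fin: "finite A" "finite B" "finite B'" "finite C"
    unfolding A_def B_def B'_def C_def by (rule finite_circles[OF D])+
  have uvS: "v \<notin> insert u S" "u \<notin> insert v S" using u v uv by auto
  have C': "C = circles D (insert v (insert u S))" unfolding C_def by (simp add: insert_commute)
  define U where "U = (\<lambda>z. \<exists>i<4. (u, i) \<in> (z :: vertex_end set))"
  define V where "V = (\<lambda>z. \<exists>i<4. (v, i) \<in> (z :: vertex_end set))"
  have d: "A - B = {z \<in> A. U z}" "B - A = {z \<in> B. U z}"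
    "B - C = {z \<in> B. V z}" "C - B = {z \<in> C. V z}"
    "A - B' = {z \<in> A. V z}" "B' - A = {z \<in> B'. V z}"
    "B' - C = {z \<in> B'. U z}" "C - B' = {z \<in> C. U z}"
    using circles_insert_diff[OF D u] circles_insert_diff[OF D v]
      circles_insert_diff[OF D v(1) uvS(1)] circles_insert_diff[OF D u(1) uvS(2)]
    by (simp_all only: A_def B_def B'_def U_def V_def C' insert_commute[of u v])
  have un: "\<Union>(A - B) = \<Union>(B - A)" "\<Union>(A - B') = \<Union>(B' - A)"
    using Union_circles_insert[OF D u] Union_circles_insert[OF D v]
    by (simp_all only: A_def B_def B'_def)
  have un2: "\<Union>(B - C) = \<Union>(C - B)"
    using Union_circles_insert[OF D v(1) uvS(1)] by (simp only: B_def C')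
  have c3: "card (A - B) + card (B - A) = 3" "card (A - B') + card (B' - A) = 3"
    "card (B - C) + card (C - B) = 3" "card (B' - C) + card (C - B') = 3"
    using card_circles_insert[OF D u] card_circles_insert[OF D v]
      card_circles_insert[OF D v(1) uvS(1)] card_circles_insert[OF D u(1) uvS(2)]
    by (simp_all only: A_def B_def B'_def C' insert_commute[of u v])
  let ?M = "B - A - C" and ?N = "B' - A - C"
  \<comment> \<open>Either way, the circles that persist are those touching neither
    crossing.\<close>
  have core: "A \<inter> B \<inter> C = A \<inter> B' \<inter> C" using d by blast
  have split: "card X + card Y = card Z" if "X \<inter> Y = {}" "X \<union> Y = Z" "finite Z" for X Y Z :: "'x set"
    using card_Un_disjoint[of X Y] that by (metis finite_Un)
  define p1 p2 p1' p2' where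
    p: "p1 = card {z \<in> A - B. \<epsilon> z = Gen_x} + card {z \<in> B \<inter> C - A. \<epsilon>' z = Gen_1}"
    "p2 = card {z \<in> A \<inter> B - C. \<epsilon> z = Gen_x} + card {z \<in> C - B. \<epsilon>' z = Gen_1}"
    "p1' = card {z \<in> A - B'. \<epsilon> z = Gen_x} + card {z \<in> B' \<inter> C - A. \<epsilon>' z = Gen_1}"
    "p2' = card {z \<in> A \<inter> B' - C. \<epsilon> z = Gen_x} + card {z \<in> C - B'. \<epsilon>' z = Gen_1}"
  have tot: "card {z \<in> A - X. \<epsilon> z = Gen_x} + card {z \<in> X \<inter> C - A. \<epsilon>' z = Gen_1} +
      (card {z \<in> A \<inter> X - C. \<epsilon> z = Gen_x} + card {z \<in> C - X. \<epsilon>' z = Gen_1}) =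
      card {z \<in> A - A \<inter> X \<inter> C. \<epsilon> z = Gen_x} + card {z \<in> C - A \<inter> X \<inter> C. \<epsilon>' z = Gen_1}" for X
  proof -
    have "card {z \<in> A - X. \<epsilon> z = Gen_x} + card {z \<in> A \<inter> X - C. \<epsilon> z = Gen_x} =
        card {z \<in> A - A \<inter> X \<inter> C. \<epsilon> z = Gen_x}"
      using fin by (intro split) auto
    moreover have "card {z \<in> X \<inter> C - A. \<epsilon>' z = Gen_1} + card {z \<in> C - X. \<epsilon>' z = Gen_1} =
        card {z \<in> C - A \<inter> X \<inter> C. \<epsilon>' z = Gen_1}"
      using fin by (intro split) auto
    ultimately show ?thesis by simp
  qed
  have tot': "p1 + p2 = p1' + p2'"
    using tot[of B] tot[of B'] core unfolding p by simp
  \<comment> \<open>Two saddles have six boundary circles in all. A free intermediate circle is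
    counted twice and every other changed circle once, so the outer states determine the number of
    free circles.\<close>
  have euler: "card (A - A \<inter> X \<inter> C) + card (C - A \<inter> X \<inter> C) + 2 * card (X - A - C) = 6"
    if "card (A - X) + card (X - A) = 3" "card (X - C) + card (C - X) = 3" "finite X" for X
  proof -
    have "card (A - X) + card (A \<inter> X - C) = card (A - A \<inter> X \<inter> C)"
      "card (X \<inter> C - A) + card (C - X) = card (C - A \<inter> X \<inter> C)"
      "card (X - A - C) + card (X \<inter> C - A) = card (X - A)"
      "card (X - A - C) + card (A \<inter> X - C) = card (X - C)"
      by (rule split; use fin that in auto)+
    then show ?thesis using that by linarith
  qed
  have MN: "card ?M = card ?N"
    using euler[OF c3(1,3) fin(2)] euler[OF c3(2,4) fin(3)] core by simp
  \<comment> \<open>The saddle at \<open>u\<close> has an incoming circle, hence at most two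
    outgoing ones.\<close>
  have "card ?M \<le> 2"
  proof -
    have "A - B \<noteq> {}"
      using circles_insert_cases(1)[OF D u] by (simp add: A_def B_def)
    then have "card (A - B) > 0" using fin by (simp add: card_gt_0_iff)
    then have "card (B - A) \<le> 2" using c3(1) by simp
    moreover have "card ?M \<le> card (B - A)" using fin by (intro card_mono) auto
    ultimately show ?thesis by simp
  qed
  then consider "card ?M = 0" | "card ?M = 1" | "card ?M = 2" by linarith
  then have "card {P \<in> Pow ?M. p1 + card P = 1 \<and> p2 + card (?M - P) = 1} =
    card {P \<in> Pow ?N. p1' + card P = 1 \<and> p2' + card (?N - P) = 1}"
  proof cases
    case 1
    then have M: "?M = {}" and N: "?N = {}" using fin MN by (metis card_0_eq finite_Diff)+
    have nB: "\<not> (U z \<and> V z)" if "z \<in> B" for z using M d(2,3) that by blast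
    have nB': "\<not> (U z \<and> V z)" if "z \<in> B'" for z using N d(6,7) that by blast
    \<comment> \<open>A saddle only regroups the ends of the circles it changes. A circle of
      \<open>A\<close> touching both crossings would leave an end of \<open>v\<close> on a circle of
      \<open>B\<close> that touches \<open>u\<close>.\<close>
    have nA: "\<not> (U z \<and> V z)" if z: "z \<in> A" for z
    proof
      assume UV: "U z \<and> V z"
      then obtain i where i: "i < 4" "(v, i) \<in> z" by (auto simp: V_def)
      have "z \<in> A - B" using UV z d(1) by blast
      then obtain y where "y \<in> B - A" "(v, i) \<in> y" using un(1) i(2) by blast
      then show False using nB[of y] d(2) i(1) by (auto simp: V_def)
    qed
    have nC: "\<not> (U z \<and> V z)" if z: "z \<in> C" for z
    proof
      assume UV: "U z \<and> V z"
      then obtain i where i: "i < 4" "(u, i) \<in> z" by (auto simp: U_def)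
      have "z \<in> C - B" using UV z d(4) by blast
      then obtain y where "y \<in> B - C" "(u, i) \<in> y" using un2 i(2) by blast
      then show False using nB[of y] d(3) i(1) by (auto simp: U_def)
    qed
    \<comment> \<open>When no circle touches both crossings, whatever changes at the first saddle on
      one path changes at the second saddle on the other.\<close>
    have "z \<in> A - B \<longleftrightarrow> z \<in> A \<inter> B' - C" "z \<in> B \<inter> C - A \<longleftrightarrow> z \<in> C - B'"
      "z \<in> A \<inter> B - C \<longleftrightarrow> z \<in> A - B'" "z \<in> C - B \<longleftrightarrow> z \<in> B' \<inter> C - A" for z
      using d[THEN arg_cong[where f = "\<lambda>X. z \<in> X"]] nA[of z] nB[of z] nB'[of z] nC[of z]
      unfolding Diff_iff Int_iff mem_Collect_eq by argo+
    note this[THEN Set.set_eqI]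
    then have "p1 = p2'" "p2 = p1'" unfolding p by simp_all
    moreover have "{P \<in> Pow ({} :: vertex_end set set). a + card P = 1 \<and> b + card ({} - P) = 1} =
        {P \<in> Pow {}. b + card P = 1 \<and> a + card ({} - P) = 1}" for a b :: nat
      by auto
    ultimately show ?thesis unfolding M N by metis
  next
    case 2
    then show ?thesis using card_Pow_one[of ?M p1 p2] card_Pow_one[of ?N p1' p2'] MN tot' by simp
  next
    case 3
    then show ?thesis using card_Pow_two[of ?M p1 p2] card_Pow_two[of ?N p1' p2'] MN tot' by simp
  qed
  then show ?thesis
    unfolding card_saddle_compositions[OF fin(1,2,4)] card_saddle_compositions[OF fin(1,3,4)] core p
    by (simp only:)
qed

section \<open>The Khovanov complex\<close>

lemma finite_UNIV_gen: "finite (UNIV :: gen set)"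
  by (rule finite_subset[of _ "{Gen_1, Gen_x}"]) (use gen.exhaust in auto)

lemma finite_crossings: "link_diagram D \<Longrightarrow> finite (crossings D)"
  by (simp add: link_diagram_def crossings_def)

lemma finite_kgens:
  assumes "link_diagram D"
  shows "finite (kgens D)"
  unfolding kgens_def
  using finite_crossings[OF assms] finite_circles[OF assms] finite_UNIV_gen
  by (intro finite_SigmaI finite_PiE) auto

lemma kgens_iff: "(S, \<epsilon>) \<in> kgens D \<longleftrightarrow> S \<subseteq> crossings D \<and> \<epsilon> \<in> circles D S \<rightarrow>\<^sub>E UNIV"
  by (auto simp: kgens_def)

section \<open>Edge signs and the square of the differential\<close>

definition edge_sign :: "('r, 'b) ring_scheme \<Rightarrow> nat set \<Rightarrow> nat \<Rightarrow> 'r" where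
  "edge_sign R S v = (\<ominus>\<^bsub>R\<^esub> \<one>\<^bsub>R\<^esub>) [^]\<^bsub>R\<^esub> card {u \<in> S. u < v}"

lemma diff_coeff_insert:
  assumes R: "cring R" and D: "link_diagram D" and v: "v \<in> crossings D" "v \<notin> S"
  shows "diff_coeff R D (S, \<epsilon>) (insert v S, \<epsilon>') =
    (if saddle (circles D S) (circles D (insert v S)) \<epsilon> \<epsilon>' then edge_sign R S v else \<zero>\<^bsub>R\<^esub>)"
proof -
  interpret cring R by (rule R)
  have "insert v S - S = {v}" using v(2) by auto
  then have "the_elem (insert v S - S) = v" by simp
  moreover have "\<exists>w\<in>crossings D - S. insert v S = insert w S" using v by blast
  ultimately show ?thesis
    by (simp add: diff_coeff_def Let_def edge_coeff_saddle[OF D v] edge_sign_def)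
qed

lemma diff_coeff_eq_zero:
  assumes "\<And>v. v \<in> crossings D \<Longrightarrow> v \<notin> S \<Longrightarrow> T \<noteq> insert v S"
  shows "diff_coeff R D (S, \<epsilon>) (T, \<epsilon>') = \<zero>\<^bsub>R\<^esub>"
  using assms by (auto simp: diff_coeff_def)

lemma diff_coeff_nonzeroE:
  assumes "cring R" "link_diagram D" "diff_coeff R D (S, \<epsilon>) (T, \<epsilon>') \<noteq> \<zero>\<^bsub>R\<^esub>"
  obtains v where "v \<in> crossings D" "v \<notin> S" "T = insert v S"
    "saddle (circles D S) (circles D (insert v S)) \<epsilon> \<epsilon>'"
  using assms diff_coeff_eq_zero[of D S T R \<epsilon> \<epsilon>'] diff_coeff_insert[OF assms(1,2), of _ S \<epsilon> \<epsilon>'] by metis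

lemma diff_coeff_closed:
  assumes R: "cring R" and D: "link_diagram D"
  shows "diff_coeff R D x y \<in> carrier R"
proof -
  interpret cring R by (rule R)
  obtain S \<epsilon> T \<epsilon>' where xy: "x = (S, \<epsilon>)" "y = (T, \<epsilon>')" by fastforce
  show ?thesis
  proof (cases "diff_coeff R D x y = \<zero>\<^bsub>R\<^esub>")
    case False
    then obtain v where "v \<in> crossings D" "v \<notin> S" "T = insert v S"
      unfolding xy by (rule diff_coeff_nonzeroE[OF R D])
    then show ?thesis by (simp add: xy diff_coeff_insert[OF R D] edge_sign_def)
  qed simp
qed

text \<open>Of two crossings only the smaller one is counted in the sign of the other, so exactly
  one of the two paths around a face picks up an additional minus sign.\<close>

lemma edge_sign_anticommute:
  assumes R: "cring R" and fin: "finite S" and u: "u \<notin> S" and v: "v \<notin> S" and uv: "u \<noteq> v"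
  shows "edge_sign R (insert u S) v \<otimes>\<^bsub>R\<^esub> edge_sign R S u =
    \<ominus>\<^bsub>R\<^esub> (edge_sign R (insert v S) u \<otimes>\<^bsub>R\<^esub> edge_sign R S v)"
proof -
  interpret cring R by (rule R)
  let ?n = "\<lambda>w. card {x \<in> S. x < w}" and ?m = "\<ominus>\<^bsub>R\<^esub> \<one>\<^bsub>R\<^esub>"
  have c: "card {x \<in> insert a S. x < b} = (if a < b then Suc (?n b) else ?n b)" if "a \<notin> S" for a b
  proof -
    have "{x \<in> insert a S. x < b} = (if a < b then insert a {x \<in> S. x < b} else {x \<in> S. x < b})" by auto
    then show ?thesis using fin that by simp
  qed
  have key: "(?m [^]\<^bsub>R\<^esub> Suc i) \<otimes>\<^bsub>R\<^esub> (?m [^]\<^bsub>R\<^esub> j) = \<ominus>\<^bsub>R\<^esub> (?m [^]\<^bsub>R\<^esub> i \<otimes>\<^bsub>R\<^esub> ?m [^]\<^bsub>R\<^esub> j)" for i j :: nat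
    by (simp add: l_minus r_minus)
  show ?thesis
  proof (cases "u < v")
    case True
    then show ?thesis
      unfolding edge_sign_def c[OF u] c[OF v] using key[of "?n v" "?n u"]
      by (simp add: m_comm del: nat_pow_Suc)
  next
    case False
    then show ?thesis
      unfolding edge_sign_def c[OF u] c[OF v] using key[of "?n u" "?n v"] uv
      by (simp add: m_comm del: nat_pow_Suc)
  qed
qed

text \<open>All labellings of one intermediate state carry the same sign. It factors out and leaves
  a cardinality, which no longer refers to the ring.\<close>

lemma sum_edge_products:
  assumes R: "cring R" and D: "link_diagram D" and S: "S \<subseteq> crossings D"
    and u: "u \<in> crossings D" "u \<notin> S" and v: "v \<in> crossings D" "v \<notin> insert u S"
  shows "(\<Oplus>\<^bsub>R\<^esub>z\<in>{insert u S} \<times> (circles D (insert u S) \<rightarrow>\<^sub>E UNIV).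
      diff_coeff R D z (insert v (insert u S), \<epsilon>') \<otimes>\<^bsub>R\<^esub> diff_coeff R D (S, \<epsilon>) z) =
    [card {g \<in> circles D (insert u S) \<rightarrow>\<^sub>E UNIV. saddle (circles D S) (circles D (insert u S)) \<epsilon> g \<and>
       saddle (circles D (insert u S)) (circles D (insert v (insert u S))) g \<epsilon>'}] \<cdot>\<^bsub>R\<^esub>
      (edge_sign R (insert u S) v \<otimes>\<^bsub>R\<^esub> edge_sign R S u)"
proof -
  interpret cring R by (rule R)
  let ?L = "circles D (insert u S) \<rightarrow>\<^sub>E (UNIV :: gen set)"
  let ?P = "\<lambda>g. saddle (circles D S) (circles D (insert u S)) \<epsilon> g \<and>
       saddle (circles D (insert u S)) (circles D (insert v (insert u S))) g \<epsilon>'"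
  let ?s = "edge_sign R (insert u S) v \<otimes>\<^bsub>R\<^esub> edge_sign R S u"
  have s: "?s \<in> carrier R" "edge_sign R S u \<in> carrier R" "edge_sign R (insert u S) v \<in> carrier R"
    by (simp_all add: edge_sign_def)
  have finL: "finite ?L" using finite_circles[OF D] finite_UNIV_gen by (intro finite_PiE) auto
  have "(\<Oplus>\<^bsub>R\<^esub>z\<in>{insert u S} \<times> ?L. diff_coeff R D z (insert v (insert u S), \<epsilon>') \<otimes>\<^bsub>R\<^esub> diff_coeff R D (S, \<epsilon>) z)
      = (\<Oplus>\<^bsub>R\<^esub>z\<in>(\<lambda>g. (insert u S, g)) ` ?L.
          diff_coeff R D z (insert v (insert u S), \<epsilon>') \<otimes>\<^bsub>R\<^esub> diff_coeff R D (S, \<epsilon>) z)"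
    by (rule arg_cong[where f = "finsum R _"]) auto
  also have "\<dots> = (\<Oplus>\<^bsub>R\<^esub>g\<in>?L. diff_coeff R D (insert u S, g) (insert v (insert u S), \<epsilon>') \<otimes>\<^bsub>R\<^esub>
          diff_coeff R D (S, \<epsilon>) (insert u S, g))"
    by (rule finsum_reindex) (auto simp: inj_on_def diff_coeff_closed[OF R D])
  also have "\<dots> = (\<Oplus>\<^bsub>R\<^esub>g\<in>?L. if ?P g then ?s else \<zero>\<^bsub>R\<^esub>)"
    by (rule finsum_cong') (auto simp: s diff_coeff_insert[OF R D u] diff_coeff_insert[OF R D v])
  also have "\<dots> = (\<Oplus>\<^bsub>R\<^esub>g\<in>{g \<in> ?L. ?P g}. ?s)"
    using s finL by (intro add.finprod_mono_neutral_cong_right) auto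
  also have "\<dots> = [card {g \<in> ?L. ?P g}] \<cdot>\<^bsub>R\<^esub> ?s"
    using add.finprod_const[OF s(1), of "{g \<in> ?L. ?P g}"] by simp
  finally show ?thesis .
qed

text \<open>Two states that differ by two added crossings have exactly two states between them. The
  two contributions have equal cardinalities and opposite signs; for any other pair of states every
  term vanishes.\<close>

lemma diff_coeff_square:
  assumes R: "cring R" and D: "link_diagram D" and x: "x \<in> kgens D" and y: "y \<in> kgens D"
  shows "(\<Oplus>\<^bsub>R\<^esub>z\<in>kgens D. diff_coeff R D z y \<otimes>\<^bsub>R\<^esub> diff_coeff R D x z) = \<zero>\<^bsub>R\<^esub>"
proof -
  interpret cring R by (rule R)
  obtain S \<epsilon> T \<epsilon>' where xy: "x = (S, \<epsilon>)" "y = (T, \<epsilon>')" by fastforce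
  have S: "S \<subseteq> crossings D" using x by (simp add: xy kgens_iff)
  have finS: "finite S" using finite_subset[OF S finite_crossings[OF D]] .
  let ?f = "\<lambda>z. diff_coeff R D z y \<otimes>\<^bsub>R\<^esub> diff_coeff R D x z"
  have cl: "?f z \<in> carrier R" for z by (simp add: diff_coeff_closed[OF R D])
  have path: "\<exists>u v. u \<in> crossings D \<and> u \<notin> S \<and> v \<in> crossings D \<and> v \<notin> insert u S \<and>
      fst z = insert u S \<and> T = insert v (insert u S)" if z: "?f z \<noteq> \<zero>\<^bsub>R\<^esub>" for z
  proof -
    obtain W g where W: "z = (W, g)" by fastforce
    have nz: "diff_coeff R D x z \<noteq> \<zero>\<^bsub>R\<^esub>" "diff_coeff R D z y \<noteq> \<zero>\<^bsub>R\<^esub>"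
      using z l_null[OF diff_coeff_closed[OF R D, of x z]] r_null[OF diff_coeff_closed[OF R D, of z y]]
      by metis+
    obtain u where u: "u \<in> crossings D" "u \<notin> S" "W = insert u S"
      using nz(1) unfolding xy W by (rule diff_coeff_nonzeroE[OF R D])
    obtain v where "v \<in> crossings D" "v \<notin> W" "T = insert v W"
      using nz(2) unfolding xy W by (rule diff_coeff_nonzeroE[OF R D])
    then show ?thesis using u W by auto
  qed
  show ?thesis
  proof (cases "\<exists>u v. u \<in> crossings D \<and> u \<notin> S \<and> v \<in> crossings D \<and> v \<notin> insert u S \<and> T = insert v (insert u S)")
    case False
    then have "?f z = \<zero>\<^bsub>R\<^esub>" for z using path[of z] by blast
    then show ?thesis by (simp add: finsum_zero)
  next
    case True
    then obtain u v where u: "u \<in> crossings D" "u \<notin> S" and v: "v \<in> crossings D" "v \<notin> S"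
      and uv: "u \<noteq> v" and T: "T = insert v (insert u S)" by blast
    have uv': "v \<notin> insert u S" "u \<notin> insert v S" and T': "T = insert u (insert v S)"
      using u v uv T by auto
    let ?Z = "\<lambda>w. {insert w S} \<times> (circles D (insert w S) \<rightarrow>\<^sub>E (UNIV :: gen set))"
    let ?s = "edge_sign R (insert u S) v \<otimes>\<^bsub>R\<^esub> edge_sign R S u"
    let ?s' = "edge_sign R (insert v S) u \<otimes>\<^bsub>R\<^esub> edge_sign R S v"
    have s: "?s' \<in> carrier R" by (simp add: edge_sign_def)
    have sub: "?Z u \<union> ?Z v \<subseteq> kgens D" using S u v by (auto simp: kgens_def)
    have fin: "finite (?Z w)" for w
      using finite_circles[OF D] finite_UNIV_gen by (intro finite_cartesian_product finite_PiE) auto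
    have "insert u S \<noteq> insert v S" using u v uv by auto
    then have disj: "?Z u \<inter> ?Z v = {}" by auto
    have zero: "?f z = \<zero>\<^bsub>R\<^esub>" if z: "z \<in> kgens D - (?Z u \<union> ?Z v)" for z
    proof (rule ccontr)
      assume "?f z \<noteq> \<zero>\<^bsub>R\<^esub>"
      then obtain u' v' where *: "u' \<notin> S" "fst z = insert u' S" "T = insert v' (insert u' S)"
        using path[of z] by blast
      then have "u' = u \<or> u' = v" unfolding T using u v by auto
      then have "z \<in> ?Z u \<union> ?Z v" using z *(2) by (cases z) (auto simp: kgens_def)
      then show False using z by blast
    qed
    have "(\<Oplus>\<^bsub>R\<^esub>z\<in>kgens D. ?f z) = (\<Oplus>\<^bsub>R\<^esub>z\<in>?Z u \<union> ?Z v. ?f z)"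
      using finite_kgens[OF D] sub zero cl by (intro add.finprod_mono_neutral_cong_right) auto
    also have "\<dots> = (\<Oplus>\<^bsub>R\<^esub>z\<in>?Z u. ?f z) \<oplus>\<^bsub>R\<^esub> (\<Oplus>\<^bsub>R\<^esub>z\<in>?Z v. ?f z)"
      using fin disj cl by (intro finsum_Un_disjoint) auto
    also have "(\<Oplus>\<^bsub>R\<^esub>z\<in>?Z u. ?f z) = \<ominus>\<^bsub>R\<^esub> (\<Oplus>\<^bsub>R\<^esub>z\<in>?Z v. ?f z)"
    proof -
      define k where "k = card {g \<in> circles D (insert u S) \<rightarrow>\<^sub>E UNIV.
          saddle (circles D S) (circles D (insert u S)) \<epsilon> g \<and>
          saddle (circles D (insert u S)) (circles D (insert v (insert u S))) g \<epsilon>'}"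
      have k: "k = card {g \<in> circles D (insert v S) \<rightarrow>\<^sub>E UNIV.
          saddle (circles D S) (circles D (insert v S)) \<epsilon> g \<and>
          saddle (circles D (insert v S)) (circles D (insert u (insert v S))) g \<epsilon>'}"
        unfolding k_def insert_commute[of v u] by (rule saddle_compositions_commute[OF D u v uv])
      have 1: "(\<Oplus>\<^bsub>R\<^esub>z\<in>?Z u. ?f z) = [k] \<cdot>\<^bsub>R\<^esub> ?s"
        unfolding xy T k_def by (rule sum_edge_products[OF R D S u v(1) uv'(1)])
      have 2: "(\<Oplus>\<^bsub>R\<^esub>z\<in>?Z v. ?f z) = [k] \<cdot>\<^bsub>R\<^esub> ?s'"
        unfolding xy T' k by (rule sum_edge_products[OF R D S v u(1) uv'(2)])
      have "?s = \<ominus>\<^bsub>R\<^esub> ?s'" by (rule edge_sign_anticommute[OF R finS u(2) v(2) uv])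
      then show ?thesis unfolding 1 2 using s by (simp add: add.nat_pow_inv)
    qed
    finally show ?thesis using cl by (simp add: l_neg)
  qed
qed

section \<open>The differential as a linear map\<close>

lemma kdiff_closed:
  assumes "cring R" "link_diagram D" "\<And>x. c x \<in> carrier R"
  shows "kdiff R D c y \<in> carrier R"
proof -
  interpret cring R by (rule assms(1))
  show ?thesis using assms(3) diff_coeff_closed[OF assms(1,2)] by (auto simp: kdiff_def intro!: finsum_closed)
qed

lemma finsum_commute:
  assumes R: "cring R" and fin: "finite A" "finite B"
    and f: "\<And>x y. x \<in> A \<Longrightarrow> y \<in> B \<Longrightarrow> f x y \<in> carrier R"
  shows "(\<Oplus>\<^bsub>R\<^esub>x\<in>A. \<Oplus>\<^bsub>R\<^esub>y\<in>B. f x y) = (\<Oplus>\<^bsub>R\<^esub>y\<in>B. \<Oplus>\<^bsub>R\<^esub>x\<in>A. f x y)"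
proof -
  interpret cring R by (rule R)
  show ?thesis
    using fin(1) f
  proof (induction A)
    case empty
    then show ?case by (simp add: finsum_zero)
  next
    case (insert a A)
    have "(\<Oplus>\<^bsub>R\<^esub>x\<in>insert a A. \<Oplus>\<^bsub>R\<^esub>y\<in>B. f x y) = (\<Oplus>\<^bsub>R\<^esub>y\<in>B. f a y) \<oplus>\<^bsub>R\<^esub> (\<Oplus>\<^bsub>R\<^esub>y\<in>B. \<Oplus>\<^bsub>R\<^esub>x\<in>A. f x y)"
      using insert by (simp add: Pi_def)
    also have "\<dots> = (\<Oplus>\<^bsub>R\<^esub>y\<in>B. f a y \<oplus>\<^bsub>R\<^esub> (\<Oplus>\<^bsub>R\<^esub>x\<in>A. f x y))"
      using insert by (intro finsum_addf[symmetric]) (auto intro!: finsum_closed)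
    also have "\<dots> = (\<Oplus>\<^bsub>R\<^esub>y\<in>B. \<Oplus>\<^bsub>R\<^esub>x\<in>insert a A. f x y)"
      using insert by (intro finsum_cong') (auto intro!: finsum_closed simp: Pi_def)
    finally show ?case .
  qed
qed

lemma kdiff_kdiff:
  assumes R: "cring R" and D: "link_diagram D" and c: "\<And>x. c x \<in> carrier R"
  shows "kdiff R D (kdiff R D c) = (\<lambda>_. \<zero>\<^bsub>R\<^esub>)"
proof
  interpret cring R by (rule R)
  note dc = diff_coeff_closed[OF R D] and fin = finite_kgens[OF D]
  let ?K = "kgens D"
  fix y
  show "kdiff R D (kdiff R D c) y = \<zero>\<^bsub>R\<^esub>"
  proof (cases "y \<in> ?K")
    case True
    have "kdiff R D (kdiff R D c) y =
        (\<Oplus>\<^bsub>R\<^esub>z\<in>?K. diff_coeff R D z y \<otimes>\<^bsub>R\<^esub> (\<Oplus>\<^bsub>R\<^esub>x\<in>?K. diff_coeff R D x z \<otimes>\<^bsub>R\<^esub> c x))"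
    proof -
      have "kdiff R D (kdiff R D c) y = (\<Oplus>\<^bsub>R\<^esub>z\<in>?K. diff_coeff R D z y \<otimes>\<^bsub>R\<^esub> kdiff R D c z)"
        by (subst kdiff_def) (simp add: True)
      also have "\<dots> = (\<Oplus>\<^bsub>R\<^esub>z\<in>?K. diff_coeff R D z y \<otimes>\<^bsub>R\<^esub> (\<Oplus>\<^bsub>R\<^esub>x\<in>?K. diff_coeff R D x z \<otimes>\<^bsub>R\<^esub> c x))"
        by (rule finsum_cong') (auto simp: kdiff_def dc c intro!: finsum_closed)
      finally show ?thesis .
    qed
    also have "\<dots> = (\<Oplus>\<^bsub>R\<^esub>z\<in>?K. \<Oplus>\<^bsub>R\<^esub>x\<in>?K. diff_coeff R D z y \<otimes>\<^bsub>R\<^esub> diff_coeff R D x z \<otimes>\<^bsub>R\<^esub> c x)"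
      by (rule finsum_cong') (auto simp: dc c fin finsum_rdistr Pi_def m_assoc intro!: finsum_closed finsum_cong')
    also have "\<dots> = (\<Oplus>\<^bsub>R\<^esub>x\<in>?K. \<Oplus>\<^bsub>R\<^esub>z\<in>?K. diff_coeff R D z y \<otimes>\<^bsub>R\<^esub> diff_coeff R D x z \<otimes>\<^bsub>R\<^esub> c x)"
      by (rule finsum_commute[OF R fin fin]) (simp add: dc c)
    also have "\<dots> = (\<Oplus>\<^bsub>R\<^esub>x\<in>?K. (\<Oplus>\<^bsub>R\<^esub>z\<in>?K. diff_coeff R D z y \<otimes>\<^bsub>R\<^esub> diff_coeff R D x z) \<otimes>\<^bsub>R\<^esub> c x)"
      by (rule finsum_cong') (auto simp: dc c fin finsum_ldistr Pi_def intro!: finsum_closed)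
    also have "\<dots> = (\<Oplus>\<^bsub>R\<^esub>x\<in>?K. \<zero>\<^bsub>R\<^esub>)"
      by (rule finsum_cong') (auto simp: diff_coeff_square[OF R D _ True] c)
    also have "\<dots> = \<zero>\<^bsub>R\<^esub>" by (rule finsum_zero)
    finally show ?thesis .
  qed (simp add: kdiff_def)
qed

lemma kdiff_add:
  assumes R: "cring R" and D: "link_diagram D" and c: "\<And>x. c x \<in> carrier R" "\<And>x. c' x \<in> carrier R"
  shows "kdiff R D (\<lambda>x. c x \<oplus>\<^bsub>R\<^esub> c' x) = (\<lambda>y. kdiff R D c y \<oplus>\<^bsub>R\<^esub> kdiff R D c' y)"
proof
  interpret cring R by (rule R)
  note dc = diff_coeff_closed[OF R D]
  fix y
  show "kdiff R D (\<lambda>x. c x \<oplus>\<^bsub>R\<^esub> c' x) y = kdiff R D c y \<oplus>\<^bsub>R\<^esub> kdiff R D c' y"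
  proof (cases "y \<in> kgens D")
    case True
    have "(\<Oplus>\<^bsub>R\<^esub>x\<in>kgens D. diff_coeff R D x y \<otimes>\<^bsub>R\<^esub> (c x \<oplus>\<^bsub>R\<^esub> c' x)) =
        (\<Oplus>\<^bsub>R\<^esub>x\<in>kgens D. diff_coeff R D x y \<otimes>\<^bsub>R\<^esub> c x \<oplus>\<^bsub>R\<^esub> diff_coeff R D x y \<otimes>\<^bsub>R\<^esub> c' x)"
      by (rule finsum_cong') (simp_all add: c dc r_distr)
    also have "\<dots> = (\<Oplus>\<^bsub>R\<^esub>x\<in>kgens D. diff_coeff R D x y \<otimes>\<^bsub>R\<^esub> c x) \<oplus>\<^bsub>R\<^esub>
        (\<Oplus>\<^bsub>R\<^esub>x\<in>kgens D. diff_coeff R D x y \<otimes>\<^bsub>R\<^esub> c' x)"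
      by (rule finsum_addf) (simp_all add: c dc)
    finally show ?thesis using True by (simp add: kdiff_def)
  qed (simp add: kdiff_def)
qed

lemma kdiff_smult:
  assumes R: "cring R" and D: "link_diagram D" and c: "\<And>x. c x \<in> carrier R" and r: "r \<in> carrier R"
  shows "kdiff R D (\<lambda>x. r \<otimes>\<^bsub>R\<^esub> c x) = (\<lambda>y. r \<otimes>\<^bsub>R\<^esub> kdiff R D c y)"
proof
  interpret cring R by (rule R)
  note dc = diff_coeff_closed[OF R D]
  fix y
  show "kdiff R D (\<lambda>x. r \<otimes>\<^bsub>R\<^esub> c x) y = r \<otimes>\<^bsub>R\<^esub> kdiff R D c y"
  proof (cases "y \<in> kgens D")
    case True
    have "(\<Oplus>\<^bsub>R\<^esub>x\<in>kgens D. diff_coeff R D x y \<otimes>\<^bsub>R\<^esub> (r \<otimes>\<^bsub>R\<^esub> c x)) =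
        (\<Oplus>\<^bsub>R\<^esub>x\<in>kgens D. r \<otimes>\<^bsub>R\<^esub> (diff_coeff R D x y \<otimes>\<^bsub>R\<^esub> c x))"
      by (rule finsum_cong') (simp_all add: c dc r m_lcomm)
    also have "\<dots> = r \<otimes>\<^bsub>R\<^esub> (\<Oplus>\<^bsub>R\<^esub>x\<in>kgens D. diff_coeff R D x y \<otimes>\<^bsub>R\<^esub> c x)"
      by (rule finsum_rdistr[symmetric]) (simp_all add: c dc r finite_kgens[OF D])
    finally show ?thesis using True by (simp add: kdiff_def)
  qed (simp add: kdiff_def r)
qed

lemma module_free_module:
  fixes R :: "('r, 'b) ring_scheme" and B :: "'x set"
  assumes R: "cring R"
  shows "module R (free_module R B)"
proof -
  interpret cring R by (rule R)
  let ?F = "free_module R B"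
  have F: "carrier ?F = {c. (\<forall>x\<in>B. c x \<in> carrier R) \<and> (\<forall>x. x \<notin> B \<longrightarrow> c x = \<zero>\<^bsub>R\<^esub>)}"
    "\<zero>\<^bsub>?F\<^esub> = (\<lambda>_. \<zero>\<^bsub>R\<^esub>)" "\<And>c c'. c \<oplus>\<^bsub>?F\<^esub> c' = (\<lambda>x. c x \<oplus>\<^bsub>R\<^esub> c' x)"
    "\<And>r c. r \<odot>\<^bsub>?F\<^esub> c = (\<lambda>x. r \<otimes>\<^bsub>R\<^esub> c x)"
    by (simp_all add: free_module_def)
  have cl: "c x \<in> carrier R" if "c \<in> carrier ?F" for c x using that by (cases "x \<in> B") (auto simp: F)
  show ?thesis
  proof (rule moduleI[OF R])
    show "abelian_group ?F"
    proof (rule abelian_groupI)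
      show "\<zero>\<^bsub>?F\<^esub> \<in> carrier ?F" by (simp add: F)
    next
      fix c assume c: "c \<in> carrier ?F"
      show "\<zero>\<^bsub>?F\<^esub> \<oplus>\<^bsub>?F\<^esub> c = c" unfolding F(2,3) by (rule ext) (simp add: cl[OF c])
      have "(\<lambda>x. \<ominus>\<^bsub>R\<^esub> c x) \<in> carrier ?F" using c by (simp add: F)
      moreover have "(\<lambda>x. \<ominus>\<^bsub>R\<^esub> c x) \<oplus>\<^bsub>?F\<^esub> c = \<zero>\<^bsub>?F\<^esub>"
        unfolding F(2,3) by (rule ext) (simp add: cl[OF c] l_neg)
      ultimately show "\<exists>c'\<in>carrier ?F. c' \<oplus>\<^bsub>?F\<^esub> c = \<zero>\<^bsub>?F\<^esub>" by blast
      fix c' assume c': "c' \<in> carrier ?F"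
      show "c \<oplus>\<^bsub>?F\<^esub> c' \<in> carrier ?F" using c c' by (simp add: F)
      show "c \<oplus>\<^bsub>?F\<^esub> c' = c' \<oplus>\<^bsub>?F\<^esub> c"
        unfolding F(3) by (rule ext) (rule a_comm[OF cl[OF c] cl[OF c']])
      fix c'' assume c'': "c'' \<in> carrier ?F"
      show "(c \<oplus>\<^bsub>?F\<^esub> c') \<oplus>\<^bsub>?F\<^esub> c'' = c \<oplus>\<^bsub>?F\<^esub> (c' \<oplus>\<^bsub>?F\<^esub> c'')"
        unfolding F(3) by (rule ext) (rule a_assoc[OF cl[OF c] cl[OF c'] cl[OF c'']])
    qed
    fix c assume c: "c \<in> carrier ?F"
    show "\<one>\<^bsub>R\<^esub> \<odot>\<^bsub>?F\<^esub> c = c" unfolding F(4) by (rule ext) (simp add: cl[OF c])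
    fix a assume a: "a \<in> carrier R"
    show "a \<odot>\<^bsub>?F\<^esub> c \<in> carrier ?F" using c a by (simp add: F)
    show "a \<odot>\<^bsub>?F\<^esub> (c \<oplus>\<^bsub>?F\<^esub> c') = a \<odot>\<^bsub>?F\<^esub> c \<oplus>\<^bsub>?F\<^esub> a \<odot>\<^bsub>?F\<^esub> c'" if "c' \<in> carrier ?F" for c'
      unfolding F(3,4) by (rule ext) (rule r_distr[OF cl[OF c] cl[OF that] a])
    fix b assume b: "b \<in> carrier R"
    show "(a \<oplus>\<^bsub>R\<^esub> b) \<odot>\<^bsub>?F\<^esub> c = a \<odot>\<^bsub>?F\<^esub> c \<oplus>\<^bsub>?F\<^esub> b \<odot>\<^bsub>?F\<^esub> c"
      unfolding F(3,4) by (rule ext) (rule l_distr[OF a b cl[OF c]])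
    show "(a \<otimes>\<^bsub>R\<^esub> b) \<odot>\<^bsub>?F\<^esub> c = a \<odot>\<^bsub>?F\<^esub> (b \<odot>\<^bsub>?F\<^esub> c)"
      unfolding F(4) by (rule ext) (rule m_assoc[OF a b cl[OF c]])
  qed
qed

section \<open>Quotient modules\<close>

lemma submoduleD:
  assumes "module R M" "submodule N R M"
  shows "N \<subseteq> carrier M" "\<zero>\<^bsub>M\<^esub> \<in> N"
    "\<And>x y. x \<in> N \<Longrightarrow> y \<in> N \<Longrightarrow> x \<oplus>\<^bsub>M\<^esub> y \<in> N"
    "\<And>x. x \<in> N \<Longrightarrow> \<ominus>\<^bsub>M\<^esub> x \<in> N"
    "\<And>x y. x \<in> N \<Longrightarrow> y \<in> N \<Longrightarrow> x \<ominus>\<^bsub>M\<^esub> y \<in> N"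
    "\<And>r x. r \<in> carrier R \<Longrightarrow> x \<in> N \<Longrightarrow> r \<odot>\<^bsub>M\<^esub> x \<in> N"
proof -
  note E = module.submoduleE[OF assms]
  show "N \<subseteq> carrier M" "\<And>x y. x \<in> N \<Longrightarrow> y \<in> N \<Longrightarrow> x \<oplus>\<^bsub>M\<^esub> y \<in> N"
    "\<And>x. x \<in> N \<Longrightarrow> \<ominus>\<^bsub>M\<^esub> x \<in> N" "\<And>r x. r \<in> carrier R \<Longrightarrow> x \<in> N \<Longrightarrow> r \<odot>\<^bsub>M\<^esub> x \<in> N"
    using E by blast+
  show "\<zero>\<^bsub>M\<^esub> \<in> N" using subgroup.one_closed[OF submodule.axioms(1)[OF assms(2)]] by simp
  show "\<And>x y. x \<in> N \<Longrightarrow> y \<in> N \<Longrightarrow> x \<ominus>\<^bsub>M\<^esub> y \<in> N" using E by (simp add: a_minus_def)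
qed

text \<open>Closure under negation comes from scalar multiplication by minus one.\<close>

lemma submodule_closedI:
  assumes M: "module R M" and sub: "N \<subseteq> carrier M" and z: "\<zero>\<^bsub>M\<^esub> \<in> N"
    and add: "\<And>x y. x \<in> N \<Longrightarrow> y \<in> N \<Longrightarrow> x \<oplus>\<^bsub>M\<^esub> y \<in> N"
    and sm: "\<And>r x. r \<in> carrier R \<Longrightarrow> x \<in> N \<Longrightarrow> r \<odot>\<^bsub>M\<^esub> x \<in> N"
  shows "submodule N R M"
proof (rule module.submoduleI[OF M sub z _ add sm])
  interpret module R M by (rule M)
  fix x assume x: "x \<in> N"
  then have "(\<ominus>\<^bsub>R\<^esub> \<one>\<^bsub>R\<^esub>) \<odot>\<^bsub>M\<^esub> x \<in> N" by (intro sm) auto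
  then show "\<ominus>\<^bsub>M\<^esub> x \<in> N" using x sub by (simp add: smult_l_minus subset_iff)
qed

lemma module_carrier_update:
  "module R M \<Longrightarrow> submodule N R M \<Longrightarrow> module R (M\<lparr>carrier := N\<rparr>)"
  by (rule submodule.submodule_is_module)

lemma submodule_carrier_update:
  assumes "module R M" "submodule Z R M" "submodule N R M" "N \<subseteq> Z"
  shows "submodule N R (M\<lparr>carrier := Z\<rparr>)"
  by (rule module.module_incl_imp_submodule[OF module_carrier_update[OF assms(1,2)]])
    (use assms module_carrier_update[OF assms(1,3)] in simp_all)

lemma a_r_coset_carrier_update [simp]: "a_r_coset (M\<lparr>carrier := Z\<rparr>) = a_r_coset M"
  by (intro ext) (simp add: a_r_coset_def')

lemma module_homD:
  assumes "h \<in> module_hom R M P"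
  shows "\<And>x. x \<in> carrier M \<Longrightarrow> h x \<in> carrier P"
    "\<And>x y. x \<in> carrier M \<Longrightarrow> y \<in> carrier M \<Longrightarrow> h (x \<oplus>\<^bsub>M\<^esub> y) = h x \<oplus>\<^bsub>P\<^esub> h y"
    "\<And>r x. r \<in> carrier R \<Longrightarrow> x \<in> carrier M \<Longrightarrow> h (r \<odot>\<^bsub>M\<^esub> x) = r \<odot>\<^bsub>P\<^esub> h x"
  using assms by (auto simp: module_hom_def)

lemma module_homI:
  assumes "\<And>x. x \<in> carrier M \<Longrightarrow> h x \<in> carrier P"
    "\<And>x y. x \<in> carrier M \<Longrightarrow> y \<in> carrier M \<Longrightarrow> h (x \<oplus>\<^bsub>M\<^esub> y) = h x \<oplus>\<^bsub>P\<^esub> h y"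
    "\<And>r x. r \<in> carrier R \<Longrightarrow> x \<in> carrier M \<Longrightarrow> h (r \<odot>\<^bsub>M\<^esub> x) = r \<odot>\<^bsub>P\<^esub> h x"
  shows "h \<in> module_hom R M P"
  using assms by (auto simp: module_hom_def)

lemma module_minus_add:
  assumes "module R M" "x \<in> carrier M" "y \<in> carrier M"
  shows "(x \<ominus>\<^bsub>M\<^esub> y) \<oplus>\<^bsub>M\<^esub> y = x" "(x \<oplus>\<^bsub>M\<^esub> y) \<ominus>\<^bsub>M\<^esub> y = x" "x \<ominus>\<^bsub>M\<^esub> y \<in> carrier M"
proof -
  interpret module R M by (rule assms(1))
  show "(x \<ominus>\<^bsub>M\<^esub> y) \<oplus>\<^bsub>M\<^esub> y = x" "(x \<oplus>\<^bsub>M\<^esub> y) \<ominus>\<^bsub>M\<^esub> y = x" "x \<ominus>\<^bsub>M\<^esub> y \<in> carrier M"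
    using assms(2,3) by (simp_all add: M.minus_eq M.a_assoc M.l_neg M.r_neg)
qed

lemma module_hom_zero_minus:
  assumes M: "module R M" and P: "module R P" and h: "h \<in> module_hom R M P"
  shows "h \<zero>\<^bsub>M\<^esub> = \<zero>\<^bsub>P\<^esub>"
    and "x \<in> carrier M \<Longrightarrow> y \<in> carrier M \<Longrightarrow> h (x \<ominus>\<^bsub>M\<^esub> y) = h x \<ominus>\<^bsub>P\<^esub> h y"
proof -
  interpret M: module R M by (rule M)
  interpret P: module R P by (rule P)
  note h = module_homD[OF h]
  have "h \<zero>\<^bsub>M\<^esub> \<oplus>\<^bsub>P\<^esub> h \<zero>\<^bsub>M\<^esub> = h \<zero>\<^bsub>M\<^esub>" using h(2)[of "\<zero>\<^bsub>M\<^esub>" "\<zero>\<^bsub>M\<^esub>"] by simp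
  then show "h \<zero>\<^bsub>M\<^esub> = \<zero>\<^bsub>P\<^esub>" using h(1)[of "\<zero>\<^bsub>M\<^esub>"] P.add.l_cancel_one' by simp
  assume xy: "x \<in> carrier M" "y \<in> carrier M"
  have "h (x \<ominus>\<^bsub>M\<^esub> y) \<oplus>\<^bsub>P\<^esub> h y = h x"
    using h(2)[of "x \<ominus>\<^bsub>M\<^esub> y" y] module_minus_add[OF M xy] xy by simp
  then show "h (x \<ominus>\<^bsub>M\<^esub> y) = h x \<ominus>\<^bsub>P\<^esub> h y"
    using module_minus_add(2)[OF P, of "h (x \<ominus>\<^bsub>M\<^esub> y)" "h y"] h(1) xy module_minus_add(3)[OF M xy] by simp
qed

lemma submodule_image:
  assumes M: "module R M" and P: "module R P" and h: "h \<in> module_hom R M P" and N: "submodule N R M"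
  shows "submodule (h ` N) R P"
proof (rule submodule_closedI[OF P])
  note h' = module_homD[OF h] and N' = submoduleD[OF M N]
  show "h ` N \<subseteq> carrier P" using h'(1) N'(1) by auto
  show "\<zero>\<^bsub>P\<^esub> \<in> h ` N" using module_hom_zero_minus(1)[OF M P h] N'(2) by (metis image_eqI)
  show "x \<oplus>\<^bsub>P\<^esub> y \<in> h ` N" if xy: "x \<in> h ` N" "y \<in> h ` N" for x y
  proof -
    obtain a b where ab: "a \<in> N" "b \<in> N" "x = h a" "y = h b" using xy by auto
    then have "x \<oplus>\<^bsub>P\<^esub> y = h (a \<oplus>\<^bsub>M\<^esub> b)" using h'(2)[OF subsetD[OF N'(1) ab(1)] subsetD[OF N'(1) ab(2)]] by simp
    then show ?thesis using N'(3)[OF ab(1,2)] by simp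
  qed
  show "r \<odot>\<^bsub>P\<^esub> x \<in> h ` N" if rx: "r \<in> carrier R" "x \<in> h ` N" for r x
  proof -
    obtain a where a: "a \<in> N" "x = h a" using rx by auto
    then have "r \<odot>\<^bsub>P\<^esub> x = h (r \<odot>\<^bsub>M\<^esub> a)" using h'(3)[OF rx(1), of a] N'(1) by auto
    then show ?thesis using N'(6)[OF rx(1) a(1)] by simp
  qed
qed

lemma submodule_preimage:
  assumes M: "module R M" and P: "module R P" and h: "h \<in> module_hom R M P"
    and A: "submodule A R M" and B: "submodule B R P"
  shows "submodule {x \<in> A. h x \<in> B} R M"
proof (rule submodule_closedI[OF M])
  note h' = module_homD[OF h] and A' = submoduleD[OF M A] and B' = submoduleD[OF P B]
  have AM: "x \<in> carrier M" if "x \<in> A" for x using that A'(1) by blast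
  show "{x \<in> A. h x \<in> B} \<subseteq> carrier M" using AM by blast
  show "\<zero>\<^bsub>M\<^esub> \<in> {x \<in> A. h x \<in> B}" using module_hom_zero_minus(1)[OF M P h] A'(2) B'(2) by simp
  show "x \<oplus>\<^bsub>M\<^esub> y \<in> {x \<in> A. h x \<in> B}" if "x \<in> {x \<in> A. h x \<in> B}" "y \<in> {x \<in> A. h x \<in> B}" for x y
    using that A'(3)[of x y] B'(3)[of "h x" "h y"] h'(2)[of x y] AM by simp
  show "r \<odot>\<^bsub>M\<^esub> x \<in> {x \<in> A. h x \<in> B}" if "r \<in> carrier R" "x \<in> {x \<in> A. h x \<in> B}" for r x
    using that A'(6)[of r x] B'(6)[of r "h x"] h'(3)[of r x] AM by simp
qed

lemma submodule_sum:
  assumes M: "module R M" and A: "submodule A R M" and B: "submodule B R M"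
  shows "submodule {x \<oplus>\<^bsub>M\<^esub> y |x y. x \<in> A \<and> y \<in> B} R M" (is "submodule ?S R M")
proof (rule submodule_closedI[OF M])
  interpret module R M by (rule M)
  note A' = submoduleD[OF M A] and B' = submoduleD[OF M B]
  have AB: "x \<in> A \<Longrightarrow> x \<in> carrier M" "x \<in> B \<Longrightarrow> x \<in> carrier M" for x using A'(1) B'(1) by blast+
  show "?S \<subseteq> carrier M" using AB by blast
  have "\<zero>\<^bsub>M\<^esub> = \<zero>\<^bsub>M\<^esub> \<oplus>\<^bsub>M\<^esub> \<zero>\<^bsub>M\<^esub>" by simp
  then show "\<zero>\<^bsub>M\<^esub> \<in> ?S" using A'(2) B'(2) by blast
  show "p \<oplus>\<^bsub>M\<^esub> q \<in> ?S" if pq: "p \<in> ?S" "q \<in> ?S" for p q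
  proof -
    obtain x y x' y' where *: "p = x \<oplus>\<^bsub>M\<^esub> y" "x \<in> A" "y \<in> B" "q = x' \<oplus>\<^bsub>M\<^esub> y'" "x' \<in> A" "y' \<in> B"
      using pq by blast
    then have "p \<oplus>\<^bsub>M\<^esub> q = (x \<oplus>\<^bsub>M\<^esub> x') \<oplus>\<^bsub>M\<^esub> (y \<oplus>\<^bsub>M\<^esub> y')" by (simp add: AB M.a_ac)
    then show ?thesis using A'(3)[OF *(2,5)] B'(3)[OF *(3,6)] by blast
  qed
  show "r \<odot>\<^bsub>M\<^esub> p \<in> ?S" if rp: "r \<in> carrier R" "p \<in> ?S" for r p
  proof -
    obtain x y where *: "p = x \<oplus>\<^bsub>M\<^esub> y" "x \<in> A" "y \<in> B" using rp by blast
    then have "r \<odot>\<^bsub>M\<^esub> p = r \<odot>\<^bsub>M\<^esub> x \<oplus>\<^bsub>M\<^esub> r \<odot>\<^bsub>M\<^esub> y" by (simp add: AB smult_r_distr rp(1))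
    then show ?thesis using A'(6)[OF rp(1) *(2)] B'(6)[OF rp(1) *(3)] by blast
  qed
qed

context
  fixes R :: "('r, 'b) ring_scheme" and M :: "('r, 'a) module" and N :: "'a set"
  assumes M: "module R M" and N: "submodule N R M"
begin

interpretation module R M by (rule M)

lemmas N' = submoduleD[OF M N]

lemma coset_self: "x \<in> carrier M \<Longrightarrow> x \<in> N +>\<^bsub>M\<^esub> x"
  unfolding a_r_coset_def' using N'(2) by (auto intro!: bexI[of _ "\<zero>\<^bsub>M\<^esub>"])

lemma coset_memD:
  assumes "y \<in> N +>\<^bsub>M\<^esub> x" "x \<in> carrier M"
  shows "y \<in> carrier M" "y \<ominus>\<^bsub>M\<^esub> x \<in> N"
proof -
  obtain n where n: "n \<in> N" "y = n \<oplus>\<^bsub>M\<^esub> x" using assms(1) by (auto simp: a_r_coset_def')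
  then show "y \<in> carrier M" "y \<ominus>\<^bsub>M\<^esub> x \<in> N"
    using N'(1) assms(2) module_minus_add(2)[OF M, of n x] by auto
qed

lemma coset_eq_iff:
  assumes x: "x \<in> carrier M" and y: "y \<in> carrier M"
  shows "N +>\<^bsub>M\<^esub> x = N +>\<^bsub>M\<^esub> y \<longleftrightarrow> x \<ominus>\<^bsub>M\<^esub> y \<in> N"
proof
  show "x \<ominus>\<^bsub>M\<^esub> y \<in> N" if "N +>\<^bsub>M\<^esub> x = N +>\<^bsub>M\<^esub> y"
    using coset_self[OF x] coset_memD(2)[OF _ y] that by simp
next
  have *: "N +>\<^bsub>M\<^esub> x \<subseteq> N +>\<^bsub>M\<^esub> y" if xy: "x \<in> carrier M" "y \<in> carrier M" "x \<ominus>\<^bsub>M\<^esub> y \<in> N" for x y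
  proof
    fix z assume "z \<in> N +>\<^bsub>M\<^esub> x"
    then obtain n where n: "n \<in> N" "z = n \<oplus>\<^bsub>M\<^esub> x" by (auto simp: a_r_coset_def')
    then have "z = (n \<oplus>\<^bsub>M\<^esub> (x \<ominus>\<^bsub>M\<^esub> y)) \<oplus>\<^bsub>M\<^esub> y"
      using xy N'(1) module_minus_add[OF M xy(1,2)] by (simp add: M.a_assoc subset_iff)
    then show "z \<in> N +>\<^bsub>M\<^esub> y" using N'(3)[OF n(1) xy(3)] by (auto simp: a_r_coset_def')
  qed
  assume a: "x \<ominus>\<^bsub>M\<^esub> y \<in> N"
  have "y \<ominus>\<^bsub>M\<^esub> x = \<ominus>\<^bsub>M\<^esub> (x \<ominus>\<^bsub>M\<^esub> y)"
    using x y by (simp add: M.minus_eq M.minus_add M.a_comm)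
  then have "y \<ominus>\<^bsub>M\<^esub> x \<in> N" using N'(4)[OF a] by simp
  then show "N +>\<^bsub>M\<^esub> x = N +>\<^bsub>M\<^esub> y" using *[OF x y a] *[OF y x] by blast
qed

lemma coset_eq_zero_iff:
  assumes x: "x \<in> carrier M"
  shows "N +>\<^bsub>M\<^esub> x = N \<longleftrightarrow> x \<in> N"
proof -
  have "N +>\<^bsub>M\<^esub> \<zero>\<^bsub>M\<^esub> = N" using N'(1) by (auto simp: a_r_coset_def' subset_iff)
  moreover have "x \<ominus>\<^bsub>M\<^esub> \<zero>\<^bsub>M\<^esub> = x"
    using module_minus_add(1,3)[OF M x M.zero_closed] by simp
  ultimately show ?thesis using coset_eq_iff[OF x M.zero_closed] by simp
qed

lemma carrier_quotient_module: "carrier (quotient_module M N) = (\<lambda>x. N +>\<^bsub>M\<^esub> x) ` carrier M"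
  by (auto simp: quotient_module_def A_RCOSETS_def')

lemma zero_quotient_module: "\<zero>\<^bsub>quotient_module M N\<^esub> = N"
  by (simp add: quotient_module_def)

lemma add_quotient_module:
  assumes x: "x \<in> carrier M" and y: "y \<in> carrier M"
  shows "(N +>\<^bsub>M\<^esub> x) \<oplus>\<^bsub>quotient_module M N\<^esub> (N +>\<^bsub>M\<^esub> y) = N +>\<^bsub>M\<^esub> (x \<oplus>\<^bsub>M\<^esub> y)"
proof -
  have "(N +>\<^bsub>M\<^esub> x) <+>\<^bsub>M\<^esub> (N +>\<^bsub>M\<^esub> y) = N +>\<^bsub>M\<^esub> (x \<oplus>\<^bsub>M\<^esub> y)"
  proof (intro equalityI subsetI)
    fix z assume "z \<in> (N +>\<^bsub>M\<^esub> x) <+>\<^bsub>M\<^esub> (N +>\<^bsub>M\<^esub> y)"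
    then obtain n n' where n: "n \<in> N" "n' \<in> N" "z = (n \<oplus>\<^bsub>M\<^esub> x) \<oplus>\<^bsub>M\<^esub> (n' \<oplus>\<^bsub>M\<^esub> y)"
      by (auto simp: set_add_def' a_r_coset_def')
    then have "z = (n \<oplus>\<^bsub>M\<^esub> n') \<oplus>\<^bsub>M\<^esub> (x \<oplus>\<^bsub>M\<^esub> y)"
      using N'(1) x y by (simp add: M.a_ac subset_iff)
    then show "z \<in> N +>\<^bsub>M\<^esub> (x \<oplus>\<^bsub>M\<^esub> y)" using N'(3)[OF n(1,2)] by (auto simp: a_r_coset_def')
  next
    fix z assume "z \<in> N +>\<^bsub>M\<^esub> (x \<oplus>\<^bsub>M\<^esub> y)"
    then obtain n where n: "n \<in> N" "z = n \<oplus>\<^bsub>M\<^esub> (x \<oplus>\<^bsub>M\<^esub> y)" by (auto simp: a_r_coset_def')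
    then have "z = (n \<oplus>\<^bsub>M\<^esub> x) \<oplus>\<^bsub>M\<^esub> (\<zero>\<^bsub>M\<^esub> \<oplus>\<^bsub>M\<^esub> y)"
      using N'(1) x y by (simp add: M.a_ac subset_iff)
    then show "z \<in> (N +>\<^bsub>M\<^esub> x) <+>\<^bsub>M\<^esub> (N +>\<^bsub>M\<^esub> y)"
      using n(1) N'(2) unfolding set_add_def' a_r_coset_def' by blast
  qed
  then show ?thesis by (simp add: quotient_module_def)
qed

text \<open>Multiplying a coset elementwise by \<open>r\<close> need not fill a coset, whence the
  union in \<open>quotient_module\<close>. All cosets in that union coincide.\<close>

lemma smult_quotient_module:
  assumes r: "r \<in> carrier R" and x: "x \<in> carrier M"
  shows "r \<odot>\<^bsub>quotient_module M N\<^esub> (N +>\<^bsub>M\<^esub> x) = N +>\<^bsub>M\<^esub> (r \<odot>\<^bsub>M\<^esub> x)"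
proof -
  have "N +>\<^bsub>M\<^esub> (r \<odot>\<^bsub>M\<^esub> y) = N +>\<^bsub>M\<^esub> (r \<odot>\<^bsub>M\<^esub> x)" if y: "y \<in> N +>\<^bsub>M\<^esub> x" for y
  proof -
    note y' = coset_memD[OF y x]
    have "r \<odot>\<^bsub>M\<^esub> y \<ominus>\<^bsub>M\<^esub> r \<odot>\<^bsub>M\<^esub> x = r \<odot>\<^bsub>M\<^esub> (y \<ominus>\<^bsub>M\<^esub> x)"
      using y'(1) r x by (simp add: M.minus_eq smult_r_distr smult_r_minus)
    then show ?thesis using coset_eq_iff y'(1) r x N'(6)[OF r y'(2)] by simp
  qed
  then have "(\<Union>y\<in>N +>\<^bsub>M\<^esub> x. N +>\<^bsub>M\<^esub> (r \<odot>\<^bsub>M\<^esub> y)) = N +>\<^bsub>M\<^esub> (r \<odot>\<^bsub>M\<^esub> x)"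
    using coset_self[OF x] by blast
  then show ?thesis by (simp add: quotient_module_def)
qed

lemma module_quotient_module: "module R (quotient_module M N)"
proof (rule moduleI)
  let ?Q = "quotient_module M N"
  have ex: "\<exists>x\<in>carrier M. X = N +>\<^bsub>M\<^esub> x" if "X \<in> carrier ?Q" for X
    using that by (auto simp: carrier_quotient_module)
  have cl: "N +>\<^bsub>M\<^esub> x \<in> carrier ?Q" if "x \<in> carrier M" for x
    using that by (auto simp: carrier_quotient_module)
  have zero: "\<zero>\<^bsub>?Q\<^esub> = N +>\<^bsub>M\<^esub> \<zero>\<^bsub>M\<^esub>"
    using coset_eq_zero_iff[of "\<zero>\<^bsub>M\<^esub>"] N'(2) by (simp add: zero_quotient_module)
  note ops = add_quotient_module smult_quotient_module
  show "cring R" ..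
  show "abelian_group ?Q"
  proof (rule abelian_groupI)
    show "\<zero>\<^bsub>?Q\<^esub> \<in> carrier ?Q" using cl by (simp add: zero)
  next
    fix X assume "X \<in> carrier ?Q"
    then obtain x where x: "x \<in> carrier M" "X = N +>\<^bsub>M\<^esub> x" using ex by blast
    then show "\<zero>\<^bsub>?Q\<^esub> \<oplus>\<^bsub>?Q\<^esub> X = X" by (simp add: ops zero)
    have "(N +>\<^bsub>M\<^esub> (\<ominus>\<^bsub>M\<^esub> x)) \<oplus>\<^bsub>?Q\<^esub> X = \<zero>\<^bsub>?Q\<^esub>"
      using x by (simp add: ops zero M.l_neg)
    then show "\<exists>Y\<in>carrier ?Q. Y \<oplus>\<^bsub>?Q\<^esub> X = \<zero>\<^bsub>?Q\<^esub>"
      using cl[of "\<ominus>\<^bsub>M\<^esub> x"] x by auto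
    fix Y assume "Y \<in> carrier ?Q"
    then obtain y where y: "y \<in> carrier M" "Y = N +>\<^bsub>M\<^esub> y" using ex by blast
    show "X \<oplus>\<^bsub>?Q\<^esub> Y \<in> carrier ?Q" "X \<oplus>\<^bsub>?Q\<^esub> Y = Y \<oplus>\<^bsub>?Q\<^esub> X"
      using x y cl by (simp_all add: ops M.a_ac)
    fix Z assume "Z \<in> carrier ?Q"
    then obtain z where "z \<in> carrier M" "Z = N +>\<^bsub>M\<^esub> z" using ex by blast
    then show "(X \<oplus>\<^bsub>?Q\<^esub> Y) \<oplus>\<^bsub>?Q\<^esub> Z = X \<oplus>\<^bsub>?Q\<^esub> (Y \<oplus>\<^bsub>?Q\<^esub> Z)"
      using x y by (simp add: ops M.a_ac)
  qed
  fix X assume "X \<in> carrier ?Q"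
  then obtain x where x: "x \<in> carrier M" "X = N +>\<^bsub>M\<^esub> x" using ex by blast
  then show "\<one>\<^bsub>R\<^esub> \<odot>\<^bsub>?Q\<^esub> X = X" by (simp add: ops)
  fix a assume a: "a \<in> carrier R"
  then show "a \<odot>\<^bsub>?Q\<^esub> X \<in> carrier ?Q" using x cl by (simp add: ops)
  show "a \<odot>\<^bsub>?Q\<^esub> (X \<oplus>\<^bsub>?Q\<^esub> Y) = a \<odot>\<^bsub>?Q\<^esub> X \<oplus>\<^bsub>?Q\<^esub> a \<odot>\<^bsub>?Q\<^esub> Y" if "Y \<in> carrier ?Q" for Y
    using ex[OF that] a x by (auto simp: ops smult_r_distr)
  fix b assume b: "b \<in> carrier R"
  show "(a \<oplus>\<^bsub>R\<^esub> b) \<odot>\<^bsub>?Q\<^esub> X = a \<odot>\<^bsub>?Q\<^esub> X \<oplus>\<^bsub>?Q\<^esub> b \<odot>\<^bsub>?Q\<^esub> X"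
    "(a \<otimes>\<^bsub>R\<^esub> b) \<odot>\<^bsub>?Q\<^esub> X = a \<odot>\<^bsub>?Q\<^esub> (b \<odot>\<^bsub>?Q\<^esub> X)"
    using a b x by (simp_all add: ops smult_l_distr smult_assoc1)
qed

lemma quotient_map_hom: "(\<lambda>x. N +>\<^bsub>M\<^esub> x) \<in> module_hom R M (quotient_module M N)"
  by (rule module_homI) (auto simp: carrier_quotient_module add_quotient_module smult_quotient_module)

text \<open>The first isomorphism theorem, in the form by which the pages are identified below: a
  surjection and its kernel suffice.\<close>

lemma module_iso_quotient_module:
  assumes P: "module R P" and h: "h \<in> module_hom R M P"
    and surj: "\<And>y. y \<in> carrier P \<Longrightarrow> \<exists>x\<in>carrier M. h x = y"
    and ker: "\<And>x. x \<in> carrier M \<Longrightarrow> h x = \<zero>\<^bsub>P\<^esub> \<longleftrightarrow> x \<in> N"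
  shows "module_iso R (quotient_module M N) P"
proof -
  interpret P: module R P by (rule P)
  let ?Q = "quotient_module M N"
  note h' = module_homD[OF h]
  have eq: "h x = h y \<longleftrightarrow> x \<ominus>\<^bsub>M\<^esub> y \<in> N" if xy: "x \<in> carrier M" "y \<in> carrier M" for x y
  proof -
    have "h x = h y \<longleftrightarrow> h x \<ominus>\<^bsub>P\<^esub> h y = \<zero>\<^bsub>P\<^esub>"
      using module_minus_add(1)[OF P h'(1)[OF xy(1)] h'(1)[OF xy(2)]] h'(1) xy
      by (metis P.M.l_zero P.M.minus_eq P.M.r_neg)
    also have "\<dots> \<longleftrightarrow> x \<ominus>\<^bsub>M\<^esub> y \<in> N"
      using ker[of "x \<ominus>\<^bsub>M\<^esub> y"] module_hom_zero_minus(2)[OF M P h xy] module_minus_add(3)[OF M xy] by simp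
    finally show ?thesis .
  qed
  \<comment> \<open>Any representative will do, since \<open>eq\<close> makes \<open>h\<close>
    constant on cosets.\<close>
  define k where "k = (\<lambda>X. h (SOME x. x \<in> X))"
  have k: "k (N +>\<^bsub>M\<^esub> x) = h x" if x: "x \<in> carrier M" for x
  proof -
    have "(SOME y. y \<in> N +>\<^bsub>M\<^esub> x) \<in> N +>\<^bsub>M\<^esub> x" using coset_self[OF x] by (rule someI)
    from coset_memD[OF this x] show ?thesis unfolding k_def using eq x by blast
  qed
  have "k \<in> module_hom R ?Q P"
    using h' by (intro module_homI) (auto simp: carrier_quotient_module k add_quotient_module smult_quotient_module)
  moreover have "bij_betw k (carrier ?Q) (carrier P)"
  proof (rule bij_betwI')
    fix X Y assume "X \<in> carrier ?Q" "Y \<in> carrier ?Q"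
    then obtain x y where xy: "x \<in> carrier M" "y \<in> carrier M" "X = N +>\<^bsub>M\<^esub> x" "Y = N +>\<^bsub>M\<^esub> y"
      by (auto simp: carrier_quotient_module)
    then show "k X = k Y \<longleftrightarrow> X = Y" using eq coset_eq_iff by (simp add: k)
  next
    fix X assume "X \<in> carrier ?Q"
    then show "k X \<in> carrier P" using h'(1) by (auto simp: carrier_quotient_module k)
  next
    fix y assume "y \<in> carrier P"
    then obtain x where "x \<in> carrier M" "h x = y" using surj by blast
    then show "\<exists>X\<in>carrier ?Q. y = k X" using k by (auto simp: carrier_quotient_module)
  qed
  ultimately show ?thesis unfolding module_iso_def by blast
qed

end

lemma module_hom_comp:
  assumes "f \<in> module_hom R L M" "g \<in> module_hom R M N"
  shows "(\<lambda>x. g (f x)) \<in> module_hom R L N"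
  using module_homD[OF assms(1)] module_homD[OF assms(2)] by (intro module_homI) simp_all

lemma module_hom_restrict:
  assumes "h \<in> module_hom R M P" "Z \<subseteq> carrier M" "h ` Z \<subseteq> Y"
  shows "h \<in> module_hom R (M\<lparr>carrier := Z\<rparr>) (P\<lparr>carrier := Y\<rparr>)"
proof (rule module_homI)
  note h = module_homD[OF assms(1)]
  have Z: "x \<in> carrier M" if "x \<in> Z" for x using that assms(2) by blast
  show "h x \<in> carrier (P\<lparr>carrier := Y\<rparr>)" if "x \<in> carrier (M\<lparr>carrier := Z\<rparr>)" for x
    using that assms(3) by auto
  show "h (x \<oplus>\<^bsub>M\<lparr>carrier := Z\<rparr>\<^esub> y) = h x \<oplus>\<^bsub>P\<lparr>carrier := Y\<rparr>\<^esub> h y"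
    if "x \<in> carrier (M\<lparr>carrier := Z\<rparr>)" "y \<in> carrier (M\<lparr>carrier := Z\<rparr>)" for x y
    using that h(2)[of x y] Z by simp
  show "h (r \<odot>\<^bsub>M\<lparr>carrier := Z\<rparr>\<^esub> x) = r \<odot>\<^bsub>P\<lparr>carrier := Y\<rparr>\<^esub> h x"
    if "r \<in> carrier R" "x \<in> carrier (M\<lparr>carrier := Z\<rparr>)" for r x
    using that h(3)[of r x] Z by simp
qed

section \<open>The spectral sequence of a filtered complex\<close>

text \<open>A single module holds all degrees, and \<open>G s n\<close> is the part of level
  \<open>s\<close> and degree \<open>n\<close>. Subtraction and images can then be formed without
  passing between modules. Levels below 0 repeat level 0, so the formulas for pages apply to all
  integers.\<close>

locale filtered_complex =
  fixes R :: "('r, 'b) ring_scheme" and M :: "('r, 'a) module"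
    and d :: "'a \<Rightarrow> 'a" and G :: "int \<Rightarrow> int \<Rightarrow> 'a set" and m :: int
  assumes M: "module R M"
    and d: "d \<in> module_hom R M M"
    and d_d: "\<And>x. x \<in> carrier M \<Longrightarrow> d (d x) = \<zero>\<^bsub>M\<^esub>"
    and G: "\<And>s n. submodule (G s n) R M"
    and G_anti: "\<And>s n. G (s + 1) n \<subseteq> G s n"
    and G_d: "\<And>s n x. x \<in> G s n \<Longrightarrow> d x \<in> G s (n + 1)"
    and G_low: "\<And>s n. s \<le> 0 \<Longrightarrow> G s n = G 0 n"
    and G_high: "\<And>s n. s > m \<Longrightarrow> G s n = {\<zero>\<^bsub>M\<^esub>}"
begin

interpretation module R M by (rule M)

lemmas d' = module_homD[OF d]
lemmas d_zero_minus = module_hom_zero_minus[OF M M d]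
lemmas G' = submoduleD[OF M G]

lemma G_carrier: "x \<in> G s n \<Longrightarrow> x \<in> carrier M"
  using G'(1) by blast

lemma G_anti_le: "s \<le> s' \<Longrightarrow> x \<in> G s' n \<Longrightarrow> x \<in> G s n"
proof (induction s' rule: int_ge_induct)
  case (step i) then show ?case using G_anti by blast
qed

section \<open>Pages and their differentials\<close>

definition cyc :: "int \<Rightarrow> int \<Rightarrow> int \<Rightarrow> 'a set" where
  "cyc r s n = {x \<in> G s n. d x \<in> G (s + r) (n + 1)}"

text \<open>The classical denominator: the page is Z_r^s modulo Z_(r-1)^(s+1) + d Z_(r-1)^(s-r+1),
  where \<open>cyc\<close> is Z. The second index of a page is the total degree.\<close>

definition bnd :: "int \<Rightarrow> int \<Rightarrow> int \<Rightarrow> 'a set" where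
  "bnd r s n = {y \<oplus>\<^bsub>M\<^esub> z |y z. y \<in> cyc (r - 1) (s + 1) n \<and> z \<in> d ` cyc (r - 1) (s - r + 1) (n - 1)}"

definition page :: "int \<Rightarrow> int \<Rightarrow> int \<Rightarrow> ('r, 'a set) module" where
  "page r s n = quotient_module (M\<lparr>carrier := cyc r s n\<rparr>) (bnd r s n)"

text \<open>The union ranges over all representatives, each of which gives the same coset because
  \<open>d\<close> maps \<open>bnd\<close> into \<open>bnd\<close>. No representative has to be
  chosen.\<close>

definition page_diff :: "int \<Rightarrow> int \<Rightarrow> int \<Rightarrow> 'a set \<Rightarrow> 'a set" where
  "page_diff r s n X = (\<Union>x\<in>X. bnd r (s + r) (n + 1) +>\<^bsub>M\<^esub> d x)"

lemma cyc_carrier: "x \<in> cyc r s n \<Longrightarrow> x \<in> carrier M"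
  by (auto simp: cyc_def intro: G_carrier)

lemma submodule_cyc: "submodule (cyc r s n) R M"
  unfolding cyc_def by (rule submodule_preimage[OF M M d G G])

lemma submodule_bnd: "submodule (bnd r s n) R M"
  unfolding bnd_def by (rule submodule_sum[OF M submodule_cyc submodule_image[OF M M d submodule_cyc]])

lemmas cyc' = submoduleD[OF M submodule_cyc]
lemmas bnd' = submoduleD[OF M submodule_bnd]

lemma cyc_bndI: "y \<in> cyc (r - 1) (s + 1) n \<Longrightarrow> y \<in> bnd r s n"
  unfolding bnd_def
  by (rule CollectI, rule exI[of _ y], rule exI[of _ "\<zero>\<^bsub>M\<^esub>"])
    (use cyc_carrier cyc'(2) d_zero_minus(1) in \<open>force simp: image_iff\<close>)

lemma d_bndI: "w \<in> cyc (r - 1) (s - r + 1) (n - 1) \<Longrightarrow> d w \<in> bnd r s n"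
  unfolding bnd_def
  by (rule CollectI, rule exI[of _ "\<zero>\<^bsub>M\<^esub>"], rule exI[of _ "d w"])
    (use cyc_carrier cyc'(2) d'(1) in \<open>force simp: image_iff\<close>)

lemma bndE:
  assumes "x \<in> bnd r s n"
  obtains y w where "y \<in> cyc (r - 1) (s + 1) n" "w \<in> cyc (r - 1) (s - r + 1) (n - 1)" "x = y \<oplus>\<^bsub>M\<^esub> d w"
  using assms unfolding bnd_def by blast

lemma d_cyc: "x \<in> cyc r s n \<Longrightarrow> d x \<in> cyc r (s + r) (n + 1)"
  using d_d[OF cyc_carrier, of x r s n] G'(2) by (auto simp: cyc_def)

lemma bnd_cyc: "bnd r s n \<subseteq> cyc r s n"
proof
  fix x assume "x \<in> bnd r s n"
  then obtain y w where *: "y \<in> cyc (r - 1) (s + 1) n" "w \<in> cyc (r - 1) (s - r + 1) (n - 1)" "x = y \<oplus>\<^bsub>M\<^esub> d w"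
    by (rule bndE)
  have "y \<in> cyc r s n"
    using *(1) G_anti_le[of s "s + 1" y n] by (simp add: cyc_def)
  moreover have "d w \<in> cyc r s n"
    using *(2) G'(2) d_d[OF cyc_carrier[OF *(2)]] by (simp add: cyc_def)
  ultimately show "x \<in> cyc r s n" unfolding *(3) by (rule cyc'(3))
qed

lemma d_bnd:
  assumes "x \<in> bnd r s n"
  shows "d x \<in> bnd r (s + r) (n + 1)"
proof -
  from assms obtain y w where *: "y \<in> cyc (r - 1) (s + 1) n" "w \<in> cyc (r - 1) (s - r + 1) (n - 1)" "x = y \<oplus>\<^bsub>M\<^esub> d w"
    by (rule bndE)
  have "d x = d y"
    using d'(2)[of y "d w"] d_d d'(1) cyc_carrier[OF *(1)] cyc_carrier[OF *(2)] *(3) by simp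
  moreover have "d y \<in> bnd r (s + r) (n + 1)" using *(1) by (intro d_bndI) (simp add: algebra_simps)
  ultimately show ?thesis by simp
qed

lemma module_cyc: "module R (M\<lparr>carrier := cyc r s n\<rparr>)"
  by (rule module_carrier_update[OF M submodule_cyc])

lemma submodule_bnd_cyc: "submodule (bnd r s n) R (M\<lparr>carrier := cyc r s n\<rparr>)"
  by (rule submodule_carrier_update[OF M submodule_cyc submodule_bnd bnd_cyc])

lemma module_page: "module R (page r s n)"
  unfolding page_def by (rule module_quotient_module[OF module_cyc submodule_bnd_cyc])

lemma carrier_page: "carrier (page r s n) = (\<lambda>x. bnd r s n +>\<^bsub>M\<^esub> x) ` cyc r s n"
  unfolding page_def using carrier_quotient_module[OF module_cyc submodule_bnd_cyc, of r s n] by simp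

lemma zero_page: "\<zero>\<^bsub>page r s n\<^esub> = bnd r s n"
  unfolding page_def by (rule zero_quotient_module[OF module_cyc submodule_bnd_cyc])

lemma page_map_hom: "(\<lambda>x. bnd r s n +>\<^bsub>M\<^esub> x) \<in> module_hom R (M\<lparr>carrier := cyc r s n\<rparr>) (page r s n)"
  unfolding page_def using quotient_map_hom[OF module_cyc submodule_bnd_cyc, of r s n] by simp

lemmas coset_eq = coset_eq_iff[OF M submodule_bnd]
lemmas coset_zero = coset_eq_zero_iff[OF M submodule_bnd]

lemma page_diff_coset:
  assumes x: "x \<in> cyc r s n"
  shows "page_diff r s n (bnd r s n +>\<^bsub>M\<^esub> x) = bnd r (s + r) (n + 1) +>\<^bsub>M\<^esub> d x"
proof -
  note xM = cyc_carrier[OF x]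
  have "bnd r (s + r) (n + 1) +>\<^bsub>M\<^esub> d y = bnd r (s + r) (n + 1) +>\<^bsub>M\<^esub> d x"
    if y: "y \<in> bnd r s n +>\<^bsub>M\<^esub> x" for y
  proof -
    note y' = coset_memD[OF M submodule_bnd y xM]
    have "d y \<ominus>\<^bsub>M\<^esub> d x \<in> bnd r (s + r) (n + 1)"
      using d_bnd[OF y'(2)] d_zero_minus(2)[OF y'(1) xM] by simp
    then show ?thesis using coset_eq[OF d'(1)[OF y'(1)] d'(1)[OF xM]] by simp
  qed
  then show ?thesis
    unfolding page_diff_def using coset_self[OF M submodule_bnd xM, of r s n] by blast
qed

lemma page_diff_hom: "page_diff r s n \<in> module_hom R (page r s n) (page r (s + r) (n + 1))"
proof (rule module_homI)
  note q = module_homD[OF page_map_hom, simplified]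
  fix X assume "X \<in> carrier (page r s n)"
  then obtain x where x: "x \<in> cyc r s n" "X = bnd r s n +>\<^bsub>M\<^esub> x" by (auto simp: carrier_page)
  then show "page_diff r s n X \<in> carrier (page r (s + r) (n + 1))"
    using d_cyc q(1) by (simp add: page_diff_coset)
  show "page_diff r s n (a \<odot>\<^bsub>page r s n\<^esub> X) = a \<odot>\<^bsub>page r (s + r) (n + 1)\<^esub> page_diff r s n X"
    if "a \<in> carrier R" for a
    using that x d_cyc[OF x(1)] cyc'(6)[of a x r s n] cyc_carrier[OF x(1)]
    by (simp add: q(3)[symmetric] page_diff_coset d'(3))
  fix Y assume "Y \<in> carrier (page r s n)"
  then obtain y where y: "y \<in> cyc r s n" "Y = bnd r s n +>\<^bsub>M\<^esub> y" by (auto simp: carrier_page)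
  show "page_diff r s n (X \<oplus>\<^bsub>page r s n\<^esub> Y) = page_diff r s n X \<oplus>\<^bsub>page r (s + r) (n + 1)\<^esub> page_diff r s n Y"
    using x y d_cyc cyc'(3)[of x r s n y] cyc_carrier[OF x(1)] cyc_carrier[OF y(1)]
    by (simp add: q(2)[symmetric] page_diff_coset d'(2))
qed

lemma page_diff_page_diff:
  assumes "X \<in> carrier (page r s n)"
  shows "page_diff r (s + r) (n + 1) (page_diff r s n X) = \<zero>\<^bsub>page r (s + 2 * r) (n + 2)\<^esub>"
proof -
  obtain x where x: "x \<in> cyc r s n" "X = bnd r s n +>\<^bsub>M\<^esub> x" using assms by (auto simp: carrier_page)
  have "page_diff r (s + r) (n + 1) (page_diff r s n X) = bnd r (s + r + r) (n + 1 + 1) +>\<^bsub>M\<^esub> \<zero>\<^bsub>M\<^esub>"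
    using d_cyc[OF x(1)] d_d[OF cyc_carrier[OF x(1)]] x by (simp add: page_diff_coset)
  also have "\<dots> = \<zero>\<^bsub>page r (s + r + r) (n + 1 + 1)\<^esub>"
    using coset_zero bnd'(2) by (simp add: zero_page)
  finally show ?thesis by (simp add: algebra_simps)
qed

text \<open>An element of \<open>cyc (r + 1) s n\<close> is a cycle on page \<open>r\<close>.
  Conversely a cycle there can be corrected within \<open>bnd r s n\<close> to such an element, and
  those that become boundaries on page \<open>r\<close> form exactly
  \<open>bnd (r + 1) s n\<close>.\<close>

lemma module_iso_next_page:
  "module_iso R (page (r + 1) s n)
    (homology (page r (s - r) (n - 1)) (page_diff r (s - r) (n - 1)) (page r s n) (page_diff r s n)
      (page r (s + r) (n + 1)))"
proof -
  let ?E = "page r s n" and ?P = "page r (s + r) (n + 1)" and ?L = "page r (s - r) (n - 1)"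
  define K where "K = {X \<in> carrier ?E. page_diff r s n X = \<zero>\<^bsub>?P\<^esub>}"
  define I where "I = page_diff r (s - r) (n - 1) ` carrier ?L"
  have hom_in: "page_diff r (s - r) (n - 1) \<in> module_hom R ?L ?E"
    using page_diff_hom[of r "s - r" "n - 1"] by simp
  have K: "submodule K R ?E"
  proof -
    have "submodule {\<zero>\<^bsub>?P\<^esub>} R ?P"
    proof -
      interpret P: module R ?P by (rule module_page)
      show ?thesis by (rule submodule_closedI[OF module_page]) auto
    qed
    from submodule_preimage[OF module_page module_page page_diff_hom module.carrier_is_submodule[OF module_page] this]
    show ?thesis by (simp add: K_def)
  qed
  have I: "submodule I R ?E"
    unfolding I_def
    by (rule submodule_image[OF module_page module_page hom_in module.carrier_is_submodule[OF module_page]])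
  have IK: "I \<subseteq> K"
    using page_diff_page_diff[of _ r "s - r" "n - 1"] module_homD(1)[OF hom_in]
    by (auto simp: I_def K_def algebra_simps)
  have KM: "module R (?E\<lparr>carrier := K\<rparr>)" by (rule module_carrier_update[OF module_page K])
  have IKs: "submodule I R (?E\<lparr>carrier := K\<rparr>)" by (rule submodule_carrier_update[OF module_page K I IK])
  have c_sub: "cyc (r + 1) s n \<subseteq> cyc r s n"
    using G_anti_le[of "s + r" "s + (r + 1)"] by (auto simp: cyc_def)
  have cK: "bnd r s n +>\<^bsub>M\<^esub> x \<in> K" if x: "x \<in> cyc (r + 1) s n" for x
  proof -
    have "d x \<in> cyc (r - 1) (s + r + 1) (n + 1)"
      using x d_d[OF cyc_carrier[OF x]] G'(2) by (simp add: cyc_def add.assoc)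
    then have "d x \<in> bnd r (s + r) (n + 1)" by (rule cyc_bndI)
    moreover have "x \<in> cyc r s n" using c_sub x by blast
    ultimately show ?thesis
      using coset_zero[OF d'(1)[OF cyc_carrier[OF x]]]
      by (auto simp: K_def carrier_page page_diff_coset zero_page)
  qed
  define h where "h = (\<lambda>x. I +>\<^bsub>?E\<^esub> (bnd r s n +>\<^bsub>M\<^esub> x))"
  have h1: "(\<lambda>x. bnd r s n +>\<^bsub>M\<^esub> x) \<in> module_hom R (M\<lparr>carrier := cyc (r + 1) s n\<rparr>) (?E\<lparr>carrier := K\<rparr>)"
    using module_hom_restrict[OF page_map_hom, of "cyc (r + 1) s n" r s n K] c_sub cK by auto
  have h: "h \<in> module_hom R (M\<lparr>carrier := cyc (r + 1) s n\<rparr>) (quotient_module (?E\<lparr>carrier := K\<rparr>) I)"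
    unfolding h_def using module_hom_comp[OF h1 quotient_map_hom[OF KM IKs]] by simp
  have "module_iso R (quotient_module (M\<lparr>carrier := cyc (r + 1) s n\<rparr>) (bnd (r + 1) s n))
      (quotient_module (?E\<lparr>carrier := K\<rparr>) I)"
  proof (rule module_iso_quotient_module[OF module_cyc submodule_bnd_cyc module_quotient_module[OF KM IKs] h])
    fix Y assume "Y \<in> carrier (quotient_module (?E\<lparr>carrier := K\<rparr>) I)"
    then obtain X where X: "X \<in> K" "Y = I +>\<^bsub>?E\<^esub> X"
      using carrier_quotient_module[OF KM IKs] by auto
    then obtain x where x: "x \<in> cyc r s n" "X = bnd r s n +>\<^bsub>M\<^esub> x"
      by (auto simp: K_def carrier_page)
    note xM = cyc_carrier[OF x(1)]
    have "d x \<in> bnd r (s + r) (n + 1)"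
      using X(1) x coset_zero[OF d'(1)[OF xM]] by (simp add: K_def page_diff_coset zero_page)
    then obtain y z where yz: "y \<in> cyc (r - 1) (s + r + 1) (n + 1)"
        "z \<in> cyc (r - 1) (s + r - r + 1) (n + 1 - 1)" "d x = y \<oplus>\<^bsub>M\<^esub> d z"
      by (rule bndE)
    have z: "z \<in> cyc (r - 1) (s + 1) n" using yz(2) by simp
    note zM = cyc_carrier[OF z]
    \<comment> \<open>Subtracting \<open>z\<close> removes the part of \<open>d x\<close> that is
      only a boundary of level \<open>s + 1\<close>. What remains, \<open>y\<close>, lies one level
      deeper, and \<open>z\<close> itself is zero on the page.\<close>
    define x' where "x' = x \<ominus>\<^bsub>M\<^esub> z"
    have "z \<in> G s n" using z G_anti by (auto simp: cyc_def)
    then have "x' \<in> G s n" unfolding x'_def using x(1) by (intro G'(5)) (simp_all add: cyc_def)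
    moreover have "d x' = y"
      unfolding x'_def
      using d_zero_minus(2)[OF xM zM] yz(3) module_minus_add(2)[OF M cyc_carrier[OF yz(1)] d'(1)[OF zM]] by simp
    ultimately have x': "x' \<in> cyc (r + 1) s n" using yz(1) by (simp add: cyc_def add.assoc)
    have "x \<ominus>\<^bsub>M\<^esub> x' = z"
    proof -
      have "x = z \<oplus>\<^bsub>M\<^esub> x'"
        using module_minus_add(1,3)[OF M xM zM] zM by (simp add: x'_def M.a_comm)
      then show ?thesis using module_minus_add(2)[OF M zM cyc_carrier[OF x']] by simp
    qed
    then have "bnd r s n +>\<^bsub>M\<^esub> x = bnd r s n +>\<^bsub>M\<^esub> x'"
      using coset_eq[OF xM cyc_carrier[OF x']] cyc_bndI[OF z] by simp
    then have "h x' = Y" unfolding h_def X(2) x(2) by simp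
    then show "\<exists>x\<in>carrier (M\<lparr>carrier := cyc (r + 1) s n\<rparr>). h x = Y" using x' by auto
  next
    fix x assume "x \<in> carrier (M\<lparr>carrier := cyc (r + 1) s n\<rparr>)"
    then have x: "x \<in> cyc (r + 1) s n" by simp
    note xM = cyc_carrier[OF x]
    have "h x = \<zero>\<^bsub>quotient_module (?E\<lparr>carrier := K\<rparr>) I\<^esub> \<longleftrightarrow> bnd r s n +>\<^bsub>M\<^esub> x \<in> I"
      unfolding zero_quotient_module[OF KM IKs] h_def
      using coset_eq_zero_iff[OF KM IKs, of "bnd r s n +>\<^bsub>M\<^esub> x"] cK[OF x] by simp
    also have "\<dots> \<longleftrightarrow> x \<in> bnd (r + 1) s n"
    proof
      assume "bnd r s n +>\<^bsub>M\<^esub> x \<in> I"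
      then obtain w where w: "w \<in> cyc r (s - r) (n - 1)" "bnd r s n +>\<^bsub>M\<^esub> x = bnd r s n +>\<^bsub>M\<^esub> d w"
        by (auto simp: I_def carrier_page page_diff_coset)
      note wM = cyc_carrier[OF w(1)]
      have "x \<ominus>\<^bsub>M\<^esub> d w \<in> bnd r s n" using w(2) coset_eq[OF xM d'(1)[OF wM]] by simp
      then obtain y v where y: "y \<in> cyc (r - 1) (s + 1) n" and v: "v \<in> cyc (r - 1) (s - r + 1) (n - 1)"
          and xy: "x \<ominus>\<^bsub>M\<^esub> d w = y \<oplus>\<^bsub>M\<^esub> d v"
        by (rule bndE)
      note yM = cyc_carrier[OF y] and vM = cyc_carrier[OF v]
      have "v \<in> cyc r (s - r) (n - 1)"
        using v G_anti[of "s - r" "n - 1"] by (auto simp: cyc_def)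
      \<comment> \<open>Both sources of boundaries fit into one space: \<open>v\<close> starts one
        level higher than \<open>w\<close> and may be regarded as starting at level
        \<open>s - r\<close>.\<close>
      then have u: "v \<oplus>\<^bsub>M\<^esub> w \<in> cyc r (s - r) (n - 1)" using w(1) by (rule cyc'(3))
      have x_eq: "x = y \<oplus>\<^bsub>M\<^esub> d (v \<oplus>\<^bsub>M\<^esub> w)"
        using module_minus_add(1)[OF M xM d'(1)[OF wM]] xy d'(1,2) yM vM wM by (simp add: M.a_assoc)
      have "d x = d y"
        using x_eq d'(2)[OF yM d'(1)[OF cyc_carrier[OF u]]] d_d[OF cyc_carrier[OF u]] d'(1) yM by simp
      \<comment> \<open>Since \<open>d y = d x\<close> lies in level \<open>s + r + 1\<close>, the
        bound for \<open>y\<close> improves by one.\<close>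
      then have "y \<in> cyc r (s + 1) n" using x y by (simp add: cyc_def algebra_simps)
      then have 1: "y \<in> bnd (r + 1) s n" by (intro cyc_bndI) simp
      have 2: "d (v \<oplus>\<^bsub>M\<^esub> w) \<in> bnd (r + 1) s n" using u by (intro d_bndI) simp
      show "x \<in> bnd (r + 1) s n" unfolding x_eq using 1 2 by (rule bnd'(3))
    next
      assume "x \<in> bnd (r + 1) s n"
      then obtain y w where y: "y \<in> cyc r (s + 1) n" and w: "w \<in> cyc r (s - r) (n - 1)"
          and x_eq: "x = y \<oplus>\<^bsub>M\<^esub> d w"
        by (rule bndE) simp
      note yM = cyc_carrier[OF y] and wM = cyc_carrier[OF w]
      have "y \<in> cyc (r - 1) (s + 1) n"
        using y G_anti_le[of "s + r" "s + 1 + r" "d y" "n + 1"] by (simp add: cyc_def algebra_simps)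
      then have "x \<ominus>\<^bsub>M\<^esub> d w \<in> bnd r s n"
        using cyc_bndI x_eq module_minus_add(2)[OF M yM d'(1)[OF wM]] by simp
      then have "bnd r s n +>\<^bsub>M\<^esub> x = bnd r s n +>\<^bsub>M\<^esub> d w" using coset_eq[OF xM d'(1)[OF wM]] by simp
      then have "bnd r s n +>\<^bsub>M\<^esub> x = page_diff r (s - r) (n - 1) (bnd r (s - r) (n - 1) +>\<^bsub>M\<^esub> w)"
        using page_diff_coset[OF w] by simp
      then show "bnd r s n +>\<^bsub>M\<^esub> x \<in> I" using w by (auto simp: I_def carrier_page)
    qed
    finally show "h x = \<zero>\<^bsub>quotient_module (?E\<lparr>carrier := K\<rparr>) I\<^esub> \<longleftrightarrow> x \<in> bnd (r + 1) s n" .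
  qed
  then show ?thesis by (simp add: page_def[of "r + 1"] homology_def K_def I_def)
qed

section \<open>The spectral sequence and its convergence\<close>

definition ss_page :: "nat \<Rightarrow> int \<Rightarrow> int \<Rightarrow> ('r, 'a set) module" where
  "ss_page r s t = page (int r) s (s + t)"

definition ss_diff :: "nat \<Rightarrow> int \<Rightarrow> int \<Rightarrow> 'a set \<Rightarrow> 'a set" where
  "ss_diff r s t = page_diff (int r) s (s + t)"

lemma spectral_sequence_ss: "spectral_sequence R ss_page ss_diff"
  unfolding spectral_sequence_def
proof (intro allI impI conjI ballI)
  fix r :: nat and s t :: int
  have n: "s + int r + (t - int r + 1) = s + t + 1" "s + 2 * int r + (t - 2 * int r + 2) = s + t + 2"
    "s - int r + (t + int r - 1) = s + t - 1" by simp_all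
  show "module R (ss_page r s t)" by (simp add: ss_page_def module_page)
  show "ss_diff r s t \<in> module_hom R (ss_page r s t) (ss_page r (s + int r) (t - int r + 1))"
    unfolding ss_page_def ss_diff_def n by (rule page_diff_hom)
  show "ss_diff r (s + int r) (t - int r + 1) (ss_diff r s t x) = \<zero>\<^bsub>ss_page r (s + 2 * int r) (t - 2 * int r + 2)\<^esub>"
    if "x \<in> carrier (ss_page r s t)" for x
    using that unfolding ss_page_def ss_diff_def n by (rule page_diff_page_diff)
  show "module_iso R (ss_page (r + 1) s t)
     (homology (ss_page r (s - int r) (t + int r - 1)) (ss_diff r (s - int r) (t + int r - 1)) (ss_page r s t)
       (ss_diff r s t) (ss_page r (s + int r) (t - int r + 1)))"
    unfolding ss_page_def ss_diff_def n using module_iso_next_page[of "int r" s "s + t"]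
    by (simp add: add.commute)
qed

lemma carrier_page_trivial:
  assumes "cyc r s n \<subseteq> bnd r s n"
  shows "carrier (page r s n) = {\<zero>\<^bsub>page r s n\<^esub>}"
proof -
  have "bnd r s n +>\<^bsub>M\<^esub> x = bnd r s n" if "x \<in> cyc r s n" for x
    using coset_zero[OF cyc_carrier[OF that]] assms that by blast
  then show ?thesis
    using cyc'(2) by (force simp: carrier_page zero_page)
qed

text \<open>For negative \<open>s\<close> the filtration does not jump between \<open>s\<close> and
  \<open>s + 1\<close>, so everything is divided out; beyond \<open>m\<close> there is nothing to
  divide.\<close>

lemma carrier_page_one_outside:
  assumes "s < 0 \<or> s > m"
  shows "carrier (page 1 s n) = {\<zero>\<^bsub>page 1 s n\<^esub>}"
proof (rule carrier_page_trivial, rule subsetI)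
  fix x assume x: "x \<in> cyc 1 s n"
  from assms show "x \<in> bnd 1 s n"
  proof
    assume "s < 0"
    then have "x \<in> cyc 0 (s + 1) n" using x G_low[of s] G_low[of "s + 1"] by (simp add: cyc_def)
    then show ?thesis by (intro cyc_bndI) simp
  next
    assume "s > m"
    then show ?thesis using x G_high bnd'(2) by (simp add: cyc_def)
  qed
qed

definition hom_page :: "int \<Rightarrow> ('r, 'a set) module" where
  "hom_page n = quotient_module (M\<lparr>carrier := {x \<in> G 0 n. d x = \<zero>\<^bsub>M\<^esub>}\<rparr>) (d ` G 0 (n - 1))"

definition hom_filt :: "int \<Rightarrow> int \<Rightarrow> 'a set set" where
  "hom_filt p n = (\<lambda>x. (d ` G 0 (n - 1)) +>\<^bsub>M\<^esub> x) ` {x \<in> G p n. d x = \<zero>\<^bsub>M\<^esub>}"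

lemma submodule_zero: "submodule {\<zero>\<^bsub>M\<^esub>} R M"
  by (rule submodule_closedI[OF M]) auto

lemma submodule_cocycles: "submodule {x \<in> G p n. d x = \<zero>\<^bsub>M\<^esub>} R M"
  using submodule_preimage[OF M M d G submodule_zero] by simp

lemma submodule_coboundaries: "submodule (d ` G 0 (n - 1)) R M"
  by (rule submodule_image[OF M M d G])

lemma G_le_0: "x \<in> G p n \<Longrightarrow> x \<in> G 0 n"
  using G_anti_le[of 0 p x n] G_low[of p n] by (cases "p \<le> 0") simp_all

lemma coboundaries_subset: "d ` G 0 (n - 1) \<subseteq> {x \<in> G 0 n. d x = \<zero>\<^bsub>M\<^esub>}"
proof safe
  fix x assume "x \<in> G 0 (n - 1)"
  then show "d x \<in> G 0 n" "d (d x) = \<zero>\<^bsub>M\<^esub>" using G_d[of x 0 "n - 1"] d_d G_carrier by auto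
qed

lemma module_cocycles: "module R (M\<lparr>carrier := {x \<in> G 0 n. d x = \<zero>\<^bsub>M\<^esub>}\<rparr>)"
  by (rule module_carrier_update[OF M submodule_cocycles])

lemma submodule_coboundaries_cocycles:
  "submodule (d ` G 0 (n - 1)) R (M\<lparr>carrier := {x \<in> G 0 n. d x = \<zero>\<^bsub>M\<^esub>}\<rparr>)"
  by (rule submodule_carrier_update[OF M submodule_cocycles submodule_coboundaries coboundaries_subset])

lemma module_hom_page: "module R (hom_page n)"
  unfolding hom_page_def by (rule module_quotient_module[OF module_cocycles submodule_coboundaries_cocycles])

lemma hom_page_map: "(\<lambda>x. (d ` G 0 (n - 1)) +>\<^bsub>M\<^esub> x)
    \<in> module_hom R (M\<lparr>carrier := {x \<in> G 0 n. d x = \<zero>\<^bsub>M\<^esub>}\<rparr>) (hom_page n)"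
  unfolding hom_page_def
  using quotient_map_hom[OF module_cocycles submodule_coboundaries_cocycles, of n] by simp

lemma submodule_hom_filt: "submodule (hom_filt p n) R (hom_page n)"
  unfolding hom_filt_def
proof (rule submodule_image[OF module_cocycles module_hom_page hom_page_map])
  show "submodule {x \<in> G p n. d x = \<zero>\<^bsub>M\<^esub>} R (M\<lparr>carrier := {x \<in> G 0 n. d x = \<zero>\<^bsub>M\<^esub>}\<rparr>)"
    using G_le_0 by (intro submodule_carrier_update[OF M submodule_cocycles submodule_cocycles]) auto
qed

lemma hom_filt_anti: "hom_filt (p + 1) n \<subseteq> hom_filt p n"
  unfolding hom_filt_def using G_anti by (intro image_mono) auto

lemma page_stable:
  assumes r: "s + r > m" "s - r < 0"
  shows "module_iso R (page r s n)
    (quotient_module ((hom_page n)\<lparr>carrier := hom_filt s n\<rparr>) (hom_filt (s + 1) n))"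
proof -
  let ?H = "hom_page n" and ?B = "d ` G 0 (n - 1)"
  have cyc: "cyc r s n = {x \<in> G s n. d x = \<zero>\<^bsub>M\<^esub>}" using G_high[OF r(1)] by (simp add: cyc_def)
  have low: "G (s - r + 1) (n - 1) = G 0 (n - 1)" using r(2) by (intro G_low) simp
  have FM: "module R (?H\<lparr>carrier := hom_filt s n\<rparr>)"
    by (rule module_carrier_update[OF module_hom_page submodule_hom_filt])
  have FF: "submodule (hom_filt (s + 1) n) R (?H\<lparr>carrier := hom_filt s n\<rparr>)"
    by (rule submodule_carrier_update[OF module_hom_page submodule_hom_filt submodule_hom_filt hom_filt_anti])
  define h where "h = (\<lambda>x. hom_filt (s + 1) n +>\<^bsub>?H\<^esub> (?B +>\<^bsub>M\<^esub> x))"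
  have h1: "(\<lambda>x. ?B +>\<^bsub>M\<^esub> x) \<in> module_hom R (M\<lparr>carrier := cyc r s n\<rparr>) (?H\<lparr>carrier := hom_filt s n\<rparr>)"
    using module_hom_restrict[OF hom_page_map, of "cyc r s n" n "hom_filt s n"] G_le_0
    by (auto simp: cyc hom_filt_def)
  have h: "h \<in> module_hom R (M\<lparr>carrier := cyc r s n\<rparr>)
      (quotient_module (?H\<lparr>carrier := hom_filt s n\<rparr>) (hom_filt (s + 1) n))"
    unfolding h_def using module_hom_comp[OF h1 quotient_map_hom[OF FM FF]] by simp
  show ?thesis
    unfolding page_def
  proof (rule module_iso_quotient_module[OF module_cyc submodule_bnd_cyc module_quotient_module[OF FM FF] h])
    fix Y assume "Y \<in> carrier (quotient_module (?H\<lparr>carrier := hom_filt s n\<rparr>) (hom_filt (s + 1) n))"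
    then show "\<exists>x\<in>carrier (M\<lparr>carrier := cyc r s n\<rparr>). h x = Y"
      using carrier_quotient_module[OF FM FF] by (auto simp: hom_filt_def[of s] h_def cyc)
  next
    fix x assume "x \<in> carrier (M\<lparr>carrier := cyc r s n\<rparr>)"
    then have x: "x \<in> cyc r s n" by simp
    note xM = cyc_carrier[OF x]
    have "?B +>\<^bsub>M\<^esub> x \<in> hom_filt s n" using x by (auto simp: hom_filt_def cyc)
    then have "h x = \<zero>\<^bsub>quotient_module (?H\<lparr>carrier := hom_filt s n\<rparr>) (hom_filt (s + 1) n)\<^esub>
        \<longleftrightarrow> ?B +>\<^bsub>M\<^esub> x \<in> hom_filt (s + 1) n"
      unfolding zero_quotient_module[OF FM FF] h_def
      using coset_eq_zero_iff[OF FM FF, of "?B +>\<^bsub>M\<^esub> x"] by simp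
    also have "\<dots> \<longleftrightarrow> x \<in> bnd r s n"
    proof
      assume "?B +>\<^bsub>M\<^esub> x \<in> hom_filt (s + 1) n"
      then obtain y where y: "y \<in> G (s + 1) n" "d y = \<zero>\<^bsub>M\<^esub>" "?B +>\<^bsub>M\<^esub> x = ?B +>\<^bsub>M\<^esub> y"
        by (auto simp: hom_filt_def)
      note yM = G_carrier[OF y(1)]
      have "x \<ominus>\<^bsub>M\<^esub> y \<in> ?B" using coset_eq_iff[OF M submodule_coboundaries xM yM] y(3) by simp
      then obtain w where w: "w \<in> G 0 (n - 1)" "x \<ominus>\<^bsub>M\<^esub> y = d w" by auto
      have x_eq: "x = d w \<oplus>\<^bsub>M\<^esub> y" using module_minus_add(1)[OF M xM yM] w(2) by simp
      have "x \<ominus>\<^bsub>M\<^esub> y \<in> G s n"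
        using x y(1) G_anti by (intro G'(5)) (auto simp: cyc)
      \<comment> \<open>The levels match: \<open>s - r + 1 + (r - 1) = s\<close>, and
        \<open>d w\<close> is the difference of two elements of level \<open>s\<close>.\<close>
      then have "w \<in> cyc (r - 1) (s - r + 1) (n - 1)" using w low by (simp add: cyc_def)
      then have 1: "d w \<in> bnd r s n" by (rule d_bndI)
      have 2: "y \<in> bnd r s n" using y G'(2) by (intro cyc_bndI) (simp add: cyc_def)
      show "x \<in> bnd r s n" unfolding x_eq using 1 2 by (rule bnd'(3))
    next
      assume "x \<in> bnd r s n"
      then obtain y w where y: "y \<in> cyc (r - 1) (s + 1) n" and w: "w \<in> cyc (r - 1) (s - r + 1) (n - 1)"
          and x_eq: "x = y \<oplus>\<^bsub>M\<^esub> d w"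
        by (rule bndE)
      note yM = cyc_carrier[OF y] and wM = cyc_carrier[OF w]
      have y0: "y \<in> G (s + 1) n" "d y = \<zero>\<^bsub>M\<^esub>" using y G_high[OF r(1)] by (simp_all add: cyc_def)
      have "x \<ominus>\<^bsub>M\<^esub> y = d w"
        using x_eq module_minus_add(2)[OF M d'(1)[OF wM] yM] d'(1)[OF wM] yM by (simp add: M.a_comm)
      moreover have "w \<in> G 0 (n - 1)" using w low by (simp add: cyc_def)
      ultimately have "?B +>\<^bsub>M\<^esub> x = ?B +>\<^bsub>M\<^esub> y"
        using coset_eq_iff[OF M submodule_coboundaries xM yM] by simp
      then show "?B +>\<^bsub>M\<^esub> x \<in> hom_filt (s + 1) n" using y0 by (auto simp: hom_filt_def)
    qed
    finally show "h x = \<zero>\<^bsub>quotient_module (?H\<lparr>carrier := hom_filt s n\<rparr>) (hom_filt (s + 1) n)\<^esub>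
        \<longleftrightarrow> x \<in> bnd r s n" .
  qed
qed

lemma page_diff_zero_out:
  assumes "s + r > m" "X \<in> carrier (page r s n)"
  shows "page_diff r s n X = \<zero>\<^bsub>page r (s + r) (n + 1)\<^esub>"
proof -
  obtain x where x: "x \<in> cyc r s n" "X = bnd r s n +>\<^bsub>M\<^esub> x" using assms(2) by (auto simp: carrier_page)
  have "d x = \<zero>\<^bsub>M\<^esub>" using x(1) G_high[OF assms(1)] by (simp add: cyc_def)
  then show ?thesis using x coset_zero[of "\<zero>\<^bsub>M\<^esub>"] bnd'(2) by (simp add: page_diff_coset zero_page)
qed

text \<open>In a negative column a representative may be moved one level up without change, so its
  differential is among the boundaries divided out at the target.\<close>

lemma page_diff_zero_in:
  assumes "s < 0" "X \<in> carrier (page r s n)"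
  shows "page_diff r s n X = \<zero>\<^bsub>page r (s + r) (n + 1)\<^esub>"
proof -
  obtain x where x: "x \<in> cyc r s n" "X = bnd r s n +>\<^bsub>M\<^esub> x" using assms(2) by (auto simp: carrier_page)
  have "x \<in> cyc (r - 1) (s + 1) n"
    using x(1) G_low[of s] G_low[of "s + 1"] assms(1) by (simp add: cyc_def)
  then have "d x \<in> bnd r (s + r) (n + 1)" by (intro d_bndI) simp
  then show ?thesis using x coset_zero[OF d'(1)[OF cyc_carrier[OF x(1)]]]
    by (simp add: page_diff_coset zero_page)
qed

lemma converges_to_hom_page: "converges_to R ss_page ss_diff hom_page"
  unfolding converges_to_def
proof (intro conjI allI exI[of _ hom_filt])
  show "module R (hom_page n)" for n by (rule module_hom_page)
  show "submodule (hom_filt p n) R (hom_page n)" "hom_filt (p + 1) n \<subseteq> hom_filt p n" for p n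
    by (rule submodule_hom_filt hom_filt_anti)+
  show "\<exists>p q. hom_filt p n = carrier (hom_page n) \<and> hom_filt q n = {\<zero>\<^bsub>hom_page n\<^esub>}" for n
  proof (intro exI conjI)
    show "hom_filt 0 n = carrier (hom_page n)"
      unfolding hom_page_def hom_filt_def
      using carrier_quotient_module[OF module_cocycles submodule_coboundaries_cocycles, of n] by simp
    have "{x \<in> G (m + 1) n. d x = \<zero>\<^bsub>M\<^esub>} = {\<zero>\<^bsub>M\<^esub>}"
      using G_high[of "m + 1" n] d_zero_minus(1) by auto
    then show "hom_filt (m + 1) n = {\<zero>\<^bsub>hom_page n\<^esub>}"
      unfolding hom_page_def hom_filt_def zero_quotient_module[OF module_cocycles submodule_coboundaries_cocycles]
      using coset_eq_zero_iff[OF M submodule_coboundaries, of "\<zero>\<^bsub>M\<^esub>" n] submoduleD(2)[OF M submodule_coboundaries]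
      by simp
  qed
  fix s t :: int
  show "\<exists>r\<^sub>0\<ge>1. \<forall>r\<ge>r\<^sub>0.
      (\<forall>x\<in>carrier (ss_page r s t). ss_diff r s t x = \<zero>\<^bsub>ss_page r (s + int r) (t - int r + 1)\<^esub>) \<and>
      (\<forall>x\<in>carrier (ss_page r (s - int r) (t + int r - 1)).
         ss_diff r (s - int r) (t + int r - 1) x = \<zero>\<^bsub>ss_page r s t\<^esub>) \<and>
      module_iso R (ss_page r s t)
        (quotient_module ((hom_page (s + t))\<lparr>carrier := hom_filt s (s + t)\<rparr>) (hom_filt (s + 1) (s + t)))"
  \<comment> \<open>This bound pushes both \<open>s + r\<close> above \<open>m\<close> and
    \<open>s - r\<close> below 0, whatever the sign of \<open>s\<close>.\<close>
  proof (intro exI[of _ "nat (\<bar>s\<bar> + \<bar>m\<bar> + 1)"] conjI allI impI ballI)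
    show "nat (\<bar>s\<bar> + \<bar>m\<bar> + 1) \<ge> 1" by simp
    fix r assume "nat (\<bar>s\<bar> + \<bar>m\<bar> + 1) \<le> r"
    then have r: "s + int r > m" "s - int r < 0" by linarith+
    have n: "s + int r + (t - int r + 1) = s + t + 1" "s - int r + (t + int r - 1) = s + t - 1" by simp_all
    show "ss_diff r s t x = \<zero>\<^bsub>ss_page r (s + int r) (t - int r + 1)\<^esub>" if "x \<in> carrier (ss_page r s t)" for x
      using page_diff_zero_out[OF r(1)] that unfolding ss_page_def ss_diff_def n by simp
    show "ss_diff r (s - int r) (t + int r - 1) x = \<zero>\<^bsub>ss_page r s t\<^esub>"
      if "x \<in> carrier (ss_page r (s - int r) (t + int r - 1))" for x
      using page_diff_zero_in[OF r(2), of x "int r" "s + t - 1"] that unfolding ss_page_def ss_diff_def n by simp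
    show "module_iso R (ss_page r s t)
        (quotient_module ((hom_page (s + t))\<lparr>carrier := hom_filt s (s + t)\<rparr>) (hom_filt (s + 1) (s + t)))"
      unfolding ss_page_def by (rule page_stable[OF r])
  qed
qed

text \<open>The first page is the homology of a graded piece. The piece is given by a surjection
  \<open>\<pi>\<close> with kernel the next level instead of as a quotient, so that a concrete
  complex such as that of a resolved diagram can take its place.\<close>

lemma module_iso_page_one:
  fixes M' :: "('r, 'c) module" and C :: "int \<Rightarrow> 'c set"
  assumes M': "module R M'" and d1: "d1 \<in> module_hom R M' M'" and C: "\<And>n. submodule (C n) R M'"
    and \<pi>: "\<pi> \<in> module_hom R M M'"
    and img: "\<And>n. \<pi> ` G s n = C n"
    and ker: "\<And>n x. x \<in> G s n \<Longrightarrow> \<pi> x = \<zero>\<^bsub>M'\<^esub> \<longleftrightarrow> x \<in> G (s + 1) n"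
    and comm: "\<And>n x. x \<in> G s n \<Longrightarrow> \<pi> (d x) = d1 (\<pi> x)"
  shows "module_iso R (page 1 s n) (quotient_module (M'\<lparr>carrier := {y \<in> C n. d1 y = \<zero>\<^bsub>M'\<^esub>}\<rparr>) (d1 ` C (n - 1)))"
proof -
  interpret M': module R M' by (rule M')
  let ?K = "{y \<in> C n. d1 y = \<zero>\<^bsub>M'\<^esub>}" and ?I = "d1 ` C (n - 1)"
  note \<pi>' = module_homD[OF \<pi>] and \<pi>0 = module_hom_zero_minus[OF M M' \<pi>]
  have zero: "submodule {\<zero>\<^bsub>M'\<^esub>} R M'" by (rule submodule_closedI[OF M']) auto
  have K: "submodule ?K R M'" using submodule_preimage[OF M' M' d1 C zero] by simp
  have I: "submodule ?I R M'" by (rule submodule_image[OF M' M' d1 C])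
  \<comment> \<open>\<open>d1\<close> squares to zero on the pieces \<open>C n\<close> because
    \<open>d\<close> does and \<open>\<pi>\<close> maps onto them.\<close>
  have IK: "?I \<subseteq> ?K"
  proof
    fix y assume "y \<in> ?I"
    then obtain w where w: "w \<in> G s (n - 1)" "y = d1 (\<pi> w)" using img[of "n - 1"] by (metis imageE)
    have dw: "d w \<in> G s n" using G_d[OF w(1)] by simp
    have "y = \<pi> (d w)" using comm[OF w(1)] w(2) by simp
    moreover have "d1 (\<pi> (d w)) = \<pi> (d (d w))" using comm[OF dw] by simp
    moreover have "d (d w) = \<zero>\<^bsub>M\<^esub>" using d_d G_carrier[OF w(1)] by simp
    ultimately show "y \<in> ?K" using dw img[of n] \<pi>0(1) by auto
  qed
  have KM: "module R (M'\<lparr>carrier := ?K\<rparr>)" by (rule module_carrier_update[OF M' K])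
  have IKs: "submodule ?I R (M'\<lparr>carrier := ?K\<rparr>)" by (rule submodule_carrier_update[OF M' K I IK])
  have \<pi>K: "\<pi> x \<in> ?K" if "x \<in> cyc 1 s n" for x
  proof -
    have x: "x \<in> G s n" "d x \<in> G (s + 1) (n + 1)" using that by (simp_all add: cyc_def)
    have "d1 (\<pi> x) = \<zero>\<^bsub>M'\<^esub>" using comm[OF x(1)] ker[OF G_d[OF x(1)]] x(2) by simp
    then show ?thesis using x(1) img[of n] by auto
  qed
  define h where "h = (\<lambda>x. ?I +>\<^bsub>M'\<^esub> \<pi> x)"
  have h1: "\<pi> \<in> module_hom R (M\<lparr>carrier := cyc 1 s n\<rparr>) (M'\<lparr>carrier := ?K\<rparr>)"
    by (rule module_hom_restrict[OF \<pi>]) (use \<pi>K cyc'(1) in auto)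
  have h: "h \<in> module_hom R (M\<lparr>carrier := cyc 1 s n\<rparr>) (quotient_module (M'\<lparr>carrier := ?K\<rparr>) ?I)"
    unfolding h_def using module_hom_comp[OF h1 quotient_map_hom[OF KM IKs]] by simp
  show ?thesis
    unfolding page_def
  proof (rule module_iso_quotient_module[OF module_cyc submodule_bnd_cyc module_quotient_module[OF KM IKs] h])
    fix Y assume "Y \<in> carrier (quotient_module (M'\<lparr>carrier := ?K\<rparr>) ?I)"
    then obtain y where y: "y \<in> C n" "d1 y = \<zero>\<^bsub>M'\<^esub>" "Y = ?I +>\<^bsub>M'\<^esub> y"
      using carrier_quotient_module[OF KM IKs] by auto
    then obtain x where x: "x \<in> G s n" "y = \<pi> x" using img[of n] by (metis imageE)
    have "d x \<in> G (s + 1) (n + 1)" using ker[OF G_d[OF x(1)]] comm[OF x(1)] y(2) x(2) by simp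
    then have "x \<in> cyc 1 s n" using x(1) by (simp add: cyc_def)
    then show "\<exists>x\<in>carrier (M\<lparr>carrier := cyc 1 s n\<rparr>). h x = Y" using x(2) y(3) by (auto simp: h_def)
  next
    fix x assume "x \<in> carrier (M\<lparr>carrier := cyc 1 s n\<rparr>)"
    then have x: "x \<in> cyc 1 s n" by simp
    note xM = cyc_carrier[OF x]
    have xG: "x \<in> G s n" using x by (simp add: cyc_def)
    have "h x = \<zero>\<^bsub>quotient_module (M'\<lparr>carrier := ?K\<rparr>) ?I\<^esub> \<longleftrightarrow> \<pi> x \<in> ?I"
      unfolding zero_quotient_module[OF KM IKs] h_def
      using coset_eq_zero_iff[OF KM IKs, of "\<pi> x"] \<pi>K[OF x] by simp
    also have "\<dots> \<longleftrightarrow> x \<in> bnd 1 s n"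
    proof
      assume "\<pi> x \<in> ?I"
      then obtain w where w: "w \<in> G s (n - 1)" "\<pi> x = d1 (\<pi> w)" using img[of "n - 1"] by (metis imageE)
      have dw: "d w \<in> G s n" using G_d[OF w(1)] by simp
      note dwM = G_carrier[OF dw]
      have "\<pi> (x \<ominus>\<^bsub>M\<^esub> d w) = \<zero>\<^bsub>M'\<^esub>"
        using \<pi>0(2)[OF xM dwM] comm[OF w(1)] w(2) \<pi>'(1)[OF xM] by (simp add: M'.minus_eq M'.M.r_neg)
      then have *: "x \<ominus>\<^bsub>M\<^esub> d w \<in> G (s + 1) n" using ker G'(5)[OF xG dw] by simp
      then have 1: "x \<ominus>\<^bsub>M\<^esub> d w \<in> bnd 1 s n" using G_d[OF *] by (intro cyc_bndI) (simp add: cyc_def)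
      have 2: "d w \<in> bnd 1 s n" using w(1) dw by (intro d_bndI) (simp add: cyc_def)
      show "x \<in> bnd 1 s n" using bnd'(3)[OF 1 2] module_minus_add(1)[OF M xM dwM] by simp
    next
      assume "x \<in> bnd 1 s n"
      then obtain y w where yw: "y \<in> cyc (1 - 1) (s + 1) n" "w \<in> cyc (1 - 1) (s - 1 + 1) (n - 1)"
          and x_eq: "x = y \<oplus>\<^bsub>M\<^esub> d w"
        by (rule bndE)
      have y: "y \<in> G (s + 1) n" and w: "w \<in> G s (n - 1)" using yw by (simp_all add: cyc_def)
      have yG: "y \<in> G s n" using y G_anti by blast
      have dw: "d1 (\<pi> w) \<in> carrier M'"
        using module_homD(1)[OF d1 \<pi>'(1)[OF G_carrier[OF w]]] .
      have "\<pi> x = d1 (\<pi> w)"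
        using dw x_eq \<pi>'(1,2) G_carrier[OF y] d'(1)[OF G_carrier[OF w]] ker[OF yG] y comm[OF w] by simp
      then show "\<pi> x \<in> ?I" using w img[of "n - 1"] by auto
    qed
    finally show "h x = \<zero>\<^bsub>quotient_module (M'\<lparr>carrier := ?K\<rparr>) ?I\<^esub> \<longleftrightarrow> x \<in> bnd 1 s n" .
  qed
qed

end

section \<open>Faces of the cube as complexes of resolutions\<close>

declare split_paired_All [simp del]

text \<open>An ambient module of all functions, with no condition on their supports. It is shared by
  all diagrams, so the complexes of \<open>D\<close> and of its resolutions live in the same
  type.\<close>

definition chain_module :: "('r, 'b) ring_scheme \<Rightarrow> ('r, kgen \<Rightarrow> 'r) module" where
  "chain_module R = free_module R UNIV"

definition supported :: "('r, 'b) ring_scheme \<Rightarrow> kgen set \<Rightarrow> (kgen \<Rightarrow> 'r) set" where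
  "supported R P = carrier (free_module R P)"

definition kbasis :: "diagram \<Rightarrow> int \<Rightarrow> int \<Rightarrow> kgen set" where
  "kbasis D i j = {g \<in> kgens D. int (card (fst g)) = i \<and> kgen_deg D g = j}"

lemma module_chain_module: "cring R \<Longrightarrow> module R (chain_module R)"
  unfolding chain_module_def by (rule module_free_module)

lemma chain_module_simps:
  "c \<in> carrier (chain_module R) \<longleftrightarrow> (\<forall>x. c x \<in> carrier R)"
  "\<zero>\<^bsub>chain_module R\<^esub> = (\<lambda>_. \<zero>\<^bsub>R\<^esub>)"
  "c \<oplus>\<^bsub>chain_module R\<^esub> c' = (\<lambda>x. c x \<oplus>\<^bsub>R\<^esub> c' x)"
  "r \<odot>\<^bsub>chain_module R\<^esub> c = (\<lambda>x. r \<otimes>\<^bsub>R\<^esub> c x)"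
  by (simp_all add: chain_module_def free_module_def)

lemma supported_iff:
  assumes "cring R"
  shows "c \<in> supported R P \<longleftrightarrow> (\<forall>x. c x \<in> carrier R) \<and> (\<forall>x. x \<notin> P \<longrightarrow> c x = \<zero>\<^bsub>R\<^esub>)"
proof -
  interpret cring R by (rule assms)
  show ?thesis unfolding supported_def free_module_def by (simp, metis zero_closed)
qed

lemma submodule_supported:
  assumes R: "cring R"
  shows "submodule (supported R P) R (chain_module R)"
proof -
  interpret cring R by (rule R)
  show ?thesis
    by (rule submodule_closedI[OF module_chain_module[OF R]])
      (auto simp: supported_iff[OF R] chain_module_simps)
qed

lemma supported_mono: "cring R \<Longrightarrow> P \<subseteq> Q \<Longrightarrow> supported R P \<subseteq> supported R Q"
  unfolding subset_iff by (simp add: supported_iff) blast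

lemma kdiff_module_hom:
  assumes R: "cring R" and D: "link_diagram D"
  shows "kdiff R D \<in> module_hom R (chain_module R) (chain_module R)"
  by (rule module_homI)
    (simp_all add: chain_module_simps kdiff_closed[OF R D] kdiff_add[OF R D] kdiff_smult[OF R D])

lemma kdiff_supported:
  assumes R: "cring R" and D: "link_diagram D" and c: "c \<in> supported R P"
    and PQ: "\<And>x y. x \<in> P \<Longrightarrow> x \<in> kgens D \<Longrightarrow> y \<in> kgens D \<Longrightarrow> diff_coeff R D x y \<noteq> \<zero>\<^bsub>R\<^esub> \<Longrightarrow> y \<in> Q"
  shows "kdiff R D c \<in> supported R Q"
proof -
  interpret cring R by (rule R)
  have c': "c x \<in> carrier R" "x \<notin> P \<Longrightarrow> c x = \<zero>\<^bsub>R\<^esub>" for x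
    using c by (simp_all add: supported_iff[OF R])
  have "kdiff R D c y = \<zero>\<^bsub>R\<^esub>" if y: "y \<notin> Q" for y
  proof (cases "y \<in> kgens D")
    case True
    have "diff_coeff R D x y \<otimes>\<^bsub>R\<^esub> c x = \<zero>\<^bsub>R\<^esub>" if "x \<in> kgens D" for x
    proof (cases "x \<in> P")
      case True
      then have "diff_coeff R D x y = \<zero>\<^bsub>R\<^esub>" using PQ[OF _ that \<open>y \<in> kgens D\<close>] y by blast
      then show ?thesis using c'(1) by simp
    next
      case False
      then show ?thesis using c'(2) diff_coeff_closed[OF R D, of x y] by simp
    qed
    then have "(\<Oplus>\<^bsub>R\<^esub>x\<in>kgens D. diff_coeff R D x y \<otimes>\<^bsub>R\<^esub> c x) = (\<Oplus>\<^bsub>R\<^esub>x\<in>kgens D. \<zero>\<^bsub>R\<^esub>)"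
      by (intro finsum_cong') simp_all
    then show ?thesis using True by (simp add: kdiff_def finsum_zero)
  qed (simp add: kdiff_def)
  then show ?thesis using kdiff_closed[OF R D c'(1)] by (simp add: supported_iff[OF R])
qed

lemma diff_coeff_kbasis:
  assumes R: "cring R" and D: "link_diagram D" and x: "x \<in> kbasis D i j" and y: "y \<in> kgens D"
    and nz: "diff_coeff R D x y \<noteq> \<zero>\<^bsub>R\<^esub>"
  shows "y \<in> kbasis D (i + 1) j" "fst x \<subseteq> fst y"
proof -
  obtain S \<epsilon> T \<epsilon>' where xy: "x = (S, \<epsilon>)" "y = (T, \<epsilon>')" by fastforce
  obtain v where v: "v \<in> crossings D" "v \<notin> S" "T = insert v S"
      "saddle (circles D S) (circles D (insert v S)) \<epsilon> \<epsilon>'"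
    using nz unfolding xy by (rule diff_coeff_nonzeroE[OF R D])
  have "S \<subseteq> crossings D" using x by (simp add: xy kbasis_def kgens_iff)
  then have fin: "finite S" using finite_crossings[OF D] by (rule finite_subset)
  show "fst x \<subseteq> fst y" using v by (auto simp: xy)
  show "y \<in> kbasis D (i + 1) j"
    using x y kgen_deg_saddle[OF D v(1,2) fin v(4)] v fin by (auto simp: xy kbasis_def)
qed

lemma kchains_eq:
  "kchains R D \<omega> i j = (chain_module R)\<lparr>carrier :=
     supported R (kbasis D (i + n_neg D \<omega>) (j - n_pos D \<omega> + 2 * n_neg D \<omega>))\<rparr>"
  by (simp add: kchains_def unnormalised_kchains_def kbasis_def supported_def chain_module_def
      free_module_def algebra_simps)

lemma KH_eq:
  "KH R D \<omega> i j = quotient_module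
     ((chain_module R)\<lparr>carrier := {x \<in> supported R (kbasis D (i + n_neg D \<omega>) (j - n_pos D \<omega> + 2 * n_neg D \<omega>)).
        kdiff R D x = \<zero>\<^bsub>chain_module R\<^esub>}\<rparr>)
     (kdiff R D ` supported R (kbasis D (i - 1 + n_neg D \<omega>) (j - n_pos D \<omega> + 2 * n_neg D \<omega>)))"
  by (simp add: KH_def homology_def kchains_eq)

text \<open>
  The diagram \<open>D'\<close> arises from \<open>D\<close> by 1-smoothing \<open>T\<close> and 0-smoothing \<open>U\<close>. Its cube is the face
  of the cube of \<open>D\<close> on the states that contain \<open>T\<close> and avoid \<open>U\<close>; the edge signs of the two
  cubes differ by the coboundary of \<open>face_sign\<close>.
\<close>

locale resolution =
  fixes R :: "('r, 'b) ring_scheme" and D D' :: diagram and T U :: "nat set"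
  assumes R: "cring R" and D: "link_diagram D"
    and T: "T \<subseteq> crossings D" and U: "U \<subseteq> crossings D" and TU: "T \<inter> U = {}"
    and D': "vertices D' = vertices D" "glue D' = glue D"
      "resolved D' = (\<lambda>w. if w \<in> T then Some True else if w \<in> U then Some False else resolved D w)"
begin

interpretation cring R by (rule R)

lemma crossings_D': "crossings D' = crossings D - T - U"
  using T U by (auto simp: crossings_def D' split: if_splits)

lemma ends_D': "ends D' = ends D"
  by (simp add: ends_def D')

text \<open>Vertices and gluing determine planarity, and resolving leaves both alone.\<close>

lemma link_diagram_D': "link_diagram D'"
proof -
  have "planar D' \<longleftrightarrow> planar D"
    by (simp add: planar_def arcs_def faces_def components_def ends_D' D')
  then show ?thesis using D by (simp add: link_diagram_def ends_D' D')
qed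

lemma finite_T: "finite T"
  using T finite_crossings[OF D] by (rule finite_subset)

lemma circles_D':
  assumes "S \<subseteq> crossings D'"
  shows "circles D' S = circles D (S \<union> T)"
proof -
  have "state_end D' S e = state_end D (S \<union> T) e" for e
  proof -
    have "resolved D w = None" if "w \<in> T \<or> w \<in> U" for w using that T U by (auto simp: crossings_def)
    moreover have "w \<notin> S" if "w \<in> T \<or> w \<in> U" for w using that assms by (auto simp: crossings_D')
    ultimately show ?thesis using TU by (auto simp: state_end_def D' split: option.split)
  qed
  then show ?thesis by (simp add: circles_def state_rel_def ends_D' D')
qed

text \<open>The labelling is carried over verbatim: corresponding states have the same sets of ends
  as circles.\<close>

definition face_emb :: "kgen \<Rightarrow> kgen" where
  "face_emb = (\<lambda>(S, \<epsilon>). (S \<union> T, \<epsilon>))"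

text \<open>The exponent counts pairs \<open>t < w\<close> with \<open>t\<close> in \<open>T\<close>
  and \<open>w\<close> in \<open>S\<close>. Adding \<open>v\<close> to \<open>S\<close> increases it
  by the number of \<open>t < v\<close>, which is what \<open>T\<close> contributes to the sign of
  the edge at \<open>v\<close>.\<close>

definition face_sign :: "nat set \<Rightarrow> 'r" where
  "face_sign S = (\<ominus>\<^bsub>R\<^esub> \<one>\<^bsub>R\<^esub>) [^]\<^bsub>R\<^esub> (\<Sum>w\<in>S. card {t \<in> T. t < w})"

definition restrict_face :: "(kgen \<Rightarrow> 'r) \<Rightarrow> kgen \<Rightarrow> 'r" where
  "restrict_face x g = (if g \<in> kgens D' then face_sign (fst g) \<otimes>\<^bsub>R\<^esub> x (face_emb g) else \<zero>\<^bsub>R\<^esub>)"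

lemma minus_one_pow_square: "((\<ominus>\<^bsub>R\<^esub> \<one>\<^bsub>R\<^esub>) [^]\<^bsub>R\<^esub> (k::nat)) \<otimes>\<^bsub>R\<^esub> ((\<ominus>\<^bsub>R\<^esub> \<one>\<^bsub>R\<^esub>) [^]\<^bsub>R\<^esub> k) = \<one>\<^bsub>R\<^esub>"
proof -
  have "(\<ominus>\<^bsub>R\<^esub> \<one>\<^bsub>R\<^esub>) \<otimes>\<^bsub>R\<^esub> (\<ominus>\<^bsub>R\<^esub> \<one>\<^bsub>R\<^esub>) = \<one>\<^bsub>R\<^esub>" by (simp add: l_minus r_minus)
  then show ?thesis by (metis a_inv_closed nat_pow_distrib nat_pow_one one_closed)
qed

lemma face_sign_closed [simp]: "face_sign S \<in> carrier R"
  by (simp add: face_sign_def)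

lemma face_sign_square: "face_sign S \<otimes>\<^bsub>R\<^esub> face_sign S = \<one>\<^bsub>R\<^esub>"
  unfolding face_sign_def by (rule minus_one_pow_square)

lemma face_sign_cancel: "a \<in> carrier R \<Longrightarrow> face_sign S \<otimes>\<^bsub>R\<^esub> (face_sign S \<otimes>\<^bsub>R\<^esub> a) = a"
  by (simp add: m_assoc[symmetric] face_sign_square)

lemma kgens_D'_disjoint: "(S, \<epsilon>) \<in> kgens D' \<Longrightarrow> S \<inter> T = {} \<and> S \<inter> U = {} \<and> S \<subseteq> crossings D'"
  by (auto simp: kgens_iff crossings_D')

lemma face_emb_kgens:
  assumes "g \<in> kgens D'"
  shows "face_emb g \<in> kgens D" "T \<subseteq> fst (face_emb g)" "fst (face_emb g) \<inter> U = {}"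
    "(fst (face_emb g) - T, snd (face_emb g)) = g"
proof -
  obtain S \<epsilon> where g: "g = (S, \<epsilon>)" by fastforce
  have S: "S \<subseteq> crossings D'" "S \<inter> T = {}" "S \<inter> U = {}"
    using assms kgens_D'_disjoint[of S \<epsilon>] by (auto simp: g)
  show "face_emb g \<in> kgens D"
    using assms S(1) T circles_D'[OF S(1)] by (auto simp: g face_emb_def kgens_iff crossings_D')
  show "T \<subseteq> fst (face_emb g)" "fst (face_emb g) \<inter> U = {}" using S TU by (auto simp: g face_emb_def)
  show "(fst (face_emb g) - T, snd (face_emb g)) = g" using S by (auto simp: g face_emb_def)
qed

lemma face_emb_surj:
  assumes "g \<in> kgens D" "T \<subseteq> fst g" "fst g \<inter> U = {}"
  shows "(fst g - T, snd g) \<in> kgens D'" "face_emb (fst g - T, snd g) = g"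
proof -
  obtain S \<epsilon> where g: "g = (S, \<epsilon>)" by fastforce
  have S: "S - T \<subseteq> crossings D'" "(S - T) \<union> T = S"
    using assms by (auto simp: g kgens_iff crossings_D')
  show "(fst g - T, snd g) \<in> kgens D'"
    using assms S(1) circles_D'[OF S(1)] S(2) by (simp add: g kgens_iff)
  show "face_emb (fst g - T, snd g) = g" using S(2) by (simp add: g face_emb_def)
qed

lemma inj_on_face_emb: "inj_on face_emb (kgens D')"
  by (metis face_emb_kgens(4) inj_onI)

lemma face_emb_degrees:
  assumes "g \<in> kgens D'"
  shows "card (fst (face_emb g)) = card (fst g) + card T"
    "kgen_deg D (face_emb g) = kgen_deg D' g + int (card T)"
proof -
  obtain S \<epsilon> where g: "g = (S, \<epsilon>)" by fastforce
  have S: "S \<subseteq> crossings D'" "S \<inter> T = {}" using assms kgens_D'_disjoint[of S \<epsilon>] by (auto simp: g)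
  have "finite S" using S(1) finite_crossings[OF link_diagram_D'] by (rule finite_subset)
  then have c: "card (S \<union> T) = card S + card T" using finite_T S(2) by (rule card_Un_disjoint)
  then show "card (fst (face_emb g)) = card (fst g) + card T" by (simp add: g face_emb_def)
  show "kgen_deg D (face_emb g) = kgen_deg D' g + int (card T)"
    using circles_D'[OF S(1)] c by (simp add: g face_emb_def kgen_deg_def)
qed

lemma face_emb_kbasis:
  assumes "g \<in> kgens D'"
  shows "face_emb g \<in> kbasis D i j \<longleftrightarrow> g \<in> kbasis D' (i - int (card T)) (j - int (card T))"
  using face_emb_kgens(1)[OF assms] face_emb_degrees[OF assms] assms by (auto simp: kbasis_def)

lemma restrict_face_hom: "restrict_face \<in> module_hom R (chain_module R) (chain_module R)"
proof (rule module_homI)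
  fix x assume "x \<in> carrier (chain_module R)"
  then have x: "x g \<in> carrier R" for g by (simp add: chain_module_simps)
  show "restrict_face x \<in> carrier (chain_module R)" using x by (simp add: chain_module_simps restrict_face_def)
  show "restrict_face (r \<odot>\<^bsub>chain_module R\<^esub> x) = r \<odot>\<^bsub>chain_module R\<^esub> restrict_face x" if "r \<in> carrier R" for r
    unfolding chain_module_simps using that x by (intro ext) (simp add: restrict_face_def m_lcomm)
  fix y assume "y \<in> carrier (chain_module R)"
  then have y: "y g \<in> carrier R" for g by (simp add: chain_module_simps)
  show "restrict_face (x \<oplus>\<^bsub>chain_module R\<^esub> y) = restrict_face x \<oplus>\<^bsub>chain_module R\<^esub> restrict_face y"
    unfolding chain_module_simps using x y by (intro ext) (simp add: restrict_face_def r_distr)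
qed

text \<open>The degrees drop by the size of \<open>T\<close> because \<open>T\<close> is counted as
  1-smoothed in \<open>D\<close> but not in \<open>D'\<close>.\<close>

lemma restrict_face_image:
  "restrict_face ` supported R {g \<in> kbasis D i j. T \<subseteq> fst g} =
     supported R (kbasis D' (i - int (card T)) (j - int (card T)))"
proof (intro equalityI subsetI)
  fix y assume "y \<in> restrict_face ` supported R {g \<in> kbasis D i j. T \<subseteq> fst g}"
  then obtain x where x_supp: "x \<in> supported R {g \<in> kbasis D i j. T \<subseteq> fst g}" "y = restrict_face x" by blast
  have x: "x g \<in> carrier R" "g \<notin> kbasis D i j \<Longrightarrow> x g = \<zero>\<^bsub>R\<^esub>" "y = restrict_face x" for g
    using x_supp by (simp_all add: supported_iff[OF R])
  show "y \<in> supported R (kbasis D' (i - int (card T)) (j - int (card T)))"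
    unfolding supported_iff[OF R]
  proof (intro conjI allI impI)
    show "y g \<in> carrier R" for g using x(1) by (simp add: x(3) restrict_face_def)
    show "y g = \<zero>\<^bsub>R\<^esub>" if "g \<notin> kbasis D' (i - int (card T)) (j - int (card T))" for g
      using x(2)[of "face_emb g"] face_emb_kbasis[of g i j] that by (simp add: x(3) restrict_face_def)
  qed
next
  fix y assume y: "y \<in> supported R (kbasis D' (i - int (card T)) (j - int (card T)))"
  then have y': "y g \<in> carrier R" "g \<notin> kbasis D' (i - int (card T)) (j - int (card T)) \<Longrightarrow> y g = \<zero>\<^bsub>R\<^esub>" for g
    by (auto simp: supported_iff[OF R])
  \<comment> \<open>Extension by zero. The sign is its own inverse, so multiplying by it again
    undoes the twist.\<close>
  define x where "x = (\<lambda>g. if g \<in> kbasis D i j \<and> T \<subseteq> fst g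
    then face_sign (fst g - T) \<otimes>\<^bsub>R\<^esub> y (fst g - T, snd g) else \<zero>\<^bsub>R\<^esub>)"
  have x: "x \<in> supported R {g \<in> kbasis D i j. T \<subseteq> fst g}"
    using y'(1) by (auto simp: supported_iff[OF R] x_def)
  have "restrict_face x = y"
  proof
    fix g
    show "restrict_face x g = y g"
    proof (cases "g \<in> kgens D'")
      case True
      note e = face_emb_kgens(4)[OF True]
      have e1: "fst (face_emb g) - T = fst g" by (metis e fst_conv)
      show ?thesis
      proof (cases "face_emb g \<in> kbasis D i j")
        case T1: True
        then show ?thesis
          using True face_emb_kgens(2)[OF True] e e1 face_sign_cancel[OF y'(1)]
          by (simp add: restrict_face_def x_def)
      next
        case False
        then show ?thesis
          using True face_emb_kbasis[OF True] y'(2) by (simp add: restrict_face_def x_def)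
      qed
    next
      case False
      then have "g \<notin> kbasis D' (i - int (card T)) (j - int (card T))" by (simp add: kbasis_def)
      then show ?thesis using y'(2) False by (simp add: restrict_face_def)
    qed
  qed
  then show "y \<in> restrict_face ` supported R {g \<in> kbasis D i j. T \<subseteq> fst g}" using x by blast
qed

text \<open>The face omits exactly the states that meet \<open>U\<close>. If \<open>U\<close>
  consists of the next crossing, these form the next level of the filtration; if \<open>U\<close> is
  empty, the map is injective on the level.\<close>

lemma restrict_face_eq_zero_iff:
  assumes x: "x \<in> supported R {g \<in> kbasis D i j. T \<subseteq> fst g}"
  shows "restrict_face x = \<zero>\<^bsub>chain_module R\<^esub> \<longleftrightarrow>
    x \<in> supported R {g \<in> kbasis D i j. T \<subseteq> fst g \<and> fst g \<inter> U \<noteq> {}}"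
proof -
  have x': "x g \<in> carrier R" "g \<notin> kbasis D i j \<or> \<not> T \<subseteq> fst g \<Longrightarrow> x g = \<zero>\<^bsub>R\<^esub>" for g
    using x by (auto simp: supported_iff[OF R])
  have "restrict_face x = \<zero>\<^bsub>chain_module R\<^esub> \<longleftrightarrow> (\<forall>g\<in>kgens D'. x (face_emb g) = \<zero>\<^bsub>R\<^esub>)"
  proof
    assume z: "restrict_face x = \<zero>\<^bsub>chain_module R\<^esub>"
    show "\<forall>g\<in>kgens D'. x (face_emb g) = \<zero>\<^bsub>R\<^esub>"
    proof
      fix g assume "g \<in> kgens D'"
      then have "face_sign (fst g) \<otimes>\<^bsub>R\<^esub> x (face_emb g) = \<zero>\<^bsub>R\<^esub>"
        using fun_cong[OF z, of g] by (simp add: restrict_face_def chain_module_simps)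
      then show "x (face_emb g) = \<zero>\<^bsub>R\<^esub>"
        using face_sign_cancel[OF x'(1), of "fst g" "face_emb g"] by simp
    qed
  qed (auto simp: restrict_face_def chain_module_simps fun_eq_iff)
  also have "\<dots> \<longleftrightarrow> x \<in> supported R {g \<in> kbasis D i j. T \<subseteq> fst g \<and> fst g \<inter> U \<noteq> {}}"
  proof
    assume z: "\<forall>g\<in>kgens D'. x (face_emb g) = \<zero>\<^bsub>R\<^esub>"
    have "x g = \<zero>\<^bsub>R\<^esub>" if "g \<notin> {g \<in> kbasis D i j. T \<subseteq> fst g \<and> fst g \<inter> U \<noteq> {}}" for g
    proof (cases "g \<in> kbasis D i j \<and> T \<subseteq> fst g")
      case True
      then have "g \<in> kgens D" "T \<subseteq> fst g" "fst g \<inter> U = {}" using that by (auto simp: kbasis_def)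
      from face_emb_surj[OF this] show ?thesis using z by metis
    next
      case False
      then show ?thesis using x'(2) by blast
    qed
    then show "x \<in> supported R {g \<in> kbasis D i j. T \<subseteq> fst g \<and> fst g \<inter> U \<noteq> {}}"
      using x'(1) by (simp add: supported_iff[OF R])
  next
    assume "x \<in> supported R {g \<in> kbasis D i j. T \<subseteq> fst g \<and> fst g \<inter> U \<noteq> {}}"
    then show "\<forall>g\<in>kgens D'. x (face_emb g) = \<zero>\<^bsub>R\<^esub>"
      using face_emb_kgens(3) by (auto simp: supported_iff[OF R])
  qed
  finally show ?thesis .
qed

text \<open>The elements of \<open>T\<close> below \<open>v\<close> enter once through
  \<open>face_sign\<close> and once through the edge sign, and cancel.\<close>

lemma face_sign_edge_sign:
  assumes v: "v \<in> crossings D'" "v \<notin> W" and W: "W \<subseteq> crossings D'"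
  shows "face_sign (insert v W) \<otimes>\<^bsub>R\<^esub> edge_sign R (W \<union> T) v = edge_sign R W v \<otimes>\<^bsub>R\<^esub> face_sign W"
proof -
  let ?m = "\<ominus>\<^bsub>R\<^esub> \<one>\<^bsub>R\<^esub>" and ?t = "card {t \<in> T. t < v}" and ?w = "card {u \<in> W. u < v}"
    and ?s = "\<Sum>w\<in>W. card {t \<in> T. t < w}"
  have fin: "finite W" using W finite_crossings[OF link_diagram_D'] by (rule finite_subset)
  have "W \<inter> T = {}" using W by (auto simp: crossings_D')
  then have "card ({u \<in> W. u < v} \<union> {t \<in> T. t < v}) = ?w + ?t"
    using fin finite_T by (intro card_Un_disjoint) auto
  moreover have "{u \<in> W \<union> T. u < v} = {u \<in> W. u < v} \<union> {t \<in> T. t < v}" by auto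
  ultimately have "edge_sign R (W \<union> T) v = ?m [^]\<^bsub>R\<^esub> (?w + ?t)" by (simp add: edge_sign_def)
  moreover have "face_sign (insert v W) = ?m [^]\<^bsub>R\<^esub> (?t + ?s)"
    using fin v(2) by (simp add: face_sign_def)
  moreover have "(?m [^]\<^bsub>R\<^esub> (?t + ?s)) \<otimes>\<^bsub>R\<^esub> (?m [^]\<^bsub>R\<^esub> (?w + ?t)) =
      (?m [^]\<^bsub>R\<^esub> ?t \<otimes>\<^bsub>R\<^esub> ?m [^]\<^bsub>R\<^esub> ?t) \<otimes>\<^bsub>R\<^esub> (?m [^]\<^bsub>R\<^esub> ?w \<otimes>\<^bsub>R\<^esub> ?m [^]\<^bsub>R\<^esub> ?s)"
    by (simp add: nat_pow_mult ac_simps)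
  ultimately show ?thesis
    by (simp add: minus_one_pow_square edge_sign_def face_sign_def)
qed

lemma diff_coeff_face_emb:
  assumes z: "z \<in> kgens D'" and g: "g \<in> kgens D'"
  shows "face_sign (fst g) \<otimes>\<^bsub>R\<^esub> diff_coeff R D (face_emb z) (face_emb g) =
    diff_coeff R D' z g \<otimes>\<^bsub>R\<^esub> face_sign (fst z)"
proof -
  obtain W \<delta> S \<epsilon> where zg: "z = (W, \<delta>)" "g = (S, \<epsilon>)" by fastforce
  have W: "W \<inter> T = {}" "W \<subseteq> crossings D'" and S: "S \<inter> T = {}" "S \<subseteq> crossings D'"
    using z g kgens_D'_disjoint by (auto simp: zg)
  show ?thesis
  proof (cases "\<exists>v. v \<in> crossings D' \<and> v \<notin> W \<and> S = insert v W")
    case True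
    then obtain v where v: "v \<in> crossings D'" "v \<notin> W" "S = insert v W" by blast
    have vD: "v \<in> crossings D" "v \<notin> W \<union> T" using v by (auto simp: crossings_D')
    have "insert v W \<union> T = insert v (W \<union> T)" by blast
    then have "circles D' (insert v W) = circles D (insert v (W \<union> T))"
      using circles_D'[of "insert v W"] v(1) W(2) by simp
    then show ?thesis
      using face_sign_edge_sign[OF v(1,2) W(2)] circles_D'[OF W(2)]
      by (simp add: zg face_emb_def v(3) diff_coeff_insert[OF R D vD]
          diff_coeff_insert[OF R link_diagram_D' v(1,2)])
  next
    case False
    then have 1: "diff_coeff R D' z g = \<zero>\<^bsub>R\<^esub>" unfolding zg by (intro diff_coeff_eq_zero) blast
    have "diff_coeff R D (face_emb z) (face_emb g) = \<zero>\<^bsub>R\<^esub>"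
      unfolding zg face_emb_def prod.case
    proof (rule diff_coeff_eq_zero)
      fix v assume v: "v \<in> crossings D" "v \<notin> W \<union> T"
      show "S \<union> T \<noteq> insert v (W \<union> T)"
      proof
        assume eq: "S \<union> T = insert v (W \<union> T)"
        then have "S = insert v W" using v S W by blast
        moreover have "v \<in> crossings D'" using calculation S by blast
        ultimately show False using False v by blast
      qed
    qed
    then show ?thesis using 1 by simp
  qed
qed

text \<open>No term from outside the face reaches it: \<open>x\<close> vanishes on states that do
  not contain \<open>T\<close>, and a state meeting \<open>U\<close> has only edges to states
  meeting \<open>U\<close>. On the face itself the signs match.\<close>

lemma restrict_face_kdiff:
  assumes x: "x \<in> supported R {g \<in> kbasis D i j. T \<subseteq> fst g}"
  shows "restrict_face (kdiff R D x) = kdiff R D' (restrict_face x)"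
proof
  have x': "x g \<in> carrier R" "\<not> T \<subseteq> fst g \<Longrightarrow> x g = \<zero>\<^bsub>R\<^esub>" for g
    using x by (auto simp: supported_iff[OF R])
  note dc = diff_coeff_closed[OF R D] and dc' = diff_coeff_closed[OF R link_diagram_D']
  fix g
  show "restrict_face (kdiff R D x) g = kdiff R D' (restrict_face x) g"
  proof (cases "g \<in> kgens D'")
    case g: True
    let ?f = "\<lambda>z. diff_coeff R D z (face_emb g) \<otimes>\<^bsub>R\<^esub> x z"
    have f: "?f z \<in> carrier R" for z by (simp add: dc x')
    have zero: "?f z = \<zero>\<^bsub>R\<^esub>" if z: "z \<in> kgens D - face_emb ` kgens D'" for z
    proof (rule ccontr)
      assume nz: "?f z \<noteq> \<zero>\<^bsub>R\<^esub>"
      obtain W \<delta> S \<epsilon> where zg: "z = (W, \<delta>)" "face_emb g = (S, \<epsilon>)" by fastforce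
      have "diff_coeff R D (W, \<delta>) (S, \<epsilon>) \<noteq> \<zero>\<^bsub>R\<^esub>" using nz x'(1)[of z] zg by auto
      then obtain v where "S = insert v W" by (rule diff_coeff_nonzeroE[OF R D])
      then have "fst z \<inter> U = {}" using face_emb_kgens(3)[OF g] by (auto simp: zg)
      moreover have "T \<subseteq> fst z"
        by (rule ccontr) (use nz x'(2)[of z] r_null[OF dc] in simp)
      ultimately have "z \<in> face_emb ` kgens D'" using face_emb_surj[of z] z by (metis DiffD1 image_eqI)
      then show False using z by blast
    qed
    have "restrict_face (kdiff R D x) g = face_sign (fst g) \<otimes>\<^bsub>R\<^esub> (\<Oplus>\<^bsub>R\<^esub>z\<in>kgens D. ?f z)"
      using g face_emb_kgens(1)[OF g] by (simp add: restrict_face_def kdiff_def)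
    also have "(\<Oplus>\<^bsub>R\<^esub>z\<in>kgens D. ?f z) = (\<Oplus>\<^bsub>R\<^esub>z\<in>face_emb ` kgens D'. ?f z)"
      using finite_kgens[OF D] face_emb_kgens(1) zero f
      by (intro add.finprod_mono_neutral_cong_right) auto
    also have "\<dots> = (\<Oplus>\<^bsub>R\<^esub>z\<in>kgens D'. ?f (face_emb z))"
      using f by (intro finsum_reindex inj_on_face_emb) auto
    also have "face_sign (fst g) \<otimes>\<^bsub>R\<^esub> \<dots> = (\<Oplus>\<^bsub>R\<^esub>z\<in>kgens D'. face_sign (fst g) \<otimes>\<^bsub>R\<^esub> ?f (face_emb z))"
      using f finite_kgens[OF link_diagram_D'] by (intro finsum_rdistr) auto
    also have "\<dots> = (\<Oplus>\<^bsub>R\<^esub>z\<in>kgens D'. diff_coeff R D' z g \<otimes>\<^bsub>R\<^esub> restrict_face x z)"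
    proof (rule finsum_cong')
      fix z assume z: "z \<in> kgens D'"
      have "face_sign (fst g) \<otimes>\<^bsub>R\<^esub> ?f (face_emb z) =
          (face_sign (fst g) \<otimes>\<^bsub>R\<^esub> diff_coeff R D (face_emb z) (face_emb g)) \<otimes>\<^bsub>R\<^esub> x (face_emb z)"
        by (simp add: m_assoc dc x')
      also have "\<dots> = diff_coeff R D' z g \<otimes>\<^bsub>R\<^esub> restrict_face x z"
        unfolding diff_coeff_face_emb[OF z g] using z by (simp add: restrict_face_def m_assoc dc' x')
      finally show "face_sign (fst g) \<otimes>\<^bsub>R\<^esub> ?f (face_emb z) = diff_coeff R D' z g \<otimes>\<^bsub>R\<^esub> restrict_face x z" .
    qed (auto simp: restrict_face_def dc' x')
    also have "\<dots> = kdiff R D' (restrict_face x) g" using g by (simp add: kdiff_def)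
    finally show ?thesis .
  next
    case False
    then show ?thesis by (simp add: restrict_face_def kdiff_def)
  qed
qed

end

section \<open>Crossing counts and degree shifts of the resolved diagrams\<close>

lemma res_1_resolution:
  "vertices (res_1 D c k) = vertices D" "glue (res_1 D c k) = glue D"
  "resolved (res_1 D c k) = (\<lambda>w. if w \<in> c ` {1..k} then Some True else resolved D w)"
proof (induction k)
  case (Suc k)
  {
    case 3
    have "{1..Suc k} = insert (Suc k) {1..k}" by auto
    then show ?case using Suc(3) by (auto simp: resolve_def fun_eq_iff)
  }
qed (simp_all add: resolve_def)

lemma res_0_resolution:
  assumes "inj_on c {1..m}" "k < m"
  shows "vertices (res_0 D c (Suc k)) = vertices D" "glue (res_0 D c (Suc k)) = glue D"
  "resolved (res_0 D c (Suc k)) = (\<lambda>w. if w \<in> c ` {1..k} then Some True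
     else if w \<in> {c (Suc k)} then Some False else resolved D w)"
proof -
  have "c (Suc k) \<notin> c ` {1..k}"
    using assms by (auto dest!: inj_onD)
  then show "resolved (res_0 D c (Suc k)) = (\<lambda>w. if w \<in> c ` {1..k} then Some True
     else if w \<in> {c (Suc k)} then Some False else resolved D w)"
    by (auto simp: resolve_def res_1_resolution fun_eq_iff)
qed (simp_all add: resolve_def res_1_resolution)

lemma n_pos_plus_n_neg:
  assumes "finite (crossings D)"
  shows "n_pos D \<omega> + n_neg D \<omega> = int (card (crossings D))"
proof -
  have "card {v \<in> crossings D. positive_crossing \<omega> v} + card {v \<in> crossings D. \<not> positive_crossing \<omega> v}
      = card (crossings D)"
    using assms by (subst card_Un_disjoint[symmetric]) (auto intro: arg_cong[where f = card])
  then show ?thesis by (simp add: n_pos_def n_neg_def)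
qed

lemma n_neg_remove:
  assumes "finite (crossings D)" "v \<in> crossings D" "crossings D' = crossings D - {v}"
  shows "n_neg D' \<omega> = n_neg D \<omega> - (if positive_crossing \<omega> v then 0 else 1)"
proof (cases "positive_crossing \<omega> v")
  case True
  then have "{w \<in> crossings D'. \<not> positive_crossing \<omega> w} = {w \<in> crossings D. \<not> positive_crossing \<omega> w}"
    using assms(3) by auto
  then show ?thesis using True by (simp add: n_neg_def)
next
  case False
  then have "{w \<in> crossings D'. \<not> positive_crossing \<omega> w} = {w \<in> crossings D. \<not> positive_crossing \<omega> w} - {v}"
    using assms(3) by auto
  moreover have "v \<in> {w \<in> crossings D. \<not> positive_crossing \<omega> w}" using False assms(2) by simp
  moreover have "finite {w \<in> crossings D. \<not> positive_crossing \<omega> w}" using assms(1) by simp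
  ultimately have "card {w \<in> crossings D. \<not> positive_crossing \<omega> w} =
      Suc (card {w \<in> crossings D'. \<not> positive_crossing \<omega> w})"
    using card_Suc_Diff1 by metis
  then show ?thesis using False by (simp add: n_neg_def)
qed

context
  fixes D :: diagram and m :: nat and c :: "nat \<Rightarrow> nat" and \<omega> \<omega>' :: "nat \<Rightarrow> orient"
  assumes D: "link_diagram D" and inj: "inj_on c {1..m}" and c: "c ` {1..m} \<subseteq> crossings D"
    and tower: "tower_orientations D c m \<omega> \<omega>'"
begin

lemma crossings_res_1: "crossings (res_1 D c k) = crossings D - c ` {1..k}"
  by (auto simp: crossings_def res_1_resolution split: if_splits)

lemma crossings_res_0:
  assumes "k < m"
  shows "crossings (res_0 D c (Suc k)) = crossings D - c ` {1..k} - {c (Suc k)}"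
  by (auto simp: crossings_def res_0_resolution[OF inj assms] simp del: res_0.simps split: if_splits)

lemma c_Suc_mem:
  assumes "k < m"
  shows "c (Suc k) \<in> crossings D - c ` {1..k}"
  using assms inj c by (auto dest!: inj_onD)

lemma card_c_image: "k \<le> m \<Longrightarrow> card (c ` {1..k}) = k"
  using inj_on_subset[OF inj, of "{1..k}"] by (simp add: card_image)

lemma crossings_res_Suc:
  assumes "k < m"
  shows "crossings (res_1 D c (Suc k)) = crossings (res_1 D c k) - {c (Suc k)}"
    "crossings (res_0 D c (Suc k)) = crossings (res_1 D c k) - {c (Suc k)}"
    "c (Suc k) \<in> crossings (res_1 D c k)" "finite (crossings (res_1 D c k))"
proof -
  have "{1..Suc k} = insert (Suc k) {1..k}" by auto
  then show "crossings (res_1 D c (Suc k)) = crossings (res_1 D c k) - {c (Suc k)}"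
    unfolding crossings_res_1 by auto
  show "crossings (res_0 D c (Suc k)) = crossings (res_1 D c k) - {c (Suc k)}"
    unfolding crossings_res_1 crossings_res_0[OF assms] by simp
  show "c (Suc k) \<in> crossings (res_1 D c k)" unfolding crossings_res_1 by (rule c_Suc_mem[OF assms])
  show "finite (crossings (res_1 D c k))"
    unfolding crossings_res_1 using finite_crossings[OF D] by simp
qed

lemma tower_step:
  assumes "k < m"
  shows "positive_crossing (\<omega> k) (c (Suc k)) \<Longrightarrow> \<omega>' (Suc k) = \<omega> k"
    "\<not> positive_crossing (\<omega> k) (c (Suc k)) \<Longrightarrow> \<omega> (Suc k) = \<omega> k"
proof -
  have "Suc k \<in> {1..m}" using assms by simp
  then have "if positive_crossing (\<omega> (Suc k - 1)) (c (Suc k)) then \<omega>' (Suc k) = \<omega> (Suc k - 1)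
      else \<omega> (Suc k) = \<omega> (Suc k - 1)"
    using tower unfolding tower_orientations_def by blast
  then show "positive_crossing (\<omega> k) (c (Suc k)) \<Longrightarrow> \<omega>' (Suc k) = \<omega> k"
    "\<not> positive_crossing (\<omega> k) (c (Suc k)) \<Longrightarrow> \<omega> (Suc k) = \<omega> k"
    by simp_all
qed

text \<open>At a negative crossing the orientation is inherited and exactly one negative crossing is
  lost, so the expression for the positive case gives 0 there as well. The single expression can be
  summed by telescoping.\<close>

lemma a_const_eq:
  assumes "k < m"
  shows "a_const D c \<omega> (Suc k) = n_neg (res_1 D c k) (\<omega> k) - n_neg (res_1 D c (Suc k)) (\<omega> (Suc k)) - 1"
  using n_neg_remove[OF crossings_res_Suc(4,3,1)[OF assms], of "\<omega> k"] tower_step(2)[OF assms]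
  by (simp add: a_const_def del: res_1.simps)

text \<open>At a positive crossing the inherited orientation loses no negative crossing, so the
  difference is 0 and again one expression covers both cases.\<close>

lemma a_tilde_eq:
  assumes "k < m"
  shows "a_tilde D c \<omega> \<omega>' (Suc k) = n_neg (res_1 D c k) (\<omega> k) - n_neg (res_0 D c (Suc k)) (\<omega>' (Suc k))"
  using n_neg_remove[OF crossings_res_Suc(4,3,2)[OF assms], of "\<omega> k"] tower_step(1)[OF assms]
  by (simp add: a_tilde_def del: res_1.simps res_0.simps)

lemma A_const_eq: "k \<le> m \<Longrightarrow> A_const D c \<omega> k = n_neg D (\<omega> 0) - n_neg (res_1 D c k) (\<omega> k) - int k"
proof (induction k)
  case (Suc k)
  have "A_const D c \<omega> (Suc k) = A_const D c \<omega> k + a_const D c \<omega> (Suc k)"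
    by (simp add: A_const_def)
  then show ?case using Suc a_const_eq[of k] by (simp del: res_1.simps)
qed (simp add: A_const_def)

lemma B_const_eq: "B_const D c \<omega> k = 3 * A_const D c \<omega> k + int k"
  by (simp add: B_const_def A_const_def b_const_def sum.distrib sum_distrib_left)

text \<open>The total number of crossings is independent of orientation, so
  \<open>\<omega>\<^sub>0\<close> and \<open>\<omega>\<^sub>1\<close> may be arbitrary. This
  eliminates the positive crossings from the quantum shifts.\<close>

lemma n_total_res:
  shows "k \<le> m \<Longrightarrow> n_pos (res_1 D c k) \<omega>\<^sub>1 + n_neg (res_1 D c k) \<omega>\<^sub>1 = n_pos D \<omega>\<^sub>0 + n_neg D \<omega>\<^sub>0 - int k"
    and "k < m \<Longrightarrow> n_pos (res_0 D c (Suc k)) \<omega>\<^sub>1 + n_neg (res_0 D c (Suc k)) \<omega>\<^sub>1 =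
      n_pos D \<omega>\<^sub>0 + n_neg D \<omega>\<^sub>0 - int k - 1"
proof -
  note fin = finite_crossings[OF D]
  have le: "card (crossings (res_1 D c k)) + k = card (crossings D)" if "k \<le> m" for k
  proof -
    have "c ` {1..k} \<subseteq> crossings D" using c that by force
    then show ?thesis
      using card_Diff_subset[of "c ` {1..k}" "crossings D"] card_mono[OF fin, of "c ` {1..k}"] card_c_image[OF that]
      by (simp add: crossings_res_1)
  qed
  have fin1: "finite (crossings (res_1 D c k))" for k using fin by (simp add: crossings_res_1)
  show "n_pos (res_1 D c k) \<omega>\<^sub>1 + n_neg (res_1 D c k) \<omega>\<^sub>1 = n_pos D \<omega>\<^sub>0 + n_neg D \<omega>\<^sub>0 - int k" if "k \<le> m"
    using n_pos_plus_n_neg[OF fin1, of k \<omega>\<^sub>1] n_pos_plus_n_neg[OF fin, of \<omega>\<^sub>0] le[OF that] by linarith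
  assume k: "k < m"
  then have "crossings (res_0 D c (Suc k)) = crossings (res_1 D c (Suc k))"
    using crossings_res_Suc(1,2) by simp
  then have "n_pos (res_0 D c (Suc k)) \<omega>\<^sub>1 + n_neg (res_0 D c (Suc k)) \<omega>\<^sub>1 = int (card (crossings (res_1 D c (Suc k))))"
    using n_pos_plus_n_neg[of "res_0 D c (Suc k)" \<omega>\<^sub>1] fin1[of "Suc k"] by simp
  then show "n_pos (res_0 D c (Suc k)) \<omega>\<^sub>1 + n_neg (res_0 D c (Suc k)) \<omega>\<^sub>1 =
      n_pos D \<omega>\<^sub>0 + n_neg D \<omega>\<^sub>0 - int k - 1"
    using n_pos_plus_n_neg[OF fin, of \<omega>\<^sub>0] le[of "Suc k"] k by linarith
qed

end

text \<open>\<open>nat s\<close> identifies all negative levels with level 0. The condition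
  \<open>s \<le> int m\<close> empties the levels beyond the last numbered crossing, where values of
  \<open>c\<close> would have no meaning.\<close>

definition level_basis :: "diagram \<Rightarrow> orient \<Rightarrow> (nat \<Rightarrow> nat) \<Rightarrow> nat \<Rightarrow> int \<Rightarrow> int \<Rightarrow> int \<Rightarrow> kgen set" where
  "level_basis D \<omega> c m j s n =
     {g \<in> kbasis D (n + n_neg D \<omega>) (j - n_pos D \<omega> + 2 * n_neg D \<omega>). c ` {1..nat s} \<subseteq> fst g \<and> s \<le> int m}"

lemma filtered_complex_khovanov:
  assumes R: "cring R" and D: "link_diagram D"
  shows "filtered_complex R (chain_module R) (kdiff R D) (\<lambda>s n. supported R (level_basis D \<omega> c m j s n)) (int m)"
proof (rule filtered_complex.intro)
  show "module R (chain_module R)" by (rule module_chain_module[OF R])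
  show "kdiff R D \<in> module_hom R (chain_module R) (chain_module R)" by (rule kdiff_module_hom[OF R D])
  show "kdiff R D (kdiff R D x) = \<zero>\<^bsub>chain_module R\<^esub>" if "x \<in> carrier (chain_module R)" for x
    using kdiff_kdiff[OF R D, of x] that by (simp add: chain_module_simps)
  show "submodule (supported R (level_basis D \<omega> c m j s n)) R (chain_module R)" for s n
    by (rule submodule_supported[OF R])
  show "supported R (level_basis D \<omega> c m j (s + 1) n) \<subseteq> supported R (level_basis D \<omega> c m j s n)" for s n
  proof (rule supported_mono[OF R])
    have "c ` {1..nat s} \<subseteq> c ` {1..nat (s + 1)}" by (intro image_mono) auto
    then show "level_basis D \<omega> c m j (s + 1) n \<subseteq> level_basis D \<omega> c m j s n"
      unfolding level_basis_def by auto
  qed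
  show "kdiff R D x \<in> supported R (level_basis D \<omega> c m j s (n + 1))"
    if "x \<in> supported R (level_basis D \<omega> c m j s n)" for s n x
  proof (rule kdiff_supported[OF R D that])
    fix y z assume y: "y \<in> level_basis D \<omega> c m j s n" and z: "z \<in> kgens D" and nz: "diff_coeff R D y z \<noteq> \<zero>\<^bsub>R\<^esub>"
    have "y \<in> kbasis D (n + n_neg D \<omega>) (j - n_pos D \<omega> + 2 * n_neg D \<omega>)" using y by (simp add: level_basis_def)
    from diff_coeff_kbasis[OF R D this z nz] show "z \<in> level_basis D \<omega> c m j s (n + 1)"
      using y by (auto simp: level_basis_def algebra_simps)
  qed
  show "supported R (level_basis D \<omega> c m j s n) = supported R (level_basis D \<omega> c m j 0 n)" if "s \<le> 0" for s n
    using that by (simp add: level_basis_def)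
  show "supported R (level_basis D \<omega> c m j s n) = {\<zero>\<^bsub>chain_module R\<^esub>}" if "s > int m" for s n
  proof -
    interpret cring R by (rule R)
    have "level_basis D \<omega> c m j s n = {}" using that by (simp add: level_basis_def)
    then show ?thesis by (auto simp: supported_iff[OF R] chain_module_simps)
  qed
qed

text \<open>Treats both kinds of column: \<open>U\<close> holds the next crossing, or is empty in
  the last column. The hypotheses on \<open>i\<close> and \<open>j'\<close> say that the normalised
  degrees of both diagrams name the same basis elements once the \<open>s\<close> fixed 1-smoothings
  are subtracted from both gradings.\<close>

lemma khovanov_page_one:
  fixes s :: nat
  assumes R: "cring R" and D: "link_diagram D" and sm: "s \<le> m"
    and res: "resolution R D D' (c ` {1..s}) U" and U_eq: "U = (if s < m then {c (Suc s)} else {})"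
    and cardT: "card (c ` {1..s}) = s"
    and i: "i + n_neg D' \<omega>' = n + n_neg D \<omega> - int s"
    and j': "j' - n_pos D' \<omega>' + 2 * n_neg D' \<omega>' = j - n_pos D \<omega> + 2 * n_neg D \<omega> - int s"
  shows "module_iso R (filtered_complex.page (chain_module R) (kdiff R D)
      (\<lambda>s n. supported R (level_basis D \<omega> c m j s n)) 1 (int s) n) (KH R D' \<omega>' i j')"
proof -
  interpret F: filtered_complex R "chain_module R" "kdiff R D"
      "\<lambda>s n. supported R (level_basis D \<omega> c m j s n)" "int m"
    by (rule filtered_complex_khovanov[OF R D])
  interpret resolution R D D' "c ` {1..s}" U by (rule res)
  let ?T = "c ` {1..s}" and ?J = "j - n_pos D \<omega> + 2 * n_neg D \<omega>"
  have level: "level_basis D \<omega> c m j (int s) n = {g \<in> kbasis D (n + n_neg D \<omega>) ?J. ?T \<subseteq> fst g}" for n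
    using sm by (simp add: level_basis_def)
  \<comment> \<open>For \<open>s = m\<close> both sides are empty: no state meets the empty
    \<open>U\<close>, and level \<open>m + 1\<close> is cut off.\<close>
  have level1: "level_basis D \<omega> c m j (int s + 1) n =
      {g \<in> kbasis D (n + n_neg D \<omega>) ?J. ?T \<subseteq> fst g \<and> fst g \<inter> U \<noteq> {}}" for n
  proof (cases "s < m")
    case True
    have n: "nat (int s + 1) = Suc s" by simp
    have "{1..Suc s} = insert (Suc s) {1..s}" by auto
    then show ?thesis using True unfolding level_basis_def n U_eq by auto
  next
    case False
    then show ?thesis using sm by (simp add: level_basis_def U_eq)
  qed
  let ?C = "\<lambda>n. supported R (kbasis D' (n + n_neg D \<omega> - int s) (?J - int s))"
  have "module_iso R (F.page 1 (int s) n)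
      (quotient_module ((chain_module R)\<lparr>carrier := {y \<in> ?C n. kdiff R D' y = \<zero>\<^bsub>chain_module R\<^esub>}\<rparr>)
        (kdiff R D' ` ?C (n - 1)))"
  proof (rule F.module_iso_page_one[where \<pi> = restrict_face])
    show "module R (chain_module R)" by (rule module_chain_module[OF R])
    show "kdiff R D' \<in> module_hom R (chain_module R) (chain_module R)"
      by (rule kdiff_module_hom[OF R link_diagram_D'])
    show "submodule (?C n) R (chain_module R)" for n by (rule submodule_supported[OF R])
    show "restrict_face \<in> module_hom R (chain_module R) (chain_module R)" by (rule restrict_face_hom)
    show "restrict_face ` supported R (level_basis D \<omega> c m j (int s) n) = ?C n" for n
      using restrict_face_image[of "n + n_neg D \<omega>" ?J] unfolding level cardT .
    fix n x assume x: "x \<in> supported R (level_basis D \<omega> c m j (int s) n)"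
    show "restrict_face x = \<zero>\<^bsub>chain_module R\<^esub> \<longleftrightarrow> x \<in> supported R (level_basis D \<omega> c m j (int s + 1) n)"
      unfolding level1 by (rule restrict_face_eq_zero_iff) (use x in \<open>simp add: level\<close>)
    show "restrict_face (kdiff R D x) = kdiff R D' (restrict_face x)"
      by (rule restrict_face_kdiff) (use x in \<open>simp add: level\<close>)
  qed
  moreover have "n - 1 + n_neg D \<omega> - int s = i - 1 + n_neg D' \<omega>'" using i by simp
  ultimately show ?thesis unfolding KH_eq i j' by simp
qed

theorem proposition2p2:
  fixes R :: "('r, 'b) ring_scheme"
    and D :: diagram and m :: nat and c :: "nat \<Rightarrow> nat"
    and \<omega> \<omega>' :: "nat \<Rightarrow> orient" and j :: int
  assumes "cring R"
    and "link_diagram D"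
    and "m \<ge> 1"
    and "inj_on c {1..m}" and "c ` {1..m} \<subseteq> crossings D"
    and "tower_orientations D c m \<omega> \<omega>'"
  shows "\<exists>(E :: nat \<Rightarrow> int \<Rightarrow> int \<Rightarrow> ('r, (kgen \<Rightarrow> 'r) set) module) d.
    spectral_sequence R E d \<and>
    converges_to R E d (\<lambda>n. KH R D (\<omega> 0) n j) \<and>
    (\<forall>s<m. \<forall>t.
       module_iso R (E 1 (int s) t)
         (KH R (res_0 D c (s + 1)) (\<omega>' (s + 1))
            (int s + t + A_const D c \<omega> s + a_tilde D c \<omega> \<omega>' (s + 1))
            (j + B_const D c \<omega> s + b_tilde D c \<omega> \<omega>' (s + 1)))) \<and>
    (\<forall>t.
       module_iso R (E 1 (int m) t)
         (KH R (res_1 D c m) (\<omega> m)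
            (int m + t + A_const D c \<omega> m) (j + B_const D c \<omega> m))) \<and>
    (\<forall>s t. s < 0 \<or> s > int m \<longrightarrow> carrier (E 1 s t) = {\<zero>\<^bsub>E 1 s t\<^esub>})"
proof -
  note R = assms(1) and D = assms(2) and inj = assms(4) and c = assms(5) and tower = assms(6)
  interpret F: filtered_complex R "chain_module R" "kdiff R D"
      "\<lambda>s n. supported R (level_basis D (\<omega> 0) c m j s n)" "int m"
    by (rule filtered_complex_khovanov[OF R D])
  note A = A_const_eq[OF D inj c tower] and at = a_tilde_eq[OF D inj c tower]
    and total = n_total_res[OF D inj c tower]
  \<comment> \<open>Level 0 imposes no condition, so it is the full complex of \<open>D\<close> in
    quantum degree \<open>j\<close>.\<close>
  have H: "F.hom_page n = KH R D (\<omega> 0) n j" for n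
    unfolding F.hom_page_def KH_eq by (simp add: level_basis_def)
  have "converges_to R F.ss_page F.ss_diff (\<lambda>n. KH R D (\<omega> 0) n j)"
    using F.converges_to_hom_page unfolding H[abs_def] .
  moreover have "module_iso R (F.ss_page 1 (int s) t)
         (KH R (res_0 D c (s + 1)) (\<omega>' (s + 1))
            (int s + t + A_const D c \<omega> s + a_tilde D c \<omega> \<omega>' (s + 1))
            (j + B_const D c \<omega> s + b_tilde D c \<omega> \<omega>' (s + 1)))" if s: "s < m" for s t
  proof -
    have mem: "c (Suc s) \<in> crossings D - c ` {1..s}" by (rule c_Suc_mem[OF D inj c tower s])
    have sub: "c ` {1..s} \<subseteq> crossings D" using c s by force
    have res: "resolution R D (res_0 D c (Suc s)) (c ` {1..s}) {c (Suc s)}"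
      using R D mem sub res_0_resolution[OF inj s, of D] by (intro resolution.intro) (simp_all del: res_0.simps)
    \<comment> \<open>The sum of \<open>A_const\<close> and \<open>a_tilde\<close> is the drop in
      negative crossings from \<open>D\<close> to the resolved diagram, minus \<open>s\<close>. In
      the quantum degree three times this sum meets a loss of \<open>s + 1\<close> crossings; the
      0-smoothed one accounts for the \<open>-1\<close> in \<open>b_tilde\<close>.\<close>
    show ?thesis
      unfolding F.ss_page_def Suc_eq_plus1[symmetric] of_nat_1
      by (rule khovanov_page_one[OF R D _ res])
        (use s card_c_image[OF D inj c tower, of s] A[of s] at[OF s] total(2)[OF s, of "\<omega>' (Suc s)" "\<omega> 0"]
          in \<open>simp_all add: B_const_eq[OF D inj c tower] b_tilde_def del: res_0.simps res_1.simps\<close>)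
  qed
  moreover have "module_iso R (F.ss_page 1 (int m) t)
         (KH R (res_1 D c m) (\<omega> m)
            (int m + t + A_const D c \<omega> m) (j + B_const D c \<omega> m))" for t
  proof -
    have res: "resolution R D (res_1 D c m) (c ` {1..m}) {}"
      using R D c res_1_resolution[of D c m] by (intro resolution.intro) (simp_all add: fun_eq_iff)
    \<comment> \<open>Here exactly \<open>m\<close> crossings disappear, and \<open>A_const\<close>
      and \<open>B_const\<close> alone balance the two degrees.\<close>
    show ?thesis
      unfolding F.ss_page_def of_nat_1
      by (rule khovanov_page_one[OF R D _ res])
        (use card_c_image[OF D inj c tower, of m] A[of m] total(1)[of m "\<omega> m" "\<omega> 0"]
          in \<open>simp_all add: B_const_eq[OF D inj c tower]\<close>)
  qed
  moreover have "carrier (F.ss_page 1 s t) = {\<zero>\<^bsub>F.ss_page 1 s t\<^esub>}" if "s < 0 \<or> s > int m" for s t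
    unfolding F.ss_page_def of_nat_1 by (rule F.carrier_page_one_outside[OF that])
  ultimately show ?thesis using F.spectral_sequence_ss by blast
qed

end
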